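(* Fix constants $q>3$, $C>0$ and $b>0$ not depending on $n$. For each $n$ let $p=p_n$ be a positive integer, and let $X_1,\dots,X_n$ be i.i.d. random vectors in $\mathbb{R}^p$, $X_i=(X_{i1},\dots,X_{ip})^\top$, whose common distribution may depend on $n$, with mean vector $\mu=\mathbb{E}X_i$ and covariance matrix $\Sigma=\mathrm{Cov}(X_i)$. Assume that $$\max_{j\le p}\mathbb{E}|X_{ij}|^q\le C\qquad\text{and}\qquad \mathrm{Var}(X_{ij})\ge b\ \text{ for all } j=1,\dots,p.$$ Let $\hat\mu=\frac1n\sum_{i=1}^n X_i$ and let $Y=(Y_1,\dots,Y_p)^\top$ be a centered Gaussian vector in $\mathbb{R}^p$ with $\mathrm{Cov}(Y)=\Sigma$. If, as $n\to\infty$, $$p(\log p)^{3q/2-1}=o(n^{q/2-1}),$$ then, as $n\to\infty$, $$\rho_n:=\sup_{t\in\mathbb{R}}\Big|\mathbb{P}\big(\sqrt n\,|\hat\mu-\mu|_\infty\le t\big)-\mathbb{P}\big(|Y|_\infty\le t\big)\Big|\to 0.$$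
   Context: For $x=(x_1,\dots,x_p)^\top\in\mathbb{R}^p$, $|x|_\infty=\max_{j\le p}|x_j|$. The setting is a triangular array: the dimension $p=p_n$ (possibly tending to infinity), the distribution of the $X_i$, $\mu$, $\Sigma$ and $Y$ may all depend on $n$, while $q$, $C$ and $b$ are fixed. *)

theory Defs
  imports "HOL-Probability.Probability" "HOL-Library.Landau_Symbols"
begin

text \<open>
  As the dimension of a triangular array varies with the sample size, a vector of dimension
  \<open>p\<close> is represented by its coordinates \<open>x 1, \<dots>, x p\<close> for a function \<open>x\<close> on \<open>nat\<close>. A random
  vector of dimension \<open>p\<close> is a random element of the following product space (whose points are
  fixed to \<open>undefined\<close> outside \<open>{1..p}\<close>, so that they correspond bijectively to \<open>p\<close>-tuples).
\<close>

abbreviation vec_space :: "nat \<Rightarrow> (nat \<Rightarrow> real) measure" where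
  "vec_space p \<equiv> Pi\<^sub>M {1..p} (\<lambda>_. borel)"

text \<open>Only meant for \<open>p \<ge> 1\<close>.\<close>

definition max_norm :: "nat \<Rightarrow> (nat \<Rightarrow> real) \<Rightarrow> real" where
  "max_norm p x = (MAX j\<in>{1..p}. \<bar>x j\<bar>)"

definition covariance :: "'a measure \<Rightarrow> ('a \<Rightarrow> real) \<Rightarrow> ('a \<Rightarrow> real) \<Rightarrow> real" where
  "covariance M U V =
     (\<integral>\<omega>. (U \<omega> - (\<integral>\<omega>'. U \<omega>' \<partial>M)) * (V \<omega> - (\<integral>\<omega>'. V \<omega>' \<partial>M)) \<partial>M)"

text \<open>The constants count as Gaussian, so that singular covariance matrices are allowed.\<close>

definition gaussian_variable :: "'a measure \<Rightarrow> ('a \<Rightarrow> real) \<Rightarrow> bool" where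
  "gaussian_variable M Z \<longleftrightarrow>
     Z \<in> borel_measurable M \<and>
     ((\<exists>m \<sigma>. \<sigma> > 0 \<and> distributed M lborel Z (normal_density m \<sigma>)) \<or>
      (\<exists>m. AE \<omega> in M. Z \<omega> = m))"

definition gaussian_vector :: "'a measure \<Rightarrow> nat \<Rightarrow> ('a \<Rightarrow> nat \<Rightarrow> real) \<Rightarrow> bool" where
  "gaussian_vector M p Y \<longleftrightarrow>
     Y \<in> measurable M (vec_space p) \<and>
     (\<forall>a. gaussian_variable M (\<lambda>\<omega>. \<Sum>j=1..p. a j * Y \<omega> j))"

definition sample_mean :: "nat \<Rightarrow> (nat \<Rightarrow> 'a \<Rightarrow> nat \<Rightarrow> real) \<Rightarrow> 'a \<Rightarrow> nat \<Rightarrow> real" where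
  "sample_mean n X \<omega> j = 1 / real n * (\<Sum>i=1..n. X i \<omega> j)"

end

theory Submission
  imports Defs "HOL-Real_Asymp.Real_Asymp"
begin

text \<open>
  Write \<open>l = 1 + ln p\<close>. The growth condition is exactly what makes truncating all coordinates at
  \<open>\<tau> = sqrt n / \<beta>\<close>, with \<open>\<beta>\<close> of order \<open>l powr (3/2)\<close>, harmless: the truncation changes the
  normalised sum by \<open>o(1 / sqrt l)\<close> in mean, uniformly over the coordinates, and the maximum norm of a
  Gaussian vector puts mass \<open>O(\<delta> sqrt l)\<close> on an interval of length \<open>\<delta>\<close>.

  The truncated sum is compared with \<open>Y\<close> by Lindeberg's method, with test function \<open>exp (- S)\<close> where
  \<open>S = (\<Sum>j\<le>p. exp (\<beta> (x\<^sub>j - t)) + exp (\<beta> (- x\<^sub>j - t)))\<close>. Along a jump \<open>z\<close> with \<open>\<beta> \<bar>z\<bar>\<^sub>\<infinity> \<le> 2\<close> its third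
  derivative is at most a constant times
  \<open>\<beta>\<^sup>3 exp (- c S) (\<Sum>j\<le>p. exp (\<beta> (\<bar>x\<^sub>j\<bar> - t)) \<bar>z\<^sub>j\<bar>\<^sup>3)\<close>, so that
  only \<open>max\<^sub>j E \<bar>z\<^sub>j\<bar>\<^sup>3\<close> enters and the error is of order \<open>\<beta>\<^sup>3 / sqrt n\<close>. Powers of \<open>l\<close> are free
  here, because \<open>p \<le> n powr (q/2 - 1)\<close> eventually.

  For the anti-concentration of \<open>max\<^sub>j Z\<^sub>j\<close>, split according to the first maximiser \<open>j\<close> of the standardised
  coordinates. The part of the vector uncorrelated with \<open>Z\<^sub>j\<close> is independent of it, and given that part
  the event is an upper set in \<open>Z\<^sub>j\<close>; the Gaussian hazard rate then bounds the probability of an interval by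
  its length times the probability of the whole cell, and the cells are disjoint.
\<close>

subsection \<open>Uniqueness of characteristic functions on finite products\<close>

text \<open>The test function is \<open>exp (- S)\<close> because its derivatives are polynomials in
  weighted power sums, and \<open>exp (- S)\<close> absorbs every power of the total weight. So a
  Lindeberg step does not pay for the number of coordinates as long as the jumps stay in the Taylor
  range. The Gaussian jumps do not; for them a moment of integer order \<open>m > q\<close> is paid
  once per coordinate, which is affordable as \<open>p\<close> is at most polynomial in
  \<open>n\<close>.

  A free constant \<open>K\<close> separates two kinds of error. With
  \<open>\<beta> = K\<^sup>2 * l powr (3 / 2)\<close> and
  \<open>\<delta> = 1 / (K * sqrt l)\<close>, smoothing and truncation move the threshold by a
  multiple of \<open>1 / (K * sqrt l)\<close>, which anti-concentration turns into a multiple of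
  \<open>1 / K\<close>, whatever \<open>n\<close> is. Apart from \<open>exp (- K)\<close>, all other
  errors vanish for fixed \<open>K\<close> as \<open>n\<close> grows. The binding one is the
  truncation probability: \<open>p * sqrt n * \<tau> powr (1 - q) / \<delta>\<close> is a constant
  times \<open>p * l powr (3 * q / 2 - 1) * n powr (1 - q / 2)\<close>.

  As \<Sigma> may be singular, Gaussian laws are handled through characteristic functions instead of
  densities on the product space, and resampling one coordinate takes the place of
  conditioning.\<close>

abbreviation borel_on :: "'i set \<Rightarrow> ('i \<Rightarrow> real) measure" where
  "borel_on I \<equiv> PiM I (\<lambda>_. borel)"

lemma iexp_scaled_std_normal:
  fixes s :: real
  shows "(\<integral>t. iexp (s * t) \<partial>std_normal_distribution) = complex_of_real (exp (- (s\<^sup>2) / 2))"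
  using fun_cong[OF char_std_normal_distribution, of s] by (simp add: char_def)

text \<open>Substituting \<open>x = y + u / r\<close> turns the bump into a normal density:
  integrating against it smooths \<open>c\<close> by normal noise of standard deviation
  \<open>1 / r\<close>.\<close>

lemma integral_gaussian_bump:
  fixes c :: "real \<Rightarrow> real" and r y :: real
  assumes [measurable]: "c \<in> borel_measurable borel" and c: "\<And>x. 0 \<le> c x" "\<And>x. c x \<le> 1" and r: "r > 0"
  shows "(\<integral>\<^sup>+x. ennreal (c x * exp (- ((r * (x - y))\<^sup>2) / 2)) \<partial>lborel) =
    ennreal (sqrt (2 * pi) / r) * ennreal (\<integral>u. c (y + u / r) \<partial>std_normal_distribution)"
proof -
  interpret SN: prob_space std_normal_distribution by (rule prob_space_normal_density) simp
  have "(\<integral>\<^sup>+x. ennreal (c x * exp (- ((r * (x - y))\<^sup>2) / 2)) \<partial>lborel) =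
      ennreal (1 / r) * (\<integral>\<^sup>+u. ennreal (c (y + u / r) * exp (- (u\<^sup>2) / 2)) \<partial>lborel)"
    by (subst nn_integral_real_affine[where c="1/r" and t=y]) (use r in \<open>auto simp: field_simps\<close>)
  also have "(\<integral>\<^sup>+u. ennreal (c (y + u / r) * exp (- (u\<^sup>2) / 2)) \<partial>lborel) =
      (\<integral>\<^sup>+u. ennreal (sqrt (2 * pi)) * (ennreal (std_normal_density u) * ennreal (c (y + u / r))) \<partial>lborel)"
    by (intro nn_integral_cong)
      (auto simp: std_normal_density_def ennreal_mult'[symmetric] c field_simps)
  also have "\<dots> = ennreal (sqrt (2 * pi)) * (\<integral>\<^sup>+u. ennreal (c (y + u / r)) \<partial>std_normal_distribution)"
    by (subst nn_integral_cmult) (auto simp: nn_integral_density)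
  also have "(\<integral>\<^sup>+u. ennreal (c (y + u / r)) \<partial>std_normal_distribution) =
      ennreal (\<integral>u. c (y + u / r) \<partial>std_normal_distribution)"
    by (intro nn_integral_eq_integral SN.integrable_const_bound[where B=1]) (auto simp: c)
  finally show ?thesis
    using r by (simp add: mult.assoc[symmetric] ennreal_mult'[symmetric])
qed

locale equal_characteristic_functions =
  fixes I :: "'i set" and P Q :: "('i \<Rightarrow> real) measure"
  assumes I: "finite I" and P: "prob_space P" "sets P = sets (borel_on I)"
    and Q: "prob_space Q" "sets Q = sets (borel_on I)"
    and char: "\<And>a. (\<integral>y. iexp (\<Sum>i\<in>I. a i * y i) \<partial>P) = (\<integral>y. iexp (\<Sum>i\<in>I. a i * y i) \<partial>Q)"
begin

text \<open>The Gaussian bump \<open>exp (- s\<^sup>2 / 2)\<close> is itself a characteristic function, hence a mixture of the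
  functions \<open>y \<mapsto> iexp (a \<bullet> y)\<close> whose integrals are given.\<close>

lemma gaussian_bumps_eq:
  shows "(\<integral>y. (\<Prod>i\<in>I. exp (- ((r * (x i - y i))\<^sup>2) / 2)) \<partial>P) =
    (\<integral>y. (\<Prod>i\<in>I. exp (- ((r * (x i - y i))\<^sup>2) / 2)) \<partial>Q)"
proof -
  let ?bump = "\<lambda>y. \<Prod>i\<in>I. exp (- ((r * (x i - y i))\<^sup>2) / 2)"
  let ?N = "PiM I (\<lambda>_. std_normal_distribution)"
  interpret SN: product_prob_space "\<lambda>_. std_normal_distribution" I
    by (intro product_prob_spaceI) (rule prob_space_normal_density, simp)
  have expand: "complex_of_real (\<integral>y. (?bump y) \<partial>R) =
      (\<integral>t. iexp (\<Sum>i\<in>I. r * t i * x i) * (\<integral>y. iexp (\<Sum>i\<in>I. (- r * t i) * y i) \<partial>R) \<partial>?N)"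
    if R: "prob_space R" and sR[measurable_cong]: "sets R = sets (borel_on I)"
    for R :: "('i \<Rightarrow> real) measure"
  proof -
    interpret R: prob_space R by fact
    interpret RN: pair_prob_space R ?N ..
    have sN[measurable_cong]: "sets ?N = sets (borel_on I)"
      by (intro sets_PiM_cong) auto
    have "complex_of_real (\<integral>y. (?bump y) \<partial>R) =
        (\<integral>y. (\<Prod>i\<in>I. complex_of_real (exp (- ((r * (x i - y i))\<^sup>2) / 2))) \<partial>R)"
      by (subst integral_complex_of_real[symmetric]) simp
    also have "\<dots> = (\<integral>y. (\<Prod>i\<in>I. \<integral>t. iexp (r * (x i - y i) * t) \<partial>std_normal_distribution) \<partial>R)"
      by (simp only: iexp_scaled_std_normal)
    also have "\<dots> = (\<integral>y. (\<integral>t. (\<Prod>i\<in>I. iexp (r * (x i - y i) * t i)) \<partial>?N) \<partial>R)"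
    proof (intro Bochner_Integration.integral_cong refl)
      fix y
      have "integrable std_normal_distribution (\<lambda>t. iexp (r * (x i - y i) * t))" for i
        by (intro prob_space.integrable_iexp prob_space_normal_density) (auto simp del: of_real_mult)
      then show "(\<Prod>i\<in>I. \<integral>t. iexp (r * (x i - y i) * t) \<partial>std_normal_distribution) =
          (\<integral>t. (\<Prod>i\<in>I. iexp (r * (x i - y i) * t i)) \<partial>?N)"
        by (intro SN.product_integral_prod[symmetric] I)
    qed
    also have "\<dots> = (\<integral>y. (\<integral>t. iexp (\<Sum>i\<in>I. r * t i * x i) * iexp (\<Sum>i\<in>I. (- r * t i) * y i) \<partial>?N) \<partial>R)"
      by (intro Bochner_Integration.integral_cong refl)
        (simp add: exp_sum[symmetric] exp_add[symmetric] sum_distrib_left sum.distrib[symmetric]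
          algebra_simps sum_negf[symmetric] sum_subtractf[symmetric] I)
    also have "\<dots> = (\<integral>t. (\<integral>y. iexp (\<Sum>i\<in>I. r * t i * x i) * iexp (\<Sum>i\<in>I. (- r * t i) * y i) \<partial>R) \<partial>?N)"
    proof (rule RN.Fubini_integral[symmetric])
      show "integrable (R \<Otimes>\<^sub>M ?N) (\<lambda>(y, t). iexp (\<Sum>i\<in>I. r * t i * x i) * iexp (\<Sum>i\<in>I. (- r * t i) * y i))"
      proof (rule RN.integrable_const_bound[where B=1])
        show "(\<lambda>(y, t). iexp (\<Sum>i\<in>I. r * t i * x i) * iexp (\<Sum>i\<in>I. (- r * t i) * y i))
            \<in> borel_measurable (R \<Otimes>\<^sub>M ?N)"
          by measurable
      qed (simp add: norm_mult split_beta)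
    qed
    also have "\<dots> = (\<integral>t. iexp (\<Sum>i\<in>I. r * t i * x i) * (\<integral>y. iexp (\<Sum>i\<in>I. (- r * t i) * y i) \<partial>R) \<partial>?N)"
      by simp
    finally show ?thesis .
  qed
  have "complex_of_real (\<integral>y. (?bump y) \<partial>P) =
    complex_of_real (\<integral>y. (?bump y) \<partial>Q)"
    unfolding expand[OF P] expand[OF Q] char ..
  then show ?thesis by (simp only: of_real_eq_iff)
qed

text \<open>Tonelli in the two arguments of the bump: integrating over the centre \<open>x\<close>
  with weight \<open>c\<close> yields the smoothed \<open>c\<close> at \<open>y\<close>, whereas for
  each fixed \<open>x\<close> the integral over \<open>y\<close> agrees under \<open>P\<close> and
  \<open>Q\<close>.\<close>

lemma smoothed_products_eq:
  fixes c :: "'i \<Rightarrow> real \<Rightarrow> real"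
  assumes c_meas[measurable]: "\<And>i. c i \<in> borel_measurable borel"
    and c: "\<And>i x. 0 \<le> c i x" "\<And>i x. c i x \<le> 1" and r: "r > 0"
  shows "(\<integral>y. (\<Prod>i\<in>I. \<integral>u. c i (y i + u / r) \<partial>std_normal_distribution) \<partial>P) =
    (\<integral>y. (\<Prod>i\<in>I. \<integral>u. c i (y i + u / r) \<partial>std_normal_distribution) \<partial>Q)"
proof -
  let ?bump = "\<lambda>x y. \<Prod>i\<in>I. exp (- ((r * (x i - y i))\<^sup>2) / 2)"
    and ?c = "\<lambda>x. \<Prod>i\<in>I. ennreal (c i (x i))"
  let ?L = "PiM I (\<lambda>_. lborel :: real measure)"
  interpret SN: prob_space std_normal_distribution by (rule prob_space_normal_density) simp
  interpret L: product_sigma_finite "\<lambda>_. lborel :: real measure" ..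
  interpret L: sigma_finite_measure ?L by (rule L.sigma_finite[OF I])
  define g where "g i y = (\<integral>u. c i (y + u / r) \<partial>std_normal_distribution)" for i y
  have g_meas[measurable]: "g i \<in> borel_measurable borel" for i
    unfolding g_def by measurable
  have g: "0 \<le> g i y" "g i y \<le> 1" for i y
    unfolding g_def by (auto intro!: Bochner_Integration.integral_nonneg SN.integral_le_const SN.integrable_const_bound[where B=1] simp: c)
  \<comment> \<open>Nonnegative integrals, as Lebesgue measure in \<open>x\<close> is infinite. The
    factor in front is the total mass of the bumps; it is positive and finite, hence can be
    cancelled at the end.\<close>
  have expand: "ennreal (sqrt (2 * pi) / r) ^ card I * ennreal (\<integral>y. (\<Prod>i\<in>I. g i (y i)) \<partial>R) =
     (\<integral>\<^sup>+x. (?c x) * ennreal (\<integral>y. (?bump x y) \<partial>R) \<partial>?L)"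
    if R: "prob_space R" and sR[measurable_cong]: "sets R = sets (borel_on I)"
    for R :: "('i \<Rightarrow> real) measure"
  proof -
    interpret R: prob_space R by fact
    interpret RN: pair_sigma_finite ?L R ..
    have sN[measurable_cong]: "sets ?L = sets (borel_on I)"
      by (intro sets_PiM_cong) auto
    have "(\<integral>\<^sup>+x. (?c x) * ennreal (\<integral>y. (?bump x y) \<partial>R) \<partial>?L) =
       (\<integral>\<^sup>+x. (?c x) * (\<integral>\<^sup>+y. ennreal (?bump x y) \<partial>R) \<partial>?L)"
      by (intro nn_integral_cong arg_cong2[where f="(*)"] refl nn_integral_eq_integral[symmetric]
           R.integrable_const_bound[where B=1])
        (auto intro!: prod_nonneg prod_le_1 simp: abs_prod)
    also have "\<dots> = (\<integral>\<^sup>+x. (\<integral>\<^sup>+y. (?c x) * ennreal (?bump x y) \<partial>R) \<partial>?L)"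
      by (intro nn_integral_cong nn_integral_cmult[symmetric]) measurable
    also have "\<dots> = (\<integral>\<^sup>+y. (\<integral>\<^sup>+x. (?c x) * ennreal (?bump x y) \<partial>?L) \<partial>R)"
      by (rule RN.Fubini'[symmetric]) measurable
    also have "\<dots> = (\<integral>\<^sup>+y. (\<integral>\<^sup>+x. (\<Prod>i\<in>I. ennreal (c i (x i) * exp (- ((r * (x i - y i))\<^sup>2) / 2))) \<partial>?L) \<partial>R)"
      by (intro nn_integral_cong) (simp add: prod_ennreal[symmetric] ennreal_mult prod.distrib c)
    also have "\<dots> = (\<integral>\<^sup>+y. (\<Prod>i\<in>I. \<integral>\<^sup>+x. ennreal (c i x * exp (- ((r * (x - y i))\<^sup>2) / 2)) \<partial>lborel) \<partial>R)"
      by (intro nn_integral_cong L.product_nn_integral_prod I) measurable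
    also have "\<dots> = (\<integral>\<^sup>+y. (\<Prod>i\<in>I. ennreal (sqrt (2 * pi) / r) * ennreal (g i (y i))) \<partial>R)"
      unfolding g_def by (intro nn_integral_cong prod.cong refl integral_gaussian_bump c r) measurable
    also have "\<dots> = (\<integral>\<^sup>+y. ennreal (sqrt (2 * pi) / r) ^ card I * ennreal (\<Prod>i\<in>I. g i (y i)) \<partial>R)"
      by (simp add: prod.distrib prod_ennreal g)
    also have "\<dots> = ennreal (sqrt (2 * pi) / r) ^ card I * (\<integral>\<^sup>+y. ennreal (\<Prod>i\<in>I. g i (y i)) \<partial>R)"
      by (rule nn_integral_cmult) measurable
    also have "(\<integral>\<^sup>+y. ennreal (\<Prod>i\<in>I. g i (y i)) \<partial>R) = ennreal (\<integral>y. (\<Prod>i\<in>I. g i (y i)) \<partial>R)"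
      by (intro nn_integral_eq_integral R.integrable_const_bound[where B=1])
        (auto intro!: prod_nonneg prod_le_1 simp: abs_prod g abs_of_nonneg)
    finally show ?thesis ..
  qed
  have "ennreal (sqrt (2 * pi) / r) ^ card I * ennreal (\<integral>y. (\<Prod>i\<in>I. g i (y i)) \<partial>P) =
    ennreal (sqrt (2 * pi) / r) ^ card I * ennreal (\<integral>y. (\<Prod>i\<in>I. g i (y i)) \<partial>Q)"
    unfolding expand[OF P] expand[OF Q] gaussian_bumps_eq ..
  moreover have "0 \<le> (\<integral>y. (\<Prod>i\<in>I. g i (y i)) \<partial>R)" for R
    by (intro Bochner_Integration.integral_nonneg prod_nonneg g)
  moreover have "0 < (sqrt (2 * pi) / r) ^ card I" using r by simp
  ultimately show ?thesis
    using r unfolding g_def[symmetric]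
    by (subst (asm) ennreal_mult_cancel_left)
      (auto simp: ennreal_power ennreal_eq_0_iff not_le)
qed

text \<open>The noise level \<open>1 / Suc n\<close> tends to 0; bounded convergence is applied to
  the noise in each coordinate and then to the outer integral.\<close>

lemma continuous_products_eq:
  fixes c :: "'i \<Rightarrow> real \<Rightarrow> real"
  assumes cont: "\<And>i x. isCont (c i) x" and c: "\<And>i x. 0 \<le> c i x" "\<And>i x. c i x \<le> 1"
  shows "(\<integral>y. (\<Prod>i\<in>I. c i (y i)) \<partial>P) = (\<integral>y. (\<Prod>i\<in>I. c i (y i)) \<partial>Q)"
proof -
  interpret SN: prob_space std_normal_distribution by (rule prob_space_normal_density) simp
  have [measurable]: "c i \<in> borel_measurable borel" for i
    using cont by (intro borel_measurable_continuous_onI continuous_at_imp_continuous_on) auto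
  define g where "g n i y = (\<integral>u. c i (y + u / real (Suc n)) \<partial>std_normal_distribution)" for n i y
  have [measurable]: "g n i \<in> borel_measurable borel" for n i
    unfolding g_def by measurable
  have g: "0 \<le> g n i y" "g n i y \<le> 1" for n i y
    unfolding g_def by (auto intro!: Bochner_Integration.integral_nonneg SN.integral_le_const SN.integrable_const_bound[where B=1] simp: c)
  have g_lim: "(\<lambda>n. g n i y) \<longlonglongrightarrow> c i y" for i y
  proof -
    have "(\<lambda>n. \<integral>u. c i (y + u / real (Suc n)) \<partial>std_normal_distribution) \<longlonglongrightarrow> (\<integral>u. c i y \<partial>std_normal_distribution)"
    proof (rule integral_dominated_convergence[where w="\<lambda>_. 1"])
      show "AE u in std_normal_distribution. (\<lambda>n. c i (y + u / real (Suc n))) \<longlonglongrightarrow> c i y"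
      proof (intro AE_I2)
        fix u
        have "(\<lambda>n. y + u * (1 / real (Suc n))) \<longlonglongrightarrow> y + u * 0"
          by (intro tendsto_intros LIMSEQ_Suc[OF lim_1_over_n])
        then show "(\<lambda>n. c i (y + u / real (Suc n))) \<longlonglongrightarrow> c i y"
          by (intro isCont_tendsto_compose[OF cont]) simp
      qed
    qed (auto simp: c)
    then show ?thesis by (simp add: g_def SN.prob_space[simplified])
  qed
  have lim: "(\<lambda>n. \<integral>y. (\<Prod>i\<in>I. g n i (y i)) \<partial>R) \<longlonglongrightarrow> (\<integral>y. (\<Prod>i\<in>I. c i (y i)) \<partial>R)"
    if R: "prob_space R" and sR[measurable_cong]: "sets R = sets (borel_on I)" for R
  proof -
    interpret R: prob_space R by fact
    show ?thesis
      by (rule integral_dominated_convergence[where w="\<lambda>_. 1"])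
        (auto intro!: tendsto_prod g_lim prod_nonneg prod_le_1 simp: abs_prod g abs_of_nonneg)
  qed
  have "(\<lambda>n. \<integral>y. (\<Prod>i\<in>I. g n i (y i)) \<partial>P) = (\<lambda>n. \<integral>y. (\<Prod>i\<in>I. g n i (y i)) \<partial>Q)"
    unfolding g_def by (intro ext smoothed_products_eq c) auto
  then show ?thesis
    using LIMSEQ_unique[OF lim[OF P]] lim[OF Q] by simp
qed

lemma half_spaces_eq:
  "emeasure P (Pi\<^sub>E I (\<lambda>i. {d i<..})) = emeasure Q (Pi\<^sub>E I (\<lambda>i. {d i<..}))"
proof -
  \<comment> \<open>For positive \<open>n\<close> a ramp from 0 at \<open>d i\<close> to 1 at
    \<open>d i + 1 / n\<close>. It vanishes at \<open>d i\<close> itself, so the limit is the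
    indicator of the open ray.\<close>
  define c where "c n i y = max 0 (min 1 (real n * (y - d i)))" for n i y
  have cont: "isCont (c n i) y" for n i y
    unfolding c_def by (intro continuous_intros)
  have [measurable]: "c n i \<in> borel_measurable borel" for n i
    unfolding c_def by measurable
  have c: "0 \<le> c n i y" "c n i y \<le> 1" for n i y
    by (auto simp: c_def)
  have c_lim: "(\<lambda>n. c n i y) \<longlonglongrightarrow> indicator {d i<..} y" for i y
  proof (cases "d i < y")
    case True
    obtain k where k: "inverse (real (Suc k)) < y - d i" using reals_Archimedean[of "y - d i"] True by auto
    have "c n i y = 1" if "n \<ge> Suc k" for n
    proof -
      have "1 \<le> real (Suc k) * (y - d i)" using k by (simp add: field_simps)
      also have "\<dots> \<le> real n * (y - d i)" using that True by (intro mult_right_mono) auto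
      finally show ?thesis by (simp add: c_def)
    qed
    then show ?thesis using True
      by (intro tendsto_eventually) (auto simp: eventually_sequentially intro!: exI[of _ "Suc k"])
  next
    case False
    then have "real n * (y - d i) \<le> 0" for n by (intro mult_nonneg_nonpos) auto
    then have "c n i y = 0" for n by (simp add: c_def max_absorb1 min.coboundedI2)
    then show ?thesis using False by simp
  qed
  have lim: "(\<lambda>n. \<integral>y. (\<Prod>i\<in>I. c n i (y i)) \<partial>R) \<longlonglongrightarrow> measure R (Pi\<^sub>E I (\<lambda>i. {d i<..}))"
    if R: "prob_space R" and sR[measurable_cong]: "sets R = sets (borel_on I)" for R
  proof -
    interpret R: prob_space R by fact
    have sp: "space R = Pi\<^sub>E I (\<lambda>_. UNIV)" using sets_eq_imp_space_eq[OF sR] by (simp add: space_PiM)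
    have *: "(\<lambda>n. \<integral>y. (\<Prod>i\<in>I. c n i (y i)) \<partial>R) \<longlonglongrightarrow> (\<integral>y. (\<Prod>i\<in>I. indicat_real {d i<..} (y i)) \<partial>R)"
      by (rule integral_dominated_convergence[where w="\<lambda>_. 1"])
        (auto intro!: tendsto_prod c_lim prod_nonneg prod_le_1 simp: abs_prod c abs_of_nonneg)
    have "(\<integral>y. (\<Prod>i\<in>I. indicat_real {d i<..} (y i)) \<partial>R) = (\<integral>y. indicator (Pi\<^sub>E I (\<lambda>i. {d i<..})) y \<partial>R)"
    proof (intro Bochner_Integration.integral_cong refl)
      fix y assume "y \<in> space R"
      \<comment> \<open>Membership in \<open>Pi\<^sub>E\<close> also demands the default value
        outside \<open>I\<close>, which the points of the space have.\<close>
      then have "y \<in> extensional I" by (auto simp: sp PiE_def)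
      show "(\<Prod>i\<in>I. indicat_real {d i<..} (y i)) = indicator (Pi\<^sub>E I (\<lambda>i. {d i<..})) y"
      proof (cases "\<forall>i\<in>I. d i < y i")
        case True
        then show ?thesis using \<open>y \<in> extensional I\<close> by (simp add: PiE_iff)
      next
        case False
        then have "\<exists>i\<in>I. indicat_real {d i<..} (y i) = 0" by (simp add: indicator_def)
        from prod_zero[OF I this] show ?thesis using False by (auto simp: PiE_iff)
      qed
    qed
    also have "\<dots> = measure R (Pi\<^sub>E I (\<lambda>i. {d i<..}))"
    proof -
      have "Pi\<^sub>E I (\<lambda>i. {d i<..}) \<in> sets R"
        unfolding sR by (intro sets_PiM_I_finite I) auto
      then show ?thesis by simp
    qed
    finally show ?thesis using * by simp
  qed
  have "(\<lambda>n. \<integral>y. (\<Prod>i\<in>I. c n i (y i)) \<partial>P) = (\<lambda>n. \<integral>y. (\<Prod>i\<in>I. c n i (y i)) \<partial>Q)"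
    by (intro ext continuous_products_eq c cont)
  then have "measure P (Pi\<^sub>E I (\<lambda>i. {d i<..})) = measure Q (Pi\<^sub>E I (\<lambda>i. {d i<..}))"
    using LIMSEQ_unique[OF lim[OF P]] lim[OF Q] by simp
  then show ?thesis
    using P Q by (simp add: finite_measure.emeasure_eq_measure prob_space.finite_measure)
qed

end

text \<open>Sides are upgraded from rays to Borel sets one coordinate at a time: with all other
  sides fixed, the mass as a function of one side is a finite measure on the line, determined by its
  values on rays.\<close>

lemma PiM_eq_of_half_spaces_eq:
  fixes P Q :: "('i \<Rightarrow> real) measure"
  assumes I: "finite I" and P: "finite_measure P" "sets P = sets (borel_on I)"
    and Q: "finite_measure Q" "sets Q = sets (borel_on I)"
    and eq: "\<And>d. emeasure P (Pi\<^sub>E I (\<lambda>i. {d i<..})) = emeasure Q (Pi\<^sub>E I (\<lambda>i. {d i<..}))"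
  shows "P = Q"
proof -
  interpret P: finite_measure P by fact
  interpret Q: finite_measure Q by fact
  have *: "\<forall>A d. (\<forall>i\<in>J. A i \<in> sets borel) \<longrightarrow>
      emeasure P (Pi\<^sub>E I (\<lambda>i. if i \<in> J then A i else {d i<..})) =
      emeasure Q (Pi\<^sub>E I (\<lambda>i. if i \<in> J then A i else {d i<..}))"
    if "finite J" "J \<subseteq> I" for J
    using that
  proof (induction J rule: finite_induct)
    case empty
    then show ?case by (simp add: eq)
  next
    case (insert k J)
    show ?case
    proof (intro allI impI)
      fix A :: "'i \<Rightarrow> real set" and d :: "'i \<Rightarrow> real"
      assume A: "\<forall>i\<in>insert k J. A i \<in> sets borel"
      define S where "S = (\<lambda>i. if i \<in> J then A i else {d i<..})"
      \<comment> \<open>The box with side \<open>k\<close> left free. Restricting to it and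
        projecting to coordinate \<open>k\<close> gives the measure on the line to which uniqueness
        on rays applies.\<close>
      define E where "E = Pi\<^sub>E I (S(k := UNIV))"
      have E: "E \<in> sets (borel_on I)"
        unfolding E_def S_def using A by (intro sets_PiM_I_finite I) auto
      let ?F = "\<lambda>R. distr (restrict_space R E) borel (\<lambda>y. y k)"
      have m: "(\<lambda>y. y k) \<in> measurable R borel" if "sets R = sets (borel_on I)" for R :: "('i \<Rightarrow> real) measure"
        using insert.prems by (subst measurable_cong_sets[OF that refl]) (auto intro!: measurable_component_singleton)
      have F: "emeasure (?F R) T = emeasure R (E \<inter> {y \<in> space R. y k \<in> T})"
        if R: "sets R = sets (borel_on I)" and T: "T \<in> sets borel" for R T
      proof -
        have "E \<inter> space R \<in> sets R" using E R sets_eq_imp_space_eq[OF R] by auto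
        moreover have "E \<subseteq> space R" using sets.sets_into_space[OF E] sets_eq_imp_space_eq[OF R] by simp
        moreover have "(\<lambda>y. y k) -` T \<inter> (E \<inter> space R) = E \<inter> {y \<in> space R. y k \<in> T}" by auto
        ultimately show ?thesis using m[OF R] T
          by (subst emeasure_distr)
            (auto simp: emeasure_restrict_space space_restrict_space measurable_restrict_space1)
      qed
      have sp: "space R = Pi\<^sub>E I (\<lambda>_. UNIV)" if "sets R = sets (borel_on I)" for R :: "('i \<Rightarrow> real) measure"
        using sets_eq_imp_space_eq[OF that] by (simp add: space_PiM)
      have EB: "E \<inter> {y \<in> space R. y k \<in> T} = Pi\<^sub>E I (S(k := T))"
        if "sets R = sets (borel_on I)" for R T
        using insert.prems unfolding sp[OF that] E_def by (auto simp: PiE_iff split: if_splits)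
      have "?F P = ?F Q"
      proof (rule measure_eqI_lessThan)
        fix x :: real
        show "emeasure (?F P) {x<..} < \<infinity>"
          using P by (auto simp: F less_top[symmetric])
        show "emeasure (?F P) {x<..} = emeasure (?F Q) {x<..}"
        proof -
          have "S(k := {x<..}) = (\<lambda>i. if i \<in> J then A i else {(d(k := x)) i<..})"
            using insert.hyps by (auto simp: S_def fun_eq_iff)
          then have "emeasure P (Pi\<^sub>E I (S(k := {x<..}))) = emeasure Q (Pi\<^sub>E I (S(k := {x<..})))"
            using insert A by (simp del: fun_upd_apply)
          then show ?thesis
            using F[OF P(2), of "{x<..}"] F[OF Q(2), of "{x<..}"] EB[OF P(2), of "{x<..}"] EB[OF Q(2), of "{x<..}"]
            by simp
        qed
      qed auto
      then have "emeasure (?F P) (A k) = emeasure (?F Q) (A k)" by simp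
      moreover have "S(k := A k) = (\<lambda>i. if i \<in> insert k J then A i else {d i<..})"
        by (auto simp: S_def fun_eq_iff)
      ultimately show "emeasure P (Pi\<^sub>E I (\<lambda>i. if i \<in> insert k J then A i else {d i<..})) =
        emeasure Q (Pi\<^sub>E I (\<lambda>i. if i \<in> insert k J then A i else {d i<..}))"
        using A P(2) Q(2) by (simp add: F EB del: fun_upd_apply)
    qed
  qed
  show ?thesis
  proof (rule measure_eqI_PiM_finite[OF I P(2) Q(2)])
    fix A :: "'i \<Rightarrow> real set" assume A: "\<And>i. i \<in> I \<Longrightarrow> A i \<in> sets borel"
    have "Pi\<^sub>E I (\<lambda>i. if i \<in> I then A i else {0<..}) = Pi\<^sub>E I A" by (intro PiE_cong) auto
    then show "emeasure P (Pi\<^sub>E I A) = emeasure Q (Pi\<^sub>E I A)"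
      using *[OF I, THEN spec[of _ A], THEN spec[of _ "\<lambda>_. 0"]] A by simp
  next
    show "range (\<lambda>_::nat. space P) \<subseteq> prod_algebra I (\<lambda>_. borel)"
    proof -
      have "space P = Pi\<^sub>E I (\<lambda>_. UNIV)" using sets_eq_imp_space_eq[OF P(2)] by (simp add: space_PiM)
      then show ?thesis using prod_algebraI_finite[OF I, of "\<lambda>_. UNIV" "\<lambda>_. borel"] by auto
    qed
    show "(\<Union>i::nat. space P) = space (borel_on I)" using sets_eq_imp_space_eq[OF P(2)] by simp
  qed simp
qed

theorem PiM_eq_of_char_eq:
  fixes P Q :: "('i \<Rightarrow> real) measure"
  assumes I: "finite I" and P: "prob_space P" "sets P = sets (borel_on I)"
    and Q: "prob_space Q" "sets Q = sets (borel_on I)"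
    and char: "\<And>a. (\<integral>y. iexp (\<Sum>i\<in>I. a i * y i) \<partial>P) = (\<integral>y. iexp (\<Sum>i\<in>I. a i * y i) \<partial>Q)"
  shows "P = Q"
proof -
  interpret equal_characteristic_functions I P Q by (rule equal_characteristic_functions.intro[OF I P Q char])
  show ?thesis
    using I P Q by (intro PiM_eq_of_half_spaces_eq[of I] half_spaces_eq prob_space.finite_measure)
qed

subsection \<open>Taylor expansion of the test function\<close>

text \<open>Symmetrised as a double sum, the first difference becomes a sum of terms \<open>(\<bar>v
  k\<bar> + \<bar>v l\<bar>) * (\<bar>v k\<bar> - \<bar>v l\<bar>)\<^sup>2\<close>; the second bound
  combines it with Cauchy-Schwarz. Both fold products of power sums into the third one, whose mean
  is controlled coordinate by coordinate.\<close>

lemma weighted_sum_abs_cube_le: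
  fixes w v :: "'k \<Rightarrow> real"
  assumes K: "finite K" and w: "\<And>k. k \<in> K \<Longrightarrow> 0 \<le> w k"
  shows "(\<Sum>k\<in>K. w k * \<bar>v k\<bar>) * (\<Sum>k\<in>K. w k * (v k)\<^sup>2) \<le> (\<Sum>k\<in>K. w k) * (\<Sum>k\<in>K. w k * \<bar>v k\<bar> ^ 3)"
    and "(\<Sum>k\<in>K. w k * \<bar>v k\<bar>) ^ 3 \<le> (\<Sum>k\<in>K. w k)\<^sup>2 * (\<Sum>k\<in>K. w k * \<bar>v k\<bar> ^ 3)"
proof -
  let ?A = "\<Sum>k\<in>K. w k" and ?B = "\<Sum>k\<in>K. w k * \<bar>v k\<bar>" and ?C = "\<Sum>k\<in>K. w k * (v k)\<^sup>2"
    and ?D = "\<Sum>k\<in>K. w k * \<bar>v k\<bar> ^ 3"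
  have pos: "0 \<le> ?A" "0 \<le> ?B" "0 \<le> ?C" "0 \<le> ?D"
    by (auto intro!: sum_nonneg mult_nonneg_nonneg w)
  show *: "?B * ?C \<le> ?A * ?D"
  proof -
    have swap: "(\<Sum>k\<in>K. \<Sum>l\<in>K. w k * w l * (\<bar>v l\<bar> * (v k)\<^sup>2)) = (\<Sum>k\<in>K. \<Sum>l\<in>K. w k * w l * (\<bar>v k\<bar> * (v l)\<^sup>2))"
      by (subst sum.swap) (simp add: mult_ac)
    have swap': "(\<Sum>k\<in>K. \<Sum>l\<in>K. w k * w l * \<bar>v k\<bar> ^ 3) = (\<Sum>k\<in>K. \<Sum>l\<in>K. w k * w l * \<bar>v l\<bar> ^ 3)"
      by (subst sum.swap) (simp add: mult_ac)
    have "2 * (?A * ?D - ?B * ?C) = (\<Sum>k\<in>K. \<Sum>l\<in>K. w k * w l *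
        (\<bar>v k\<bar> ^ 3 + \<bar>v l\<bar> ^ 3 - \<bar>v k\<bar> * (v l)\<^sup>2 - \<bar>v l\<bar> * (v k)\<^sup>2))"
      using swap swap'
      by (simp add: sum_product algebra_simps sum.distrib sum_subtractf)
    also have "\<dots> \<ge> 0"
    proof (intro sum_nonneg mult_nonneg_nonneg w)
      fix k l
      have *: "x ^ 3 + y ^ 3 - x * y\<^sup>2 - y * x\<^sup>2 = (x + y) * (x - y)\<^sup>2" for x y :: real
        by (simp add: power2_eq_square power3_eq_cube algebra_simps)
      have "\<bar>v k\<bar> ^ 3 + \<bar>v l\<bar> ^ 3 - \<bar>v k\<bar> * (v l)\<^sup>2 - \<bar>v l\<bar> * (v k)\<^sup>2 = (\<bar>v k\<bar> + \<bar>v l\<bar>) * (\<bar>v k\<bar> - \<bar>v l\<bar>)\<^sup>2"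
        using *[of "\<bar>v k\<bar>" "\<bar>v l\<bar>"] by simp
      then show "0 \<le> \<bar>v k\<bar> ^ 3 + \<bar>v l\<bar> ^ 3 - \<bar>v k\<bar> * (v l)\<^sup>2 - \<bar>v l\<bar> * (v k)\<^sup>2" by simp
    qed
    finally show ?thesis by simp
  qed
  have "?B\<^sup>2 \<le> ?A * ?C"
  proof -
    have swap: "(\<Sum>k\<in>K. \<Sum>l\<in>K. w k * w l * (v k)\<^sup>2) = (\<Sum>k\<in>K. \<Sum>l\<in>K. w k * w l * (v l)\<^sup>2)"
      by (subst sum.swap) (simp add: mult_ac)
    have "?A * ?C = (\<Sum>k\<in>K. \<Sum>l\<in>K. w k * w l * (v l)\<^sup>2)"
      "?B\<^sup>2 = (\<Sum>k\<in>K. \<Sum>l\<in>K. w k * w l * (\<bar>v k\<bar> * \<bar>v l\<bar>))"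
      by (simp_all add: sum_product power2_eq_square[of ?B] mult_ac)
    moreover have "(\<Sum>k\<in>K. \<Sum>l\<in>K. w k * w l * ((v k)\<^sup>2 + (v l)\<^sup>2 - 2 * \<bar>v k\<bar> * \<bar>v l\<bar>)) =
      (\<Sum>k\<in>K. \<Sum>l\<in>K. w k * w l * (v k)\<^sup>2) + (\<Sum>k\<in>K. \<Sum>l\<in>K. w k * w l * (v l)\<^sup>2) -
      2 * (\<Sum>k\<in>K. \<Sum>l\<in>K. w k * w l * (\<bar>v k\<bar> * \<bar>v l\<bar>))"
      unfolding sum_distrib_left[of 2] sum.distrib[symmetric] sum_subtractf[symmetric]
      by (intro sum.cong refl) (simp add: algebra_simps)
    ultimately have "2 * (?A * ?C - ?B\<^sup>2) = (\<Sum>k\<in>K. \<Sum>l\<in>K. w k * w l * ((v k)\<^sup>2 + (v l)\<^sup>2 - 2 * \<bar>v k\<bar> * \<bar>v l\<bar>))"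
      using swap by simp
    also have "\<dots> \<ge> 0"
    proof (intro sum_nonneg mult_nonneg_nonneg w)
      fix k l
      have "(v k)\<^sup>2 + (v l)\<^sup>2 - 2 * \<bar>v k\<bar> * \<bar>v l\<bar> = (\<bar>v k\<bar> - \<bar>v l\<bar>)\<^sup>2"
        by (simp add: power2_diff)
      then show "0 \<le> (v k)\<^sup>2 + (v l)\<^sup>2 - 2 * \<bar>v k\<bar> * \<bar>v l\<bar>" by simp
    qed
    finally show ?thesis by simp
  qed
  then have "?B ^ 3 \<le> ?A * ?C * ?B"
    using pos by (simp add: power3_eq_cube power2_eq_square mult_right_mono)
  also have "\<dots> = ?A * (?B * ?C)" by (simp add: mult_ac)
  also have "\<dots> \<le> ?A * (?A * ?D)" using pos * by (intro mult_left_mono)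
  also have "\<dots> = ?A\<^sup>2 * ?D" by (simp add: power2_eq_square)
  finally show "?B ^ 3 \<le> ?A\<^sup>2 * ?D" .
qed

lemma mult_exp_minus_le_1: "x * exp (- x) \<le> (1::real)"
proof -
  have "x \<le> exp x" using exp_ge_add_one_self[of x] by linarith
  then show ?thesis by (simp add: exp_minus field_simps)
qed

text \<open>The polynomial is the one that the third derivative of the test function produces. Half
  of the exponent absorbs it, since \<open>8 * (1 + x / 2 + x\<^sup>2 / 8)\<close> dominates it term
  by term; the other half survives as decay.\<close>

lemma quadratic_mult_exp_minus_le:
  fixes x :: real assumes "x \<ge> 0"
  shows "(x\<^sup>2 + 3 * x + 1) * exp (- x) \<le> 8 * exp (- (x / 2))" "x\<^sup>2 * exp (- x) \<le> 1"
proof -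
  have "1 + x / 2 + (x / 2)\<^sup>2 / 2 \<le> exp (x / 2)"
    using assms by (intro exp_lower_Taylor_quadratic) simp
  moreover have "x\<^sup>2 \<le> exp x"
  proof -
    have "x \<le> 1 + x / 2 + (x / 2)\<^sup>2 / 2"
      using zero_le_power2[of "x / 2 - 1"] by (simp add: power2_eq_square algebra_simps)
    then have "x \<le> exp (x / 2)" using calculation(1) by linarith
    then have "x\<^sup>2 \<le> (exp (x / 2))\<^sup>2" using assms by (intro power_mono)
    then show ?thesis by (simp add: power2_eq_square exp_add[symmetric])
  qed
  ultimately show "x\<^sup>2 * exp (- x) \<le> 1" "(x\<^sup>2 + 3 * x + 1) * exp (- x) \<le> 8 * exp (- (x / 2))"
  proof -
    assume *: "1 + x / 2 + (x / 2)\<^sup>2 / 2 \<le> exp (x / 2)" "x\<^sup>2 \<le> exp x"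
    have "x\<^sup>2 + 3 * x + 1 \<le> 8 * (1 + x / 2 + (x / 2)\<^sup>2 / 2)"
      using assms by (simp add: power2_eq_square field_simps)
    also have "\<dots> \<le> 8 * exp (x / 2)" using * by simp
    finally have "(x\<^sup>2 + 3 * x + 1) * exp (- x) \<le> 8 * exp (x / 2) * exp (- x)"
      by (intro mult_right_mono) auto
    also have "\<dots> = 8 * exp (- (x / 2))" by (simp add: exp_add[symmetric])
    finally show "(x\<^sup>2 + 3 * x + 1) * exp (- x) \<le> 8 * exp (- (x / 2))" .
    show "x\<^sup>2 * exp (- x) \<le> 1" using * by (simp add: exp_minus field_simps)
  qed
qed

text \<open>\<open>T\<close> is the second-order Taylor remainder at 0 of the function sending
  \<open>s\<close> to \<open>exp (- (\<Sum>k\<in>K. a k * exp (s * v k)))\<close>, evaluated at 1.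
  The first bound keeps decay in \<open>S\<close>, because averaging the cubes will produce a factor
  \<open>S\<close>. The second covers large jumps, where the remainder is estimated by the sizes of
  its own terms.\<close>

lemma taylor_exp_minus_sum_exp:
  fixes a v :: "'k \<Rightarrow> real"
  assumes K: "finite K" and a: "\<And>k. k \<in> K \<Longrightarrow> 0 \<le> a k"
  defines "S \<equiv> \<Sum>k\<in>K. a k"
  defines "T \<equiv> exp (- (\<Sum>k\<in>K. a k * exp (v k))) - exp (- S) + exp (- S) * (\<Sum>k\<in>K. a k * v k)
    - exp (- S) / 2 * ((\<Sum>k\<in>K. a k * v k)\<^sup>2 - (\<Sum>k\<in>K. a k * (v k)\<^sup>2))"
  shows "(\<And>k. k \<in> K \<Longrightarrow> \<bar>v k\<bar> \<le> c) \<Longrightarrow>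
      \<bar>T\<bar> \<le> 4 / 3 * exp c * exp (- (exp (- c) * S / 2)) * (\<Sum>k\<in>K. a k * \<bar>v k\<bar> ^ 3)"
    and "k0 \<in> K \<Longrightarrow> \<bar>v k0\<bar> \<ge> 1 \<Longrightarrow> m \<ge> 2 \<Longrightarrow> \<bar>T\<bar> \<le> 3 * (\<Sum>k\<in>K. \<bar>v k\<bar> ^ m)"
proof -
  let ?X = "\<Sum>k\<in>K. a k * exp (v k)" and ?L = "\<Sum>k\<in>K. a k * v k"
    and ?R = "\<Sum>k\<in>K. a k * (v k)\<^sup>2" and ?M = "\<Sum>k\<in>K. a k * \<bar>v k\<bar> ^ 3"
  \<comment> \<open>Differentiation in \<open>s\<close> raises \<open>j\<close> by one, so the
    derivatives \<open>D j\<close> of \<open>exp (- P 0)\<close> are polynomials in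
    \<open>P 1\<close>, \<open>P 2\<close>, \<open>P 3\<close> times
    \<open>exp (- P 0)\<close>.\<close>
  define P where "P j s = (\<Sum>k\<in>K. a k * exp (s * v k) * v k ^ j)" for j :: nat and s
  have P_deriv: "(P j has_real_derivative P (Suc j) s) (at s)" for j s
    unfolding P_def by (auto intro!: derivative_eq_intros simp: mult_ac)
  define D where "D j s = (if j = 0 then exp (- P 0 s) else if j = 1 then - exp (- P 0 s) * P 1 s
     else if j = 2 then exp (- P 0 s) * ((P 1 s)\<^sup>2 - P 2 s)
     else exp (- P 0 s) * (3 * P 1 s * P 2 s - (P 1 s) ^ 3 - P 3 s))" for j :: nat and s
  have D_deriv: "\<forall>j s. j < 3 \<and> 0 \<le> s \<and> s \<le> 1 \<longrightarrow> (D j has_real_derivative D (Suc j) s) (at s)"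
  proof (intro allI impI)
    fix j :: nat and s :: real assume "j < 3 \<and> 0 \<le> s \<and> s \<le> 1"
    then consider "j = 0" | "j = 1" | "j = 2" by fastforce
    then show "(D j has_real_derivative D (Suc j) s) (at s)"
    proof cases
      case 1 then show ?thesis unfolding D_def
        by (auto intro!: derivative_eq_intros P_deriv)
    next
      case 2 then show ?thesis unfolding D_def
        by (auto intro!: derivative_eq_intros P_deriv simp: power2_eq_square algebra_simps numeral_2_eq_2)
    next
      case 3 then show ?thesis unfolding D_def
        by (auto intro!: derivative_eq_intros P_deriv simp: power2_eq_square power3_eq_cube algebra_simps numeral_3_eq_3 numeral_2_eq_2)
    qed
  qed
  have P0: "P 0 0 = S" "P 1 0 = ?L" "P 2 0 = ?R"
    "P 0 1 = ?X"
    by (auto simp: P_def S_def)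
  obtain s where s: "0 < s" "s < 1"
    and "D 0 1 = (\<Sum>j<3. D j 0 / fact j * 1 ^ j) + D 3 s / fact 3 * 1 ^ 3"
    using Maclaurin[of 1 3 D "D 0", OF _ _ refl D_deriv] by auto
  moreover have "(\<Sum>j<3. D j 0 / fact j * 1 ^ j) = D 0 0 + D 1 0 + D 2 0 / 2"
    by (simp add: eval_nat_numeral)
  moreover have "fact 3 = (6 :: real)" by (simp add: eval_nat_numeral)
  ultimately have "D 0 1 = D 0 0 + D 1 0 + D 2 0 / 2 + D 3 s / 6" by simp
  moreover have "D 0 1 = exp (- ?X)" "D 0 0 = exp (- S)"
    "D 1 0 = - (exp (- S) * ?L)"
    "D 2 0 = exp (- S) * (?L\<^sup>2 - ?R)"
    unfolding D_def P0 by simp_all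
  ultimately have T: "T = D 3 s / 6" unfolding T_def by simp
  have S: "0 \<le> S" unfolding S_def by (intro sum_nonneg a)
  show "\<bar>T\<bar> \<le> 4 / 3 * exp c * exp (- (exp (- c) * S / 2)) * ?M"
    if v: "\<And>k. k \<in> K \<Longrightarrow> \<bar>v k\<bar> \<le> c"
  proof -
    have sv: "\<bar>s * v k\<bar> \<le> c" if "k \<in> K" for k
    proof -
      have "s * \<bar>v k\<bar> \<le> 1 * \<bar>v k\<bar>" using s by (intro mult_right_mono) auto
      then show ?thesis using v[OF that] s by (simp add: abs_mult)
    qed
    \<comment> \<open>Weights at the intermediate point \<open>s\<close>. They differ from
      \<open>a k\<close> by a factor between \<open>exp (- c)\<close> and \<open>exp c\<close>,
      which is the price of returning to \<open>S\<close> and the original weights. The final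
      constant 4 / 3 is 8 / 6, with 6 from the Taylor coefficient.\<close>
    define w where "w k = a k * exp (s * v k)" for k
    have w: "0 \<le> w k" if "k \<in> K" for k using a that by (simp add: w_def)
    let ?A = "\<Sum>k\<in>K. w k" and ?B = "\<Sum>k\<in>K. w k * \<bar>v k\<bar>" and ?C = "\<Sum>k\<in>K. w k * (v k)\<^sup>2"
      and ?D = "\<Sum>k\<in>K. w k * \<bar>v k\<bar> ^ 3"
    have pos: "0 \<le> ?A" "0 \<le> ?B" "0 \<le> ?C" "0 \<le> ?D"
      by (auto intro!: sum_nonneg mult_nonneg_nonneg w)
    have PB: "\<bar>P 1 s\<bar> \<le> ?B" "\<bar>P 2 s\<bar> \<le> ?C" "\<bar>P 3 s\<bar> \<le> ?D" "P 0 s = ?A"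
      unfolding P_def w_def
      by (auto intro!: order_trans[OF sum_abs] sum_mono sum_nonneg mult_nonneg_nonneg
            simp: abs_mult a power_abs)
    have "\<bar>3 * P 1 s * P 2 s - (P 1 s) ^ 3 - P 3 s\<bar> \<le> 3 * (\<bar>P 1 s\<bar> * \<bar>P 2 s\<bar>) + \<bar>P 1 s\<bar> ^ 3 + \<bar>P 3 s\<bar>"
    proof -
      have "\<bar>x - y - z\<bar> \<le> \<bar>x\<bar> + \<bar>y\<bar> + \<bar>z\<bar>" for x y z :: real by linarith
      then show ?thesis by (rule order_trans) (simp add: abs_mult power_abs)
    qed
    also have "\<dots> \<le> 3 * (?B * ?C) + ?B ^ 3 + ?D"
      using PB pos by (intro add_mono mult_mono power_mono) auto
    also have "\<dots> \<le> 3 * (?A * ?D) + ?A\<^sup>2 * ?D + ?D"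
      using weighted_sum_abs_cube_le[of K w v, OF K w] by simp
    also have "\<dots> = (?A\<^sup>2 + 3 * ?A + 1) * ?D" by (simp add: algebra_simps)
    finally have "\<bar>D 3 s\<bar> \<le> exp (- ?A) * ((?A\<^sup>2 + 3 * ?A + 1) * ?D)"
      unfolding D_def by (simp add: PB abs_mult)
    also have "\<dots> = ((?A\<^sup>2 + 3 * ?A + 1) * exp (- ?A)) * ?D" by simp
    also have "\<dots> \<le> 8 * exp (- (?A / 2)) * ?D"
      using pos by (intro mult_right_mono quadratic_mult_exp_minus_le)
    also have "\<dots> \<le> 8 * exp (- (exp (- c) * S / 2)) * (exp c * ?M)"
    proof -
      have "exp (- c) * a k \<le> w k" if "k \<in> K" for k
        using sv[OF that] a[OF that] by (simp add: w_def mult.commute mult_left_mono)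
      then have "exp (- c) * S \<le> ?A" unfolding S_def sum_distrib_left by (intro sum_mono)
      moreover have "?D \<le> exp c * ?M"
        unfolding sum_distrib_left
      proof (intro sum_mono)
        fix k assume k: "k \<in> K"
        have "exp (s * v k) * (a k * \<bar>v k\<bar> ^ 3) \<le> exp c * (a k * \<bar>v k\<bar> ^ 3)"
          using sv[OF k] a[OF k] by (intro mult_right_mono) auto
        then show "w k * \<bar>v k\<bar> ^ 3 \<le> exp c * (a k * \<bar>v k\<bar> ^ 3)" by (simp add: w_def mult_ac)
      qed
      ultimately show ?thesis using pos by (intro mult_mono) auto
    qed
    finally show ?thesis by (simp add: T mult_ac)
  qed
  show "\<bar>T\<bar> \<le> 3 * (\<Sum>k\<in>K. \<bar>v k\<bar> ^ m)" if k0: "k0 \<in> K" and vk0: "\<bar>v k0\<bar> \<ge> 1" and m: "m \<ge> 2"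
  proof -
    \<comment> \<open>The largest jump is at least 1, so after \<open>exp (- S)\<close> has absorbed
      the powers of \<open>S\<close>, the terms of \<open>T\<close> are at most 1, \<open>V\<close>
      and \<open>V\<^sup>2 / 2\<close>, all dominated by \<open>V ^ m\<close>.\<close>
    define V where "V = Max ((\<lambda>k. \<bar>v k\<bar>) ` K)"
    have V: "\<bar>v k\<bar> \<le> V" if "k \<in> K" for k using that K by (auto simp: V_def)
    have V1: "1 \<le> V" using V[OF k0] vk0 by simp
    have "V \<in> (\<lambda>k. \<bar>v k\<bar>) ` K" unfolding V_def using K k0 by (intro Max_in) auto
    then obtain k1 where k1: "k1 \<in> K" "V = \<bar>v k1\<bar>" by auto
    have VS: "V ^ m \<le> (\<Sum>k\<in>K. \<bar>v k\<bar> ^ m)"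
      using member_le_sum[of k1 K "\<lambda>k. \<bar>v k\<bar> ^ m"] k1 K by simp
    have b1: "\<bar>?L\<bar> \<le> S * V" unfolding S_def sum_distrib_right
      by (intro order_trans[OF sum_abs] sum_mono) (auto simp: abs_mult a V mult_left_mono)
    have b2: "?R \<le> S * V\<^sup>2" unfolding S_def sum_distrib_right
    proof (intro sum_mono mult_left_mono a)
      fix k assume "k \<in> K"
      then have "\<bar>v k\<bar>\<^sup>2 \<le> V\<^sup>2" using V by (intro power_mono) auto
      then show "(v k)\<^sup>2 \<le> V\<^sup>2" by simp
    qed
    have b2': "0 \<le> ?R" by (intro sum_nonneg mult_nonneg_nonneg a) auto
    have b3: "?L\<^sup>2 \<le> (S * V)\<^sup>2" using power_mono[OF b1, of 2] by simp
    have e1: "exp (- S) * S \<le> 1" using mult_exp_minus_le_1[of S] by (simp add: mult.commute)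
    have e2: "exp (- S) * S\<^sup>2 \<le> 1" using quadratic_mult_exp_minus_le(2)[OF S] by (simp add: mult.commute)
    have "\<bar>exp (- ?X) - exp (- S)\<bar> \<le> 1"
    proof -
      have "0 \<le> ?X" by (intro sum_nonneg mult_nonneg_nonneg a) auto
      then have "exp (- ?X) \<le> 1" "exp (- S) \<le> 1" using S by auto
      then show ?thesis by (smt (verit) exp_ge_zero)
    qed
    moreover have "\<bar>exp (- S) * ?L\<bar> \<le> V"
    proof -
      have "\<bar>exp (- S) * ?L\<bar> \<le> exp (- S) * (S * V)"
        using b1 by (simp add: abs_mult)
      also have "\<dots> \<le> 1 * V" unfolding mult.assoc[symmetric] using e1 V1 by (intro mult_right_mono) auto
      finally show ?thesis by simp
    qed
    moreover have "\<bar>exp (- S) / 2 * (?L\<^sup>2 - ?R)\<bar> \<le> V\<^sup>2 / 2"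
    proof -
      have "\<bar>?L\<^sup>2 - ?R\<bar> \<le> max (S\<^sup>2 * V\<^sup>2) (S * V\<^sup>2)"
        using b2 b2' b3 by (simp add: power_mult_distrib abs_le_iff) (smt (verit) zero_le_power2)
      then have "exp (- S) * \<bar>?L\<^sup>2 - ?R\<bar> \<le> exp (- S) * max (S\<^sup>2 * V\<^sup>2) (S * V\<^sup>2)"
        by (intro mult_left_mono) auto
      also have "\<dots> = max (exp (- S) * S\<^sup>2 * V\<^sup>2) (exp (- S) * S * V\<^sup>2)"
        by (simp add: max_mult_distrib_left mult.assoc)
      also have "\<dots> \<le> 1 * V\<^sup>2"
        using e1 e2 by (intro max.boundedI mult_right_mono) auto
      finally show ?thesis by (simp add: abs_mult)
    qed
    ultimately have "\<bar>T\<bar> \<le> 1 + V + V\<^sup>2 / 2" unfolding T_def by linarith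
    also have "\<dots> \<le> 3 * V ^ m"
    proof -
      have "1 \<le> V ^ m" "V ^ 2 \<le> V ^ m" using V1 m by (auto intro!: one_le_power power_increasing)
      moreover have "V \<le> V ^ 2" using V1 by (simp add: power2_eq_square)
      ultimately show ?thesis by linarith
    qed
    finally show ?thesis using VS by simp
  qed
qed

subsection \<open>Gaussian laws and anti-concentration\<close>

abbreviation quad_form :: "'i set \<Rightarrow> ('i \<Rightarrow> 'i \<Rightarrow> real) \<Rightarrow> ('i \<Rightarrow> real) \<Rightarrow> real" where
  "quad_form I \<Sigma> a \<equiv> \<Sum>i\<in>I. \<Sum>j\<in>I. a i * a j * \<Sigma> i j"

text \<open>Centered Gaussian laws, given by their characteristic function so that a singular
  \<Sigma> is covered and linear images reduce to computing a quadratic form. The form sees only the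
  symmetric part of \<Sigma>; symmetry is therefore stated separately where it matters.\<close>

definition gaussian_law :: "'i set \<Rightarrow> ('i \<Rightarrow> 'i \<Rightarrow> real) \<Rightarrow> ('i \<Rightarrow> real) measure \<Rightarrow> bool" where
  "gaussian_law I \<Sigma> G \<longleftrightarrow> prob_space G \<and> sets G = sets (borel_on I) \<and>
     (\<forall>a. (\<integral>y. iexp (\<Sum>i\<in>I. a i * y i) \<partial>G) =
       complex_of_real (exp (- quad_form I \<Sigma> a / 2)))"

lemma gaussian_lawD:
  assumes "gaussian_law I \<Sigma> G"
  shows "prob_space G" "sets G = sets (borel_on I)"
    "(\<integral>y. iexp (\<Sum>i\<in>I. a i * y i) \<partial>G) = complex_of_real (exp (- quad_form I \<Sigma> a / 2))"
  using assms by (auto simp: gaussian_law_def)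

lemma gaussian_law_unique:
  assumes "finite I" "gaussian_law I \<Sigma> G" "gaussian_law I \<Sigma>' H"
    and "\<And>i j. i \<in> I \<Longrightarrow> j \<in> I \<Longrightarrow> \<Sigma> i j = \<Sigma>' i j"
  shows "G = H"
  using assms by (intro PiM_eq_of_char_eq[of I]) (auto simp: gaussian_law_def intro!: sum.cong)

text \<open>A characteristic function has modulus at most 1.\<close>

lemma gaussian_law_psd:
  assumes "gaussian_law I \<Sigma> G"
  shows "0 \<le> quad_form I \<Sigma> a"
proof -
  interpret prob_space G using assms by (rule gaussian_lawD)
  have "norm (\<integral>y. iexp (\<Sum>i\<in>I. a i * y i) \<partial>G) \<le> (\<integral>y. norm (iexp (\<Sum>i\<in>I. a i * y i)) \<partial>G)"
    by (rule integral_norm_bound)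
  also have "\<dots> = 1" by (simp add: prob_space del: of_real_sum)
  finally show ?thesis unfolding gaussian_lawD(3)[OF assms] by simp
qed

lemma gaussian_law_image:
  fixes f :: "'a \<Rightarrow> 'i \<Rightarrow> real"
  assumes M: "prob_space M" and f[measurable]: "\<And>i. i \<in> I \<Longrightarrow> (\<lambda>x. f x i) \<in> borel_measurable M"
    and char: "\<And>a. (\<integral>x. iexp (\<Sum>i\<in>I. a i * f x i) \<partial>M) =
      complex_of_real (exp (- quad_form I \<Sigma> a / 2))"
  shows "gaussian_law I \<Sigma> (distr M (borel_on I) (\<lambda>x. \<lambda>i\<in>I. f x i))"
proof -
  have m: "(\<lambda>x. \<lambda>i\<in>I. f x i) \<in> measurable M (borel_on I)" by measurable
  show ?thesis
    unfolding gaussian_law_def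
  proof (intro conjI allI)
    fix a :: "'i \<Rightarrow> real"
    show "(\<integral>y. iexp (\<Sum>i\<in>I. a i * y i) \<partial>distr M (borel_on I) (\<lambda>x. \<lambda>i\<in>I. f x i)) =
       complex_of_real (exp (- quad_form I \<Sigma> a / 2))"
      unfolding char[of a, symmetric] by (subst integral_distr[OF m]) auto
  qed (use M m in \<open>auto intro: prob_space.prob_space_distr\<close>)
qed

lemma gaussian_law_scale:
  assumes G: "gaussian_law I \<Sigma> G"
  shows "gaussian_law I (\<lambda>i j. c i * c j * \<Sigma> i j) (distr G (borel_on I) (\<lambda>y. \<lambda>i\<in>I. c i * y i))"
proof (rule gaussian_law_image)
  note [measurable_cong] = gaussian_lawD(2)[OF G]
  show "(\<lambda>y. c i * y i) \<in> borel_measurable G" if "i \<in> I" for i using that by measurable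
  show "(\<integral>x. iexp (\<Sum>i\<in>I. a i * (c i * x i)) \<partial>G) =
     complex_of_real (exp (- (\<Sum>i\<in>I. \<Sum>j\<in>I. a i * a j * (c i * c j * \<Sigma> i j)) / 2))" for a
    using gaussian_lawD(3)[OF G, of "\<lambda>i. a i * c i"] by (simp add: mult_ac)
qed (use G in \<open>auto intro: gaussian_lawD\<close>)

lemma sum_single_coordinate:
  assumes "finite I" "j \<in> I"
  shows "(\<Sum>i\<in>I. (if i = j then b else 0) * x i) = b * (x j :: real)"
    "(\<Sum>i\<in>I. x i * (if i = j then b else 0)) = x j * b"
  using assms by (auto simp: if_distrib[of "\<lambda>u. u * _"] if_distrib[of "\<lambda>u. _ * u"] cong: if_cong)

lemma gaussian_law_coordinate:
  assumes I: "finite I" "j \<in> I" and G: "gaussian_law I \<Sigma> G" and one: "\<Sigma> j j = 1"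
  shows "distr G borel (\<lambda>y. y j) = std_normal_distribution"
proof (rule Levy_uniqueness)
  interpret G: prob_space G using G by (rule gaussian_lawD)
  note [measurable_cong] = gaussian_lawD(2)[OF G]
  have m[measurable]: "(\<lambda>y. y j) \<in> borel_measurable G" using I by measurable
  show "real_distribution (distr G borel (\<lambda>y. y j))" by (rule G.real_distribution_distr) fact
  show "real_distribution std_normal_distribution" by (rule real_dist_normal_dist)
  show "char (distr G borel (\<lambda>y. y j)) = char std_normal_distribution"
  proof
    fix t
    have "char (distr G borel (\<lambda>y. y j)) t = (\<integral>y. iexp (\<Sum>i\<in>I. (if i = j then t else 0) * y i) \<partial>G)"
      unfolding char_def by (subst integral_distr) (auto simp: sum_single_coordinate I)
    also have "\<dots> = complex_of_real (exp (- (t * t) / 2))"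
      unfolding gaussian_lawD(3)[OF G] using I one
      by (simp add: mult.assoc sum_distrib_left[symmetric] sum_single_coordinate)
    finally show "char (distr G borel (\<lambda>y. y j)) t = char std_normal_distribution t"
      by (simp add: char_std_normal_distribution power2_eq_square)
  qed
qed

text \<open>The part of a Gaussian vector that is uncorrelated with one coordinate is independent of it,
  so this coordinate may be resampled.\<close>

lemma gaussian_law_resample:
  assumes I: "finite I" "j \<in> I" and G: "gaussian_law I \<Sigma> G" and one: "\<Sigma> j j = 1"
    and sym: "\<And>i k. i \<in> I \<Longrightarrow> k \<in> I \<Longrightarrow> \<Sigma> i k = \<Sigma> k i"
  shows "distr (G \<Otimes>\<^sub>M G) (borel_on I) (\<lambda>(y, y'). \<lambda>i\<in>I. y i - \<Sigma> i j * y j + \<Sigma> i j * y' j) = G"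
proof (rule gaussian_law_unique[OF I(1) _ G refl])
  interpret G: prob_space G using G by (rule gaussian_lawD)
  interpret GG: pair_prob_space G G ..
  note [measurable_cong] = gaussian_lawD(2)[OF G]
  have "gaussian_law I \<Sigma> (distr (G \<Otimes>\<^sub>M G) (borel_on I)
      (\<lambda>w. \<lambda>i\<in>I. fst w i - \<Sigma> i j * fst w j + \<Sigma> i j * snd w j))"
  proof (rule gaussian_law_image)
    show "prob_space (G \<Otimes>\<^sub>M G)" by (rule GG.P.prob_space_axioms)
    show "(\<lambda>w. fst w i - \<Sigma> i j * fst w j + \<Sigma> i j * snd w j) \<in> borel_measurable (G \<Otimes>\<^sub>M G)" if "i \<in> I" for i
      using that I by measurable
    fix a :: "_ \<Rightarrow> real"
    let ?S = "\<lambda>w. \<Sum>i\<in>I. a i * (fst w i - \<Sigma> i j * fst w j + \<Sigma> i j * snd w j)"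
    \<comment> \<open>\<open>b\<close> is the covariance of the functional \<open>a\<close> with
      coordinate \<open>j\<close>. Removing it from the coefficient of \<open>j\<close> leaves
      \<open>a'\<close>, the part uncorrelated with that coordinate; \<open>e\<close> puts the same
      coefficient on the fresh copy.\<close>
    define b where "b = (\<Sum>i\<in>I. a i * \<Sigma> i j)"
    define a' where "a' i = a i - (if i = j then b else 0)" for i
    define e where "e i = (if i = j then b else 0)" for i
    let ?E = "\<lambda>w. iexp (\<Sum>i\<in>I. a' i * fst w i) * iexp (\<Sum>i\<in>I. e i * snd w i)"
    have "(\<integral>w. iexp (?S w) \<partial>(G \<Otimes>\<^sub>M G)) =
      (\<integral>w. ?E w \<partial>(G \<Otimes>\<^sub>M G))"
    proof (intro Bochner_Integration.integral_cong refl)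
      fix w :: "('a \<Rightarrow> real) \<times> ('a \<Rightarrow> real)"
      have "(?S w) =
          (\<Sum>i\<in>I. a i * fst w i) - b * fst w j + b * snd w j"
        by (simp add: b_def algebra_simps sum.distrib sum_subtractf sum_distrib_left)
      also have "\<dots> = (\<Sum>i\<in>I. a' i * fst w i) + (\<Sum>i\<in>I. e i * snd w i)"
        by (simp add: a'_def e_def left_diff_distrib sum_subtractf sum_single_coordinate I)
      finally show "iexp (?S w) =
        (?E w)"
        by (simp only: of_real_add distrib_left exp_add)
    qed
    also have "\<dots> = (\<integral>y. (\<integral>y'. iexp (\<Sum>i\<in>I. a' i * y i) * iexp (\<Sum>i\<in>I. e i * y' i) \<partial>G) \<partial>G)"
    proof -
      have "integrable (G \<Otimes>\<^sub>M G) (\<lambda>w. (?E w))"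
        by (rule GG.integrable_const_bound[where B=1]) (auto simp: norm_mult simp del: of_real_sum)
      then show ?thesis
        by (subst GG.integral_fst'[symmetric]) auto
    qed
    also have "\<dots> = (\<integral>y. iexp (\<Sum>i\<in>I. a' i * y i) \<partial>G) * (\<integral>y'. iexp (\<Sum>i\<in>I. e i * y' i) \<partial>G)"
      by simp
    also have "\<dots> = complex_of_real (exp (- quad_form I \<Sigma> a' / 2) *
        exp (- quad_form I \<Sigma> e / 2))"
      unfolding gaussian_lawD(3)[OF G] by simp
    also have "\<dots> = complex_of_real (exp (- quad_form I \<Sigma> a / 2))"
    proof -
      have E: "quad_form I \<Sigma> e = b * b"
        using I one unfolding e_def
        by (simp add: mult.assoc sum_distrib_left[symmetric] sum_single_coordinate)
      have AE1: "(\<Sum>i\<in>I. \<Sum>k\<in>I. a i * e k * \<Sigma> i k) = b * b"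
        using I unfolding e_def
        by (simp add: mult.assoc sum_distrib_left[symmetric] sum_single_coordinate)
          (simp add: b_def sum_distrib_left sum_distrib_right mult_ac)
      have AE2: "(\<Sum>i\<in>I. \<Sum>k\<in>I. e i * a k * \<Sigma> i k) = b * b"
      proof -
        have "(\<Sum>i\<in>I. \<Sum>k\<in>I. e i * a k * \<Sigma> i k) = (\<Sum>k\<in>I. \<Sum>i\<in>I. a k * e i * \<Sigma> k i)"
          by (subst sum.swap) (auto intro!: sum.cong simp: mult_ac sym)
        then show ?thesis using AE1 by simp
      qed
      \<comment> \<open>Variance decomposition: regressing on coordinate \<open>j\<close> removes
        \<open>b * b\<close> from the form of \<open>a\<close>, and the resampled coordinate
        restores exactly this amount.\<close>
      have "quad_form I \<Sigma> a' = quad_form I \<Sigma> a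
          - (\<Sum>i\<in>I. \<Sum>k\<in>I. a i * e k * \<Sigma> i k) - (\<Sum>i\<in>I. \<Sum>k\<in>I. e i * a k * \<Sigma> i k)
          + quad_form I \<Sigma> e"
        unfolding sum.distrib[symmetric] sum_subtractf[symmetric]
        by (intro sum.cong refl) (simp add: a'_def e_def algebra_simps)
      then show ?thesis
        unfolding E AE1 AE2 by (simp add: exp_add[symmetric] field_simps)
    qed
    finally show "(\<integral>w. iexp (?S w) \<partial>(G \<Otimes>\<^sub>M G)) =
      complex_of_real (exp (- quad_form I \<Sigma> a / 2))" .
  qed
  then show "gaussian_law I \<Sigma> (distr (G \<Otimes>\<^sub>M G) (borel_on I)
      (\<lambda>(y, y'). \<lambda>i\<in>I. y i - \<Sigma> i j * y j + \<Sigma> i j * y' j))"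
    by (simp add: split_beta')
qed

section \<open>Hazard rate of the normal law and the cells of the first maximiser\<close>

lemma std_normal_density_decreasing:
  assumes "0 \<le> D" "D \<le> x" shows "std_normal_density x \<le> std_normal_density D"
proof -
  have "D\<^sup>2 \<le> x\<^sup>2" using assms by (intro power_mono)
  then show ?thesis by (simp add: std_normal_density_def divide_right_mono)
qed

lemma std_normal_interval_le:
  assumes "\<And>x. d < x \<Longrightarrow> x \<le> d + \<epsilon> \<Longrightarrow> x \<in> A \<Longrightarrow> std_normal_density x \<le> c" "0 \<le> c" "0 \<le> \<epsilon>"
    "A \<in> sets borel" "A \<subseteq> {d<..d+\<epsilon>}"
  shows "measure std_normal_distribution A \<le> \<epsilon> * c"
proof -
  interpret SN: prob_space std_normal_distribution by (rule prob_space_normal_density) simp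
  have "ennreal (measure std_normal_distribution A) = emeasure std_normal_distribution A"
    by (simp add: SN.emeasure_eq_measure)
  also have "\<dots> = (\<integral>\<^sup>+x. ennreal (std_normal_density x) * indicator A x \<partial>lborel)"
    using assms by (intro emeasure_density) auto
  also have "\<dots> \<le> (\<integral>\<^sup>+x. ennreal c * indicator {d<..d+\<epsilon>} x \<partial>lborel)"
    using assms by (intro nn_integral_mono) (auto split: split_indicator)
  also have "\<dots> = ennreal (\<epsilon> * c)"
    using assms by (simp add: nn_integral_cmult ennreal_mult'[symmetric] mult.commute)
  finally show ?thesis using assms by (simp add: ennreal_le_iff)
qed

text \<open>A point \<open>x\<close> of the upper set brings along the whole interval from
  \<open>x\<close> to \<open>x + h\<close>, on which the density is still at least a fraction
  \<open>exp (- 1)\<close> of its value at \<open>x\<close>. So the density on the short interval is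
  bounded by a multiple of the mass of the upper set itself.\<close>

lemma std_normal_upper_set_le:
  assumes D: "0 \<le> D" "d \<le> D" and \<epsilon>: "0 \<le> \<epsilon>" "\<epsilon> \<le> 1"
    and U[measurable]: "U \<in> sets borel" and up: "\<And>x y. x \<in> U \<Longrightarrow> x \<le> y \<Longrightarrow> y \<in> U"
  shows "measure std_normal_distribution (U \<inter> {d<..d+\<epsilon>}) \<le>
    \<epsilon> * (exp 1 * (D + 2)) * measure std_normal_distribution (U \<inter> {d<..})"
proof -
  interpret SN: prob_space std_normal_distribution by (rule prob_space_normal_density) simp
  let ?m = "measure std_normal_distribution (U \<inter> {d<..})"
  have "measure std_normal_distribution (U \<inter> {d<..d+\<epsilon>}) \<le> \<epsilon> * (exp 1 * (D + 2) * ?m)"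
  proof (rule std_normal_interval_le)
    fix x assume x: "d < x" "x \<le> d + \<epsilon>" "x \<in> U \<inter> {d<..d+\<epsilon>}"
    define h where "h = 1 / (D + 2)" \<comment> \<open>over this distance the density drops by at most a factor \<open>e\<close>\<close>
    have h: "0 < h" "h \<le> 1" using D by (auto simp: h_def field_simps)
    have dens: "exp (- 1) * std_normal_density x \<le> std_normal_density y" if y: "x \<le> y" "y \<le> x + h" for y
    proof -
      have "y\<^sup>2 - x\<^sup>2 = (y - x) * (y + x)" by (simp add: power2_eq_square algebra_simps)
      \<comment> \<open>\<open>x \<le> D + 1\<close> and \<open>y \<le> D + 2\<close>, because
        \<epsilon> and \<open>h\<close> are at most 1.\<close>
      also have "\<dots> \<le> (y - x) * (2 * (D + 2))"
        using y x D \<epsilon> h by (intro mult_left_mono) auto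
      also have "\<dots> \<le> h * (2 * (D + 2))"
        using y D by (intro mult_right_mono) auto
      also have "\<dots> = 2" using D by (simp add: h_def field_simps)
      finally have "- 1 + - (x\<^sup>2) / 2 \<le> - (y\<^sup>2) / 2" by simp
      then have "exp (- 1) * exp (- (x\<^sup>2) / 2) \<le> exp (- (y\<^sup>2) / 2)" unfolding exp_add[symmetric] by simp
      then show ?thesis by (simp add: std_normal_density_def divide_right_mono field_simps)
    qed
    have "ennreal (exp (- 1) * std_normal_density x * h) =
        (\<integral>\<^sup>+y. ennreal (exp (- 1) * std_normal_density x) * indicator {x..x+h} y \<partial>lborel)"
      using h by (simp add: nn_integral_cmult ennreal_mult')
    also have "\<dots> \<le> (\<integral>\<^sup>+y. ennreal (std_normal_density y) * indicator (U \<inter> {d<..}) y \<partial>lborel)"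
      using dens x up by (intro nn_integral_mono) (auto split: split_indicator intro!: ennreal_leI)
    also have "\<dots> = ennreal ?m"
      unfolding SN.emeasure_eq_measure[symmetric] by (intro emeasure_density[symmetric]) auto
    finally have "exp (- 1) * std_normal_density x * h \<le> ?m" by (simp add: ennreal_le_iff)
    then have "std_normal_density x / (exp 1 * (D + 2)) \<le> ?m"
      by (simp add: h_def exp_minus divide_inverse mult_ac)
    moreover have "0 < exp 1 * (D + 2)" using D by (intro mult_pos_pos) auto
    ultimately show "std_normal_density x \<le> exp 1 * (D + 2) * ?m"
      by (simp add: pos_divide_le_eq mult_ac)
  qed (use D \<epsilon> in auto)
  then show ?thesis by (simp add: mult.assoc)
qed

text \<open>The difference of the two coordinates has variance \<open>2 - 2 * \<rho> j k\<close>.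
  This is what makes the maximiser event monotone in its own coordinate.\<close>

lemma gaussian_law_correlation_le_1:
  assumes I: "finite I" "j \<in> I" "k \<in> I" and G: "gaussian_law I \<rho> G"
    and one: "\<rho> j j = 1" "\<rho> k k = 1" and sym: "\<rho> k j = \<rho> j k"
  shows "\<rho> j k \<le> 1"
proof (cases "j = k")
  case False
  define a where "a i = (if i = j then 1 else 0) - (if i = k then 1 else (0 :: real))" for i
  have "(\<Sum>l\<in>I. a i * a l * \<rho> i l) = a i * (\<rho> i j - \<rho> i k)" for i
    using I by (simp add: a_def mult.assoc sum_distrib_left[symmetric] left_diff_distrib
        sum_subtractf sum_single_coordinate)
  then have "(\<Sum>i\<in>I. \<Sum>l\<in>I. a i * a l * \<rho> i l) = (\<rho> j j - \<rho> j k) - (\<rho> k j - \<rho> k k)"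
    using I by (simp add: a_def left_diff_distrib sum_subtractf sum_single_coordinate)
  then show ?thesis using gaussian_law_psd[OF G, of a] one sym by simp
qed (use one in simp)

lemma measurable_first_argmax:
  fixes d :: "'i::linorder \<Rightarrow> real"
  assumes I: "finite I" "j \<in> I" and m: "\<And>k. k \<in> I \<Longrightarrow> (\<lambda>z. z k) \<in> borel_measurable R"
  shows "Measurable.pred R (\<lambda>z. \<forall>k\<in>I. z k - d k \<le> z j - d j \<and> (k < j \<longrightarrow> z k - d k < z j - d j))"
proof (intro pred_intros_finite I)
  fix k assume k: "k \<in> I"
  have le: "Measurable.pred R (\<lambda>z. z k - d k \<le> z j - d j)"
    unfolding pred_def by (intro borel_measurable_le borel_measurable_diff borel_measurable_const m k I)
  have less: "Measurable.pred R (\<lambda>z. z k - d k < z j - d j)"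
    by (intro borel_measurable_pred_less borel_measurable_diff borel_measurable_const m k I)
  show "Measurable.pred R (\<lambda>z. z k - d k \<le> z j - d j \<and> (k < j \<longrightarrow> z k - d k < z j - d j))"
    using le less by (cases "k < j") (auto intro: pred_intros_logic)
qed

text \<open>Conditionally on the part of the vector independent of the coordinate \<open>j\<close>, the event that \<open>j\<close> is
  the first maximiser is an upper set in the coordinate \<open>j\<close>.\<close>

lemma gaussian_argmax_cell_le:
  fixes d :: "'i::linorder \<Rightarrow> real"
  assumes I: "finite I" "j \<in> I" and G: "gaussian_law I \<rho> G"
    and one: "\<And>i. i \<in> I \<Longrightarrow> \<rho> i i = 1" and sym: "\<And>i k. i \<in> I \<Longrightarrow> k \<in> I \<Longrightarrow> \<rho> i k = \<rho> k i"
    and D: "0 \<le> D" "d j \<le> D" and \<epsilon>: "0 \<le> \<epsilon>" "\<epsilon> \<le> 1"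
  defines "cell \<equiv> \<lambda>z. \<forall>k\<in>I. z k - d k \<le> z j - d j \<and> (k < j \<longrightarrow> z k - d k < z j - d j)"
  shows "measure G {z \<in> space G. cell z \<and> d j < z j \<and> z j \<le> d j + \<epsilon>} \<le>
    \<epsilon> * (exp 1 * (D + 2)) * measure G {z \<in> space G. cell z \<and> d j < z j}"
proof -
  let ?\<nu> = "measure std_normal_distribution"
  interpret G: prob_space G using G by (rule gaussian_lawD)
  interpret GG: pair_prob_space G G ..
  note sG[measurable_cong] = gaussian_lawD(2)[OF G]
  have spG: "space G = space (borel_on I)" using sets_eq_imp_space_eq[OF sG] .
  define V where "V = (\<lambda>w :: ('i \<Rightarrow> real) \<times> ('i \<Rightarrow> real). \<lambda>i\<in>I. fst w i - \<rho> i j * fst w j + \<rho> i j * snd w j)"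
  have mV[measurable]: "V \<in> measurable (G \<Otimes>\<^sub>M G) (borel_on I)"
    unfolding V_def using I by measurable
  have V: "distr (G \<Otimes>\<^sub>M G) (borel_on I) V = G"
    using gaussian_law_resample[OF I G] one sym I by (simp add: V_def split_beta')
  have [measurable]: "(\<lambda>z. z k) \<in> borel_measurable (PiM I (\<lambda>_. borel :: real measure))" if "k \<in> I" for k
    using that by measurable
  have [measurable]: "Measurable.pred (borel_on I) cell"
    unfolding cell_def by (intro measurable_first_argmax I) measurable
  \<comment> \<open>The slice of the cell over the part of \<open>y\<close> independent of
    coordinate \<open>j\<close>. \<open>V\<close> reads only coordinate \<open>j\<close> of its
    second argument, so a constant function can carry the value \<open>u\<close>.\<close>
  define U where "U y = {u. cell (V (y, (\<lambda>_. u)))}" for y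
  have cellV: "cell (V (y, y')) \<longleftrightarrow> y' j \<in> U y" for y y'
    using I by (simp add: U_def cell_def V_def)
  have Vj: "V (y, y') j = y' j" for y y' using I one by (simp add: V_def)
  have coord: "distr G borel (\<lambda>y. y j) = std_normal_distribution"
    by (rule gaussian_law_coordinate[OF I G]) (simp add: one I)
  have mj[measurable]: "(\<lambda>y. y j) \<in> borel_measurable G" using I by measurable
  let ?r = "\<lambda>y k u. y k - \<rho> k j * y j + \<rho> k j * u - d k"
  have U_iff: "u \<in> U y \<longleftrightarrow> (\<forall>k\<in>I. ?r y k u \<le> u - d j \<and>
      (k < j \<longrightarrow> ?r y k u < u - d j))" for u y
    using I one by (auto simp: U_def cell_def V_def)
  have mU: "U y \<in> sets borel" for y
  proof -
    have "U y = (\<Inter>k\<in>I. {u. ?r y k u \<le> u - d j} \<inter>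
        {u. k < j \<longrightarrow> ?r y k u < u - d j})"
      using I by (auto simp: U_iff)
    also have "\<dots> \<in> sets borel"
    proof (intro sets.finite_INT sets.Int)
      show "{u. k < j \<longrightarrow> ?r y k u < u - d j} \<in> sets borel" for k
        by (cases "k < j") auto
    qed (use I in auto)
    finally show ?thesis .
  qed
  have up: "x' \<in> U y" if x: "x \<in> U y" "x \<le> x'" for x x' y
    unfolding U_iff
  proof (intro ballI conjI impI)
    fix k assume k: "k \<in> I"
    \<comment> \<open>Raising coordinate \<open>j\<close> by some amount raises coordinate
      \<open>k\<close> by at most that amount, as the correlation is at most 1; the lead of
      \<open>j\<close> cannot shrink.\<close>
    have "(1 - \<rho> k j) * x \<le> (1 - \<rho> k j) * x'"
      using gaussian_law_correlation_le_1[OF I(1) k I(2) G one one sym] k I x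
      by (intro mult_left_mono) auto
    then have *: "\<rho> k j * x' - x' \<le> \<rho> k j * x - x"
      by (simp add: algebra_simps)
    show "?r y k x' \<le> x' - d j"
      using x(1) k * unfolding U_iff by force
    show "?r y k x' < x' - d j" if "k < j"
      using x(1) k * that unfolding U_iff by force
  qed
  let ?S = "\<lambda>A. {w \<in> space (G \<Otimes>\<^sub>M G). cell (V w) \<and> snd w j \<in> A}"
  have slice: "Pair y -` (?S A) = (\<lambda>y. y j) -` (U y \<inter> A) \<inter> space G"
    if "y \<in> space G" for y A
    using that by (auto simp: space_pair_measure cellV)
  \<comment> \<open>Measurability in \<open>y\<close> comes from the slices of one measurable set in
    the product, whose mass is that of \<open>U y \<inter> A\<close> under the normal law of
    coordinate \<open>j\<close>.\<close>
  have int: "integrable G (\<lambda>y. ?\<nu> (U y \<inter> A))" if [measurable]: "A \<in> sets borel" for A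
  proof (rule G.integrable_const_bound[where B=1])
    have "(\<lambda>y. enn2real (emeasure G (Pair y -` (?S A)))) \<in> borel_measurable G"
      using I by (intro borel_measurable_enn2real G.measurable_emeasure_Pair) measurable
    moreover have "enn2real (emeasure G (Pair y -` (?S A))) =
        ?\<nu> (U y \<inter> A)" if y: "y \<in> space G" for y
      unfolding coord[symmetric] measure_def[symmetric] slice[OF y] using mU[of y] by (subst measure_distr) auto
    ultimately show "(\<lambda>y. ?\<nu> (U y \<inter> A)) \<in> borel_measurable G"
      by (subst (asm) measurable_cong) auto
  qed (auto simp: prob_space.prob_le_1 prob_space_normal_density)
  have split: "measure G {z \<in> space G. cell z \<and> z j \<in> A} =
      (\<integral>y. ?\<nu> (U y \<inter> A) \<partial>G)" if [measurable]: "A \<in> sets borel" for A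
  proof -
    have "emeasure G {z \<in> space G. cell z \<and> z j \<in> A} =
        emeasure (distr (G \<Otimes>\<^sub>M G) (borel_on I) V) {z \<in> space G. cell z \<and> z j \<in> A}"
      by (simp add: V)
    also have "\<dots> = emeasure (G \<Otimes>\<^sub>M G) (?S A)"
    proof (subst emeasure_distr)
      show "{z \<in> space G. cell z \<and> z j \<in> A} \<in> sets (borel_on I)"
        unfolding spG using I by measurable
      have "V -` {z \<in> space G. cell z \<and> z j \<in> A} \<inter> space (G \<Otimes>\<^sub>M G) =
          (?S A)"
        using measurable_space[OF mV] by (auto simp: spG) (metis Vj prod.collapse)+
      then show "emeasure (G \<Otimes>\<^sub>M G) (V -` {z \<in> space G. cell z \<and> z j \<in> A} \<inter> space (G \<Otimes>\<^sub>M G)) =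
          emeasure (G \<Otimes>\<^sub>M G) (?S A)" by simp
    qed (rule mV)
    also have "\<dots> = (\<integral>\<^sup>+y. emeasure G (Pair y -` (?S A)) \<partial>G)"
      using I by (intro G.emeasure_pair_measure_alt) measurable
    also have "\<dots> = (\<integral>\<^sup>+y. ennreal (?\<nu> (U y \<inter> A)) \<partial>G)"
    proof (intro nn_integral_cong)
      fix y assume y: "y \<in> space G"
      have "emeasure G (Pair y -` (?S A)) =
          emeasure (distr G borel (\<lambda>y. y j)) (U y \<inter> A)"
        unfolding slice[OF y] using mU[of y] by (subst emeasure_distr) auto
      then show "emeasure G (Pair y -` (?S A)) =
          ennreal (?\<nu> (U y \<inter> A))"
        unfolding coord
        by (simp add: finite_measure.emeasure_eq_measure prob_space.finite_measure prob_space_normal_density)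
    qed
    also have "\<dots> = ennreal (\<integral>y. ?\<nu> (U y \<inter> A) \<partial>G)"
      by (intro nn_integral_eq_integral int that) auto
    finally show ?thesis by (simp add: G.emeasure_eq_measure)
  qed
  have "measure G {z \<in> space G. cell z \<and> d j < z j \<and> z j \<le> d j + \<epsilon>} =
      (\<integral>y. ?\<nu> (U y \<inter> {d j<..d j+\<epsilon>}) \<partial>G)"
    using split[of "{d j<..d j+\<epsilon>}"] by simp
  also have "\<dots> \<le> (\<integral>y. \<epsilon> * (exp 1 * (D + 2)) * ?\<nu> (U y \<inter> {d j<..}) \<partial>G)"
    by (intro integral_mono integrable_mult_right int std_normal_upper_set_le[OF D \<epsilon> mU up]) auto
  also have "\<dots> = \<epsilon> * (exp 1 * (D + 2)) * measure G {z \<in> space G. cell z \<and> d j < z j}"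
    using split[of "{d j<..}"] by simp
  finally show ?thesis .
qed

text \<open>Cells with threshold at most \<open>D\<close> obey the hazard-rate bound, and
  disjointness makes their total mass at most 1. For a higher threshold the density is already below
  its value at \<open>D\<close>, which costs one small term per coordinate. \<open>D\<close> is left
  free to balance the two.\<close>

lemma gaussian_max_anticoncentration_standardized:
  fixes d :: "'i::linorder \<Rightarrow> real"
  assumes I: "finite I" and G: "gaussian_law I \<rho> G"
    and one: "\<And>i. i \<in> I \<Longrightarrow> \<rho> i i = 1" and sym: "\<And>i k. i \<in> I \<Longrightarrow> k \<in> I \<Longrightarrow> \<rho> i k = \<rho> k i"
    and D: "0 \<le> D" and \<epsilon>: "0 \<le> \<epsilon>" "\<epsilon> \<le> 1"
  shows "measure G {z \<in> space G. (\<exists>j\<in>I. d j < z j) \<and> (\<forall>j\<in>I. z j \<le> d j + \<epsilon>)} \<le>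
    \<epsilon> * (real (card I) * std_normal_density D + exp 1 * (D + 2))"
proof -
  let ?E = "{z \<in> space G. (\<exists>j\<in>I. d j < z j) \<and> (\<forall>j\<in>I. z j \<le> d j + \<epsilon>)}"
  interpret G: prob_space G using G by (rule gaussian_lawD)
  note sG[measurable_cong] = gaussian_lawD(2)[OF G]
  define cell where "cell j z \<longleftrightarrow> (\<forall>k\<in>I. z k - d k \<le> z j - d j \<and> (k < j \<longrightarrow> z k - d k < z j - d j))" for j z
  have [measurable]: "(\<lambda>z. z k) \<in> borel_measurable G" if "k \<in> I" for k
    using that by measurable
  have [measurable]: "Measurable.pred G (cell j)" if "j \<in> I" for j
    unfolding cell_def[abs_def] using that by (intro measurable_first_argmax I) measurable
  define A where "A j = {z \<in> space G. cell j z \<and> d j < z j \<and> z j \<le> d j + \<epsilon>}" for j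
  define B where "B j = {z \<in> space G. cell j z \<and> d j < z j}" for j
  have mAB: "A j \<in> sets G" "B j \<in> sets G" if "j \<in> I" for j
    unfolding A_def B_def using that I by measurable
  have "disjoint_family_on B I"
    unfolding disjoint_family_on_def B_def cell_def by (auto simp: neq_iff) force+
  then have disj: "(\<Sum>j\<in>I. measure G (B j)) \<le> 1"
    using mAB I by (subst G.finite_measure_finite_Union[symmetric]) auto
  have "?E \<subseteq> (\<Union>j\<in>I. A j)"
  proof safe
    fix z i assume z: "z \<in> space G" "i \<in> I" "d i < z i" "\<forall>j\<in>I. z j \<le> d j + \<epsilon>"
    \<comment> \<open>The largest excess over the thresholds, positive because coordinate
      \<open>i\<close> exceeds its own; the least index attaining it names the cell.\<close>
    define m where "m = Max ((\<lambda>k. z k - d k) ` I)"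
    define J where "J = {k \<in> I. z k - d k = m}"
    have m: "z k - d k \<le> m" if "k \<in> I" for k using I that by (auto simp: m_def)
    have "m \<in> (\<lambda>k. z k - d k) ` I" unfolding m_def using I z by (intro Max_in) auto
    then have J: "finite J" "J \<noteq> {}" using I by (auto simp: J_def)
    define j where "j = Min J"
    have j: "j \<in> I" "z j - d j = m" using Min_in[OF J] by (auto simp: J_def j_def)
    have "z k - d k < m" if "k \<in> I" "k < j" for k
    proof (rule ccontr)
      assume "\<not> z k - d k < m"
      then have "k \<in> J" using m[OF that(1)] that by (auto simp: J_def)
      then show False using Min_le[OF J(1) \<open>k \<in> J\<close>] that by (simp add: j_def leD)
    qed
    then have "cell j z" using j m by (auto simp: cell_def)
    then show "z \<in> (\<Union>j\<in>I. A j)"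
      using z j m[of i] by (auto simp: A_def intro!: bexI[of _ j])
  qed
  then have "measure G ?E \<le> measure G (\<Union>j\<in>I. A j)"
    using mAB I by (intro G.finite_measure_mono) auto
  also have "\<dots> \<le> (\<Sum>j\<in>I. measure G (A j))"
    using mAB I by (intro G.finite_measure_subadditive_finite) auto
  also have "\<dots> \<le> (\<Sum>j\<in>I. \<epsilon> * std_normal_density D + \<epsilon> * (exp 1 * (D + 2)) * measure G (B j))"
  proof (intro sum_mono)
    fix j assume j: "j \<in> I"
    show "measure G (A j) \<le> \<epsilon> * std_normal_density D + \<epsilon> * (exp 1 * (D + 2)) * measure G (B j)"
    proof (cases "d j \<le> D")
      case True
      have "measure G (A j) \<le> \<epsilon> * (exp 1 * (D + 2)) * measure G (B j)"
        unfolding A_def B_def cell_def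
        by (rule gaussian_argmax_cell_le[where d=d and \<rho>=\<rho>]) (use one sym in \<open>auto intro: I j G D True \<epsilon>\<close>)
      moreover have "0 \<le> \<epsilon> * std_normal_density D" using \<epsilon> by simp
      ultimately show ?thesis by linarith
    next
      case False
      have [measurable]: "(\<lambda>y. y j) \<in> borel_measurable G" using j by measurable
      have "measure G (A j) \<le> measure G ((\<lambda>y. y j) -` {d j<..d j+\<epsilon>} \<inter> space G)"
        unfolding A_def by (intro G.finite_measure_mono) auto
      also have "\<dots> = measure (distr G borel (\<lambda>y. y j)) {d j<..d j+\<epsilon>}"
        by (subst measure_distr) auto
      also have "\<dots> = measure std_normal_distribution {d j<..d j+\<epsilon>}"
        by (subst gaussian_law_coordinate[OF I j G one[OF j]]) simp
      also have "\<dots> \<le> \<epsilon> * std_normal_density D"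
        using False D \<epsilon> by (intro std_normal_interval_le std_normal_density_decreasing) auto
      finally show ?thesis using D \<epsilon> by (smt (verit) exp_ge_zero measure_nonneg mult_nonneg_nonneg)
    qed
  qed
  also have "\<dots> = \<epsilon> * (real (card I) * std_normal_density D) + \<epsilon> * (exp 1 * (D + 2)) * (\<Sum>j\<in>I. measure G (B j))"
    by (simp add: sum.distrib sum_distrib_left)
  also have "\<dots> \<le> \<epsilon> * (real (card I) * std_normal_density D) + \<epsilon> * (exp 1 * (D + 2)) * 1"
    using D \<epsilon> disj by (intro add_left_mono mult_left_mono mult_nonneg_nonneg) auto
  finally show ?thesis by (simp add: algebra_simps)
qed

text \<open>The balancing choice of \<open>D\<close>: the product is exactly
  \<open>1 / sqrt (2 * pi)\<close>.\<close>

lemma card_mult_std_normal_density_le_1: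
  assumes "p \<ge> 1" shows "real p * std_normal_density (sqrt (2 * ln (real p))) \<le> 1"
proof -
  have "real p * std_normal_density (sqrt (2 * ln (real p))) = 1 / sqrt (2 * pi)"
    using assms by (simp add: std_normal_density_def exp_minus)
  also have "\<dots> \<le> 1" using pi_gt3 by (simp add: real_le_rsqrt)
  finally show ?thesis .
qed

text \<open>Dividing by the standard deviations turns the common threshold \<open>t\<close> into
  \<open>c j * t\<close>, which depends on \<open>j\<close>; hence the vector of thresholds in the
  standardised version. The length of the interval grows by a factor of at most
  \<open>1 / sqrt b\<close>.\<close>

lemma gaussian_max_anticoncentration:
  fixes I :: "'i::linorder set"
  assumes I: "finite I" "I \<noteq> {}" and G: "gaussian_law I \<Sigma> G"
    and b: "0 < b" "\<And>i. i \<in> I \<Longrightarrow> b \<le> \<Sigma> i i" and sym: "\<And>i k. i \<in> I \<Longrightarrow> k \<in> I \<Longrightarrow> \<Sigma> i k = \<Sigma> k i"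
    and \<delta>: "0 \<le> \<delta>" "\<delta> \<le> sqrt b"
  shows "measure G {y \<in> space G. (\<exists>j\<in>I. t < y j) \<and> (\<forall>j\<in>I. y j \<le> t + \<delta>)} \<le>
    \<delta> / sqrt b * (1 + exp 1 * (sqrt (2 * ln (real (card I))) + 2))"
proof -
  let ?A = "{y \<in> space G. (\<exists>j\<in>I. t < y j) \<and> (\<forall>j\<in>I. y j \<le> t + \<delta>)}"
  interpret G: prob_space G using G by (rule gaussian_lawD)
  note sG[measurable_cong] = gaussian_lawD(2)[OF G]
  define c where "c i = 1 / sqrt (\<Sigma> i i)" for i
  define H where "H = distr G (borel_on I) (\<lambda>y. \<lambda>i\<in>I. c i * y i)"
  have H: "gaussian_law I (\<lambda>i j. c i * c j * \<Sigma> i j) H"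
    unfolding H_def by (rule gaussian_law_scale[OF G])
  interpret H: prob_space H using H by (rule gaussian_lawD)
  note sH[measurable_cong] = gaussian_lawD(2)[OF H]
  have pos: "0 < \<Sigma> i i" if "i \<in> I" for i using b that by force
  have c: "0 < c i" "c i \<le> 1 / sqrt b" if "i \<in> I" for i
    using pos[OF that] b that by (auto simp: c_def frac_le)
  have m: "(\<lambda>y. \<lambda>i\<in>I. c i * y i) \<in> measurable G (borel_on I)" by measurable
  let ?scale = "\<lambda>y. \<lambda>i\<in>I. c i * y i"
  let ?E = "{z \<in> space H. (\<exists>j\<in>I. c j * t < z j) \<and> (\<forall>j\<in>I. z j \<le> c j * t + \<delta> / sqrt b)}"
  have E: "?E \<in> sets H" using I by measurable
  have "measure G ?A \<le>
      measure G (?scale -` ?E \<inter> space G)"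
  proof (rule G.finite_measure_mono)
    show "?scale -` ?E \<inter> space G \<in> sets G"
      using m E unfolding sH by (rule measurable_sets)
    show "?A \<subseteq> ?scale -` ?E \<inter> space G"
    proof safe
      fix y j assume y: "y \<in> space G" "\<forall>j\<in>I. y j \<le> t + \<delta>" and j: "j \<in> I" "t < y j"
      have sp: "(\<lambda>i\<in>I. c i * y i) \<in> space H"
        using measurable_space[OF m y(1)] sets_eq_imp_space_eq[OF sH] by simp
      have le: "c k * y k \<le> c k * t + \<delta> / sqrt b" if k: "k \<in> I" for k
      proof -
        have "c k * y k \<le> c k * (t + \<delta>)" using y k c[OF k] by (intro mult_left_mono) auto
        also have "\<dots> = c k * t + c k * \<delta>" by (simp add: algebra_simps)
        also have "c k * \<delta> \<le> 1 / sqrt b * \<delta>" using c[OF k] \<delta> by (intro mult_right_mono) auto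
        finally show ?thesis by simp
      qed
      have "c j * t < c j * y j" using c[OF j(1)] j by simp
      then show "y \<in> ?scale -` ?E" using sp le j by auto
    qed
  qed
  also have "\<dots> = measure H ?E"
    unfolding H_def by (subst measure_distr[OF m]) (use E in \<open>auto simp: sH[unfolded H_def] H_def\<close>)
  also have "\<dots> \<le> \<delta> / sqrt b * (real (card I) * std_normal_density (sqrt (2 * ln (real (card I)))) +
      exp 1 * (sqrt (2 * ln (real (card I))) + 2))"
  proof (rule gaussian_max_anticoncentration_standardized[OF I(1) H])
    show "c i * c i * \<Sigma> i i = 1" if "i \<in> I" for i
      using pos[OF that] by (simp add: c_def field_simps)
    show "0 \<le> sqrt (2 * ln (real (card I)))" using I by (simp add: Suc_leI card_gt_0_iff)
    show "c i * c k * \<Sigma> i k = c k * c i * \<Sigma> k i" if "i \<in> I" "k \<in> I" for i k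
      using sym[OF that] by simp
  qed (use \<delta> b in auto)
  also have "\<dots> \<le> \<delta> / sqrt b * (1 + exp 1 * (sqrt (2 * ln (real (card I))) + 2))"
    using \<delta> b I by (intro mult_left_mono add_right_mono card_mult_std_normal_density_le_1)
      (auto simp: Suc_leI card_gt_0_iff)
  finally show ?thesis .
qed

subsection \<open>Lindeberg replacement\<close>

text \<open>A smooth substitute for the indicator of \<open>max\<^sub>i \<bar>x\<^sub>i\<bar> \<le> t\<close>.\<close>

definition soft_box :: "'i set \<Rightarrow> real \<Rightarrow> real \<Rightarrow> ('i \<Rightarrow> real) \<Rightarrow> real" where
  "soft_box I \<beta> t x = exp (- (\<Sum>(i, s)\<in>I \<times> {- 1, 1}. exp (\<beta> * (s * x i - t))))"

lemma soft_box_bounds: "0 \<le> soft_box I \<beta> t x" "soft_box I \<beta> t x \<le> 1" "\<bar>soft_box I \<beta> t x\<bar> \<le> 1"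
  by (auto simp: soft_box_def intro!: sum_nonneg)

lemma soft_box_measurable[measurable (raw)]:
  assumes "\<And>i. i \<in> I \<Longrightarrow> (\<lambda>w. f w i) \<in> borel_measurable M"
  shows "(\<lambda>w. soft_box I \<beta> t (f w)) \<in> borel_measurable M"
proof -
  have "(\<lambda>w. exp (\<beta> * (snd k * f w (fst k) - t))) \<in> borel_measurable M" if "k \<in> I \<times> {- 1, 1}" for k
  proof -
    have [measurable]: "(\<lambda>w. f w (fst k)) \<in> borel_measurable M" using that by (intro assms) auto
    show ?thesis by measurable
  qed
  then have [measurable]: "(\<lambda>w. \<Sum>k\<in>I \<times> {- 1, 1}. exp (\<beta> * (snd k * f w (fst k) - t))) \<in> borel_measurable M"
    by (rule borel_measurable_sum)
  show ?thesis
    unfolding soft_box_def split_beta by measurable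
qed

text \<open>The margin makes each of the \<open>2 * card I\<close> exponentials at most
  \<open>exp (- K) / (2 * card I)\<close>, so that their sum is at most \<open>exp (- K)\<close>.
  This is where the smoothing width acquires its logarithm of the dimension.\<close>

lemma soft_box_near_1:
  assumes I: "finite I" and \<beta>: "0 < \<beta>" and x: "\<And>i. i \<in> I \<Longrightarrow> \<bar>x i\<bar> \<le> t - (ln (2 * real (card I)) + K) / \<beta>"
  shows "1 - exp (- K) \<le> soft_box I \<beta> t x"
proof (cases "I = {}")
  case False
  then have c: "0 < real (card I)" using I by (simp add: card_gt_0_iff)
  have "(\<Sum>(i, s)\<in>I \<times> {- 1, 1}. exp (\<beta> * (s * x i - t))) \<le> (\<Sum>(i, s)\<in>I \<times> {- 1, 1 :: real}. exp (- K) / (2 * real (card I)))"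
  proof (intro sum_mono, clarsimp simp del: insert_iff)
    fix i and s :: real assume "i \<in> I" "s \<in> {- 1, 1}"
    then have "s * x i - t \<le> - ((ln (2 * real (card I)) + K) / \<beta>)" using x[of i] by auto
    then have "\<beta> * (s * x i - t) \<le> - ln (2 * real (card I)) - K"
      using \<beta> by (simp add: field_simps)
    then have "exp (\<beta> * (s * x i - t)) \<le> exp (- K - ln (2 * real (card I)))" by simp
    also have "\<dots> = exp (- K) / (2 * real (card I))" using c by (simp add: exp_diff)
    finally show "exp (\<beta> * (s * x i - t)) \<le> exp (- K) / (2 * real (card I))" .
  qed
  also have "\<dots> = exp (- K)" using c by (simp add: card_cartesian_product)
  finally have "- (\<Sum>(i, s)\<in>I \<times> {- 1, 1}. exp (\<beta> * (s * x i - t))) \<ge> - exp (- K)" by simp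
  then have "exp (- exp (- K)) \<le> soft_box I \<beta> t x" by (simp add: soft_box_def)
  moreover have "1 - exp (- K) \<le> exp (- exp (- K))" using exp_ge_add_one_self[of "- exp (- K)"] by simp
  ultimately show ?thesis by simp
qed (simp add: soft_box_def)

text \<open>A single exponential already exceeds \<open>K\<close>, since
  \<open>K \<le> exp K\<close>.\<close>

lemma soft_box_near_0:
  assumes I: "finite I" and \<beta>: "0 < \<beta>" and i: "i \<in> I" "t + K / \<beta> \<le> \<bar>x i\<bar>"
  shows "soft_box I \<beta> t x \<le> exp (- K)"
proof -
  define s :: real where "s = (if x i \<ge> 0 then 1 else - 1)"
  have s: "s \<in> {- 1, 1}" "s * x i = \<bar>x i\<bar>" by (auto simp: s_def)
  have "K \<le> \<beta> * (\<bar>x i\<bar> - t)" using i \<beta> by (simp add: field_simps)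
  also have "\<dots> \<le> exp (\<beta> * (s * x i - t))"
    unfolding s(2) using exp_ge_add_one_self[of "\<beta> * (\<bar>x i\<bar> - t)"] by linarith
  also have "\<dots> \<le> (\<Sum>(i, s)\<in>I \<times> {- 1, 1}. exp (\<beta> * (s * x i - t)))"
  proof -
    have "(\<lambda>(i, s). exp (\<beta> * (s * x i - t))) (i, s) \<le> (\<Sum>(i, s)\<in>I \<times> {- 1, 1}. exp (\<beta> * (s * x i - t)))"
    proof (rule member_le_sum)
      show "(i, s) \<in> I \<times> {- 1, 1}" using i(1) s(1) by (rule SigmaI)
      show "finite (I \<times> {- 1, 1 :: real})" using I by blast
    qed (clarsimp)
    then show ?thesis by (simp only: prod.case)
  qed
  finally show ?thesis
    unfolding soft_box_def exp_le_cancel_iff neg_le_iff_le .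
qed

section \<open>Replacing independent summands one by one\<close>

lemma expectation_diff_le:
  fixes g h :: "'a \<Rightarrow> real"
  assumes R: "prob_space R" and [measurable]: "g \<in> borel_measurable R" "h \<in> borel_measurable R"
    and b: "\<And>w. \<bar>g w\<bar> \<le> 1" "\<And>w. \<bar>h w\<bar> \<le> 1" and gh: "\<And>w. \<bar>g w - h w\<bar> \<le> c"
  shows "\<bar>(\<integral>w. g w \<partial>R) - (\<integral>w. h w \<partial>R)\<bar> \<le> c"
proof -
  interpret R: prob_space R by fact
  have int: "integrable R g" "integrable R h"
    by (auto intro!: R.integrable_const_bound[where B=1] simp: b)
  then have "\<bar>(\<integral>w. g w \<partial>R) - (\<integral>w. h w \<partial>R)\<bar> = \<bar>\<integral>w. g w - h w \<partial>R\<bar>" by simp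
  also have "\<dots> \<le> (\<integral>w. \<bar>g w - h w\<bar> \<partial>R)" by (rule integral_abs_bound)
  also have "\<dots> \<le> c" using int by (intro R.integral_le_const) (auto simp: gh)
  finally show ?thesis .
qed

lemma abs_expectation_le_1:
  fixes g :: "'a \<Rightarrow> real"
  assumes R: "prob_space R" and b: "\<And>w. \<bar>g w\<bar> \<le> 1"
  shows "\<bar>\<integral>w. g w \<partial>R\<bar> \<le> 1"
proof -
  interpret R: prob_space R by fact
  have "\<bar>\<integral>w. g w \<partial>R\<bar> \<le> (\<integral>w. \<bar>g w\<bar> \<partial>R)" by (rule integral_abs_bound)
  also have "\<dots> \<le> 1"
  \<comment> \<open>A non-integrable integrand has integral 0 by convention, so the bound persists
    in that case.\<close>
  proof (cases "integrable R (\<lambda>w. \<bar>g w\<bar>)")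
    case True then show ?thesis by (intro R.integral_le_const) (auto simp: b)
  qed (simp add: not_integrable_integral_eq)
  finally show ?thesis .
qed

text \<open>While one summand is exchanged the others are frozen and act as a shift; therefore
  \<open>step\<close> is uniform in \<open>x\<close> and the induction generalises over it.\<close>

lemma lindeberg_replacement:
  fixes \<zeta> :: "'a \<Rightarrow> 'i \<Rightarrow> real" and \<eta> :: "'b \<Rightarrow> 'i \<Rightarrow> real"
  assumes P: "prob_space P" and G: "prob_space G"
    and \<zeta>[measurable]: "\<And>i. i \<in> I \<Longrightarrow> (\<lambda>w. \<zeta> w i) \<in> borel_measurable P"
    and \<eta>[measurable]: "\<And>i. i \<in> I \<Longrightarrow> (\<lambda>w. \<eta> w i) \<in> borel_measurable G"
    and step: "\<And>x. \<bar>(\<integral>w. soft_box I \<beta> t (\<lambda>i. x i + \<zeta> w i) \<partial>P) - (\<integral>w. soft_box I \<beta> t (\<lambda>i. x i + \<eta> w i) \<partial>G)\<bar> \<le> \<Delta>"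
    and L: "finite L"
  shows "\<bar>(\<integral>w. soft_box I \<beta> t (\<lambda>i. x i + (\<Sum>l\<in>L. \<zeta> (w l) i)) \<partial>PiM L (\<lambda>_. P)) -
      (\<integral>w. soft_box I \<beta> t (\<lambda>i. x i + (\<Sum>l\<in>L. \<eta> (w l) i)) \<partial>PiM L (\<lambda>_. G))\<bar> \<le> real (card L) * \<Delta>"
  using L
proof (induction L arbitrary: x rule: finite_induct)
  case empty
  interpret P: prob_space "PiM {} (\<lambda>_::'c. P)" by (intro prob_space_PiM P)
  interpret G: prob_space "PiM {} (\<lambda>_::'c. G)" by (intro prob_space_PiM G)
  show ?case by (simp add: P.prob_space G.prob_space)
next
  case (insert k L)
  interpret P: prob_space P by fact
  interpret G: prob_space G by fact
  interpret PP: product_prob_space "\<lambda>_::'c. P" L by (intro product_prob_spaceI P)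
  interpret GG: product_prob_space "\<lambda>_::'c. G" L by (intro product_prob_spaceI G)
  interpret PL: prob_space "PiM L (\<lambda>_. P)" by (intro prob_space_PiM P)
  interpret GL: prob_space "PiM L (\<lambda>_. G)" by (intro prob_space_PiM G)
  interpret PL': prob_space "PiM (insert k L) (\<lambda>_. P)" by (intro prob_space_PiM P)
  interpret GL': prob_space "PiM (insert k L) (\<lambda>_. G)" by (intro prob_space_PiM G)
  interpret PG: pair_prob_space "PiM L (\<lambda>_. P)" G ..
  interpret GG2: pair_prob_space "PiM L (\<lambda>_. G)" G ..
  interpret PG2: pair_prob_space "PiM L (\<lambda>_. P)" P ..
  let ?f = "soft_box I \<beta> t" and ?PL = "PiM L (\<lambda>_. P)" and ?GL = "PiM L (\<lambda>_. G)"
    and ?u = "\<lambda>w i. x i + (\<Sum>l\<in>L. \<zeta> (w l) i)"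
    and ?v = "\<lambda>y w i. (x i + \<eta> y i) + (\<Sum>l\<in>L. \<zeta> (w l) i)"
    and ?v' = "\<lambda>y w i. (x i + \<eta> y i) + (\<Sum>l\<in>L. \<eta> (w l) i)"
  note bd = soft_box_bounds(3)[of I \<beta> t]
  have eqP: "(\<integral>w. ?f (\<lambda>i. x i + (\<Sum>l\<in>insert k L. \<zeta> (w l) i)) \<partial>PiM (insert k L) (\<lambda>_. P)) =
      (\<integral>w. (\<integral>y. ?f (\<lambda>i. ?u w i + \<zeta> y i) \<partial>P) \<partial>?PL)"
  proof (subst PP.product_integral_insert[OF insert.hyps(1,2)])
    show "integrable (PiM (insert k L) (\<lambda>_. P)) (\<lambda>w. ?f (\<lambda>i. x i + (\<Sum>l\<in>insert k L. \<zeta> (w l) i)))"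
      by (rule PL'.integrable_const_bound[where B=1]) (auto simp: bd)
    have "(\<Sum>l\<in>L. \<zeta> ((w(k := y)) l) i) = (\<Sum>l\<in>L. \<zeta> (w l) i)" for w y i
      using insert.hyps by (intro sum.cong) auto
    then show "(\<integral>w. (\<integral>y. ?f (\<lambda>i. x i + (\<Sum>l\<in>insert k L. \<zeta> ((w(k := y)) l) i)) \<partial>P) \<partial>?PL) =
      (\<integral>w. (\<integral>y. ?f (\<lambda>i. ?u w i + \<zeta> y i) \<partial>P) \<partial>?PL)"
      using insert.hyps by (simp add: add_ac)
  qed
  have eqG: "(\<integral>w. ?f (\<lambda>i. x i + (\<Sum>l\<in>insert k L. \<eta> (w l) i)) \<partial>PiM (insert k L) (\<lambda>_. G)) =
      (\<integral>w. (\<integral>y. ?f (?v' y w) \<partial>G) \<partial>?GL)"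
  proof (subst GG.product_integral_insert[OF insert.hyps(1,2)])
    show "integrable (PiM (insert k L) (\<lambda>_. G)) (\<lambda>w. ?f (\<lambda>i. x i + (\<Sum>l\<in>insert k L. \<eta> (w l) i)))"
      by (rule GL'.integrable_const_bound[where B=1]) (auto simp: bd)
    have "(\<Sum>l\<in>L. \<eta> ((w(k := y)) l) i) = (\<Sum>l\<in>L. \<eta> (w l) i)" for w y i
      using insert.hyps by (intro sum.cong) auto
    then show "(\<integral>w. (\<integral>y. ?f (\<lambda>i. x i + (\<Sum>l\<in>insert k L. \<eta> ((w(k := y)) l) i)) \<partial>G) \<partial>?GL) =
      (\<integral>w. (\<integral>y. ?f (?v' y w) \<partial>G) \<partial>?GL)"
      using insert.hyps by (simp add: add_ac)
  qed
  have swapP: "(\<integral>w. (\<integral>y. ?f (\<lambda>i. ?u w i + \<eta> y i) \<partial>G) \<partial>?PL) =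
      (\<integral>y. (\<integral>w. ?f (?v y w) \<partial>?PL) \<partial>G)"
    by (subst PG.Fubini_integral[symmetric])
      (auto intro!: PG.integrable_const_bound[where B=1] simp: bd split_beta add_ac)
  have swapG: "(\<integral>w. (\<integral>y. ?f (?v' y w) \<partial>G) \<partial>?GL) =
      (\<integral>y. (\<integral>w. ?f (?v' y w) \<partial>?GL) \<partial>G)"
    by (subst GG2.Fubini_integral[symmetric])
      (auto intro!: GG2.integrable_const_bound[where B=1] simp: bd split_beta)
  \<comment> \<open>The hybrid keeps the summands in \<open>L\<close> from \<open>P\<close> and
    takes the new one from \<open>G\<close>. This step compares it with the pure \<open>P\<close>
    sum; the next uses the induction hypothesis at the shift \<open>x + \<eta> y\<close>.\<close>
  have "\<bar>(\<integral>w. (\<integral>y. ?f (\<lambda>i. ?u w i + \<zeta> y i) \<partial>P) \<partial>?PL) -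
      (\<integral>w. (\<integral>y. ?f (\<lambda>i. ?u w i + \<eta> y i) \<partial>G) \<partial>?PL)\<bar> \<le> \<Delta>"
    by (intro expectation_diff_le step abs_expectation_le_1 bd P G prob_space_PiM) measurable
  moreover have "\<bar>(\<integral>y. (\<integral>w. ?f (?v y w) \<partial>?PL) \<partial>G) -
      (\<integral>y. (\<integral>w. ?f (?v' y w) \<partial>?GL) \<partial>G)\<bar> \<le> real (card L) * \<Delta>"
  proof (rule expectation_diff_le[OF G])
    show "(\<lambda>y. \<integral>w. ?f (?v y w) \<partial>?PL) \<in> borel_measurable G"
      by measurable
    show "(\<lambda>y. \<integral>w. ?f (?v' y w) \<partial>?GL) \<in> borel_measurable G"
      by measurable
    show "\<bar>(\<integral>w. ?f (?v y w) \<partial>?PL) -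
        (\<integral>w. ?f (?v' y w) \<partial>?GL)\<bar> \<le> real (card L) * \<Delta>" for y
      by (rule insert.IH)
    show "\<bar>\<integral>w. ?f (?v y w) \<partial>?PL\<bar> \<le> 1" for y
      by (rule abs_expectation_le_1[OF prob_space_PiM[OF P] bd])
    show "\<bar>\<integral>w. ?f (?v' y w) \<partial>?GL\<bar> \<le> 1" for y
      by (rule abs_expectation_le_1[OF prob_space_PiM[OF G] bd])
  qed
  moreover have "real (card (insert k L)) * \<Delta> = \<Delta> + real (card L) * \<Delta>"
    using insert.hyps by (simp add: distrib_right)
  ultimately show ?case
    unfolding eqP eqG swapG swapP by linarith
qed

section \<open>One Lindeberg step: averaging the Taylor expansion\<close>

lemma (in finite_measure) integrable_product_of_cubes:
  fixes f g :: "'a \<Rightarrow> real"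
  assumes [measurable]: "f \<in> borel_measurable M" "g \<in> borel_measurable M"
    and int: "integrable M (\<lambda>w. \<bar>f w\<bar> ^ 3)" "integrable M (\<lambda>w. \<bar>g w\<bar> ^ 3)"
  shows "integrable M (\<lambda>w. f w * g w)" "integrable M f"
proof -
  have le: "\<bar>x * y\<bar> \<le> 1 + \<bar>x\<bar> ^ 3 + \<bar>y\<bar> ^ 3" "\<bar>x\<bar> \<le> 1 + \<bar>x\<bar> ^ 3" for x y :: real
  proof -
    have *: "u \<le> 1 + u ^ 3" "u\<^sup>2 \<le> 1 + u ^ 3" if "0 \<le> u" for u :: real
    proof -
      have "0 \<le> u ^ 3" using that by simp
      moreover have "u \<le> 1 \<Longrightarrow> u\<^sup>2 \<le> 1" using that by (intro power_le_one)
      moreover have "1 \<le> u \<Longrightarrow> u \<le> u ^ 3" by (intro self_le_power) auto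
      moreover have "1 \<le> u \<Longrightarrow> u\<^sup>2 \<le> u ^ 3" by (intro power_increasing) auto
      ultimately show "u \<le> 1 + u ^ 3" "u\<^sup>2 \<le> 1 + u ^ 3" by linarith+
    qed
    show "\<bar>x\<bar> \<le> 1 + \<bar>x\<bar> ^ 3" by (rule *) simp
    have "\<bar>x * y\<bar> \<le> (max \<bar>x\<bar> \<bar>y\<bar>)\<^sup>2"
      unfolding abs_mult power2_eq_square by (intro mult_mono) auto
    also have "\<dots> \<le> 1 + (max \<bar>x\<bar> \<bar>y\<bar>) ^ 3" by (intro *) auto
    also have "\<dots> \<le> 1 + \<bar>x\<bar> ^ 3 + \<bar>y\<bar> ^ 3" by (auto simp: max_def)
    finally show "\<bar>x * y\<bar> \<le> 1 + \<bar>x\<bar> ^ 3 + \<bar>y\<bar> ^ 3" .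
  qed
  show "integrable M (\<lambda>w. f w * g w)"
    by (rule Bochner_Integration.integrable_bound[where f="\<lambda>w. 1 + \<bar>f w\<bar> ^ 3 + \<bar>g w\<bar> ^ 3"])
      (use int le in auto)
  show "integrable M f"
    by (rule Bochner_Integration.integrable_bound[where f="\<lambda>w. 1 + \<bar>f w\<bar> ^ 3"])
      (use int le in auto)
qed

text \<open>Mean zero kills the linear term, and the quadratic term becomes a covariance expression.
  The averaged remainder is at most \<open>A * S * M\<close>, and the decay of \<open>A\<close> in
  \<open>S\<close> makes this bounded uniformly in the weights \<open>a\<close>, hence in the shift.
  \<open>h\<close> pays for the outcomes whose jumps leave the Taylor range.\<close>

lemma expectation_exp_minus_sum_exp:
  fixes v :: "'a \<Rightarrow> 'k \<Rightarrow> real"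
  assumes P: "prob_space P" and K: "finite K" and a: "\<And>k. k \<in> K \<Longrightarrow> 0 \<le> a k"
    and v[measurable]: "\<And>k. k \<in> K \<Longrightarrow> (\<lambda>w. v w k) \<in> borel_measurable P"
    and int3: "\<And>k. k \<in> K \<Longrightarrow> integrable P (\<lambda>w. \<bar>v w k\<bar> ^ 3)"
    and M: "\<And>k. k \<in> K \<Longrightarrow> (\<integral>w. \<bar>v w k\<bar> ^ 3 \<partial>P) \<le> M"
    and mean: "\<And>k. k \<in> K \<Longrightarrow> (\<integral>w. v w k \<partial>P) = 0"
    and cov: "\<And>k l. k \<in> K \<Longrightarrow> l \<in> K \<Longrightarrow> (\<integral>w. v w k * v w l \<partial>P) = c k l"
    and h: "integrable P h" "\<And>w. 0 \<le> h w"
    and large: "AE w in P. (\<forall>k\<in>K. \<bar>v w k\<bar> \<le> 2) \<or> (\<Sum>k\<in>K. \<bar>v w k\<bar> ^ m) \<le> h w" and m: "m \<ge> 2"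
    and M0: "0 \<le> M"
  defines "S \<equiv> \<Sum>k\<in>K. a k"
  shows "\<bar>(\<integral>w. exp (- (\<Sum>k\<in>K. a k * exp (v w k))) \<partial>P) -
      (exp (- S) + exp (- S) / 2 * ((\<Sum>k\<in>K. \<Sum>l\<in>K. a k * a l * c k l) - (\<Sum>k\<in>K. a k * c k k)))\<bar>
    \<le> 8 / 3 * exp 4 * M + 3 * (\<integral>w. h w \<partial>P)"
proof -
  let ?X = "\<lambda>w. exp (- (\<Sum>k\<in>K. a k * exp (v w k)))" and ?L = "\<lambda>w. \<Sum>k\<in>K. a k * v w k"
    and ?R = "\<lambda>w. \<Sum>k\<in>K. a k * (v w k)\<^sup>2" and ?M = "\<lambda>w. \<Sum>k\<in>K. a k * \<bar>v w k\<bar> ^ 3"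
    and ?c = "(\<Sum>k\<in>K. \<Sum>l\<in>K. a k * a l * c k l) - (\<Sum>k\<in>K. a k * c k k)"
  interpret P: prob_space P by fact
  define T where "T w = (?X w) - exp (- S) + exp (- S) * (?L w)
    - exp (- S) / 2 * ((?L w)\<^sup>2 - (?R w))" for w
  define A where "A = 4 / 3 * exp 2 * exp (- (exp (- 2) * S / 2))"
  have int: "integrable P (\<lambda>w. v w k * v w l)" "integrable P (\<lambda>w. v w k)" if "k \<in> K" "l \<in> K" for k l
    using P.integrable_product_of_cubes[OF v v int3 int3, of k l] that by auto
  have int_exp: "integrable P (\<lambda>w. (?X w))"
    by (rule P.integrable_const_bound[where B=1]) (auto intro!: AE_I2 sum_nonneg mult_nonneg_nonneg a)
  have sq: "(?L w)\<^sup>2 = (\<Sum>k\<in>K. \<Sum>l\<in>K. a k * a l * (v w k * v w l))" for w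
    by (simp add: power2_eq_square sum_product mult_ac)
  have int_lin: "integrable P (\<lambda>w. ?L w)"
    and int_sq: "integrable P (\<lambda>w. (?L w)\<^sup>2)"
    and int_diag: "integrable P (\<lambda>w. ?R w)"
    unfolding sq unfolding power2_eq_square
    by (auto intro!: Bochner_Integration.integrable_sum integrable_mult_right int)
  have E_lin: "(\<integral>w. ?L w \<partial>P) = 0"
    by (subst Bochner_Integration.integral_sum) (auto intro!: int simp: mean)
  have E_sq: "(\<integral>w. (?L w)\<^sup>2 \<partial>P) = (\<Sum>k\<in>K. \<Sum>l\<in>K. a k * a l * c k l)"
    unfolding sq
    by (subst Bochner_Integration.integral_sum, (intro Bochner_Integration.integrable_sum integrable_mult_right int; assumption),
        intro sum.cong refl, subst Bochner_Integration.integral_sum, (intro integrable_mult_right int; assumption))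
      (auto intro!: sum.cong simp: cov)
  have E_diag: "(\<integral>w. ?R w \<partial>P) = (\<Sum>k\<in>K. a k * c k k)"
    unfolding power2_eq_square
    by (subst Bochner_Integration.integral_sum) (auto intro!: integrable_mult_right int sum.cong simp: cov)
  have E_T: "(\<integral>w. T w \<partial>P) = (\<integral>w. ?X w \<partial>P) -
      (exp (- S) + exp (- S) / 2 * ?c)"
    unfolding T_def using int_exp int_lin int_sq int_diag
    by (simp add: E_lin E_sq E_diag P.prob_space)
  have T_le: "AE w in P. \<bar>T w\<bar> \<le> A * (?M w) + 3 * h w"
    using large
  proof eventually_elim
    case (elim w)
    have nn: "0 \<le> A * (?M w)"
      unfolding A_def by (intro mult_nonneg_nonneg sum_nonneg a) auto
    show ?case
    proof (cases "\<forall>k\<in>K. \<bar>v w k\<bar> \<le> 2")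
      case True
      then have "\<bar>T w\<bar> \<le> A * (?M w)"
        unfolding T_def A_def S_def by (intro taylor_exp_minus_sum_exp(1) K a) auto
      then show ?thesis using h(2)[of w] by linarith
    next
      case False
      then obtain k0 where k0: "k0 \<in> K" "\<bar>v w k0\<bar> \<ge> 1" by force
      have "\<bar>T w\<bar> \<le> 3 * (\<Sum>k\<in>K. \<bar>v w k\<bar> ^ m)"
        unfolding T_def S_def by (rule taylor_exp_minus_sum_exp(2)[where v="v w", OF K a k0 m])
      also have "\<dots> \<le> 3 * h w" using elim False by simp
      finally show ?thesis using nn by linarith
    qed
  qed
  have int_cub: "integrable P (\<lambda>w. A * (?M w))"
    by (intro integrable_mult_right Bochner_Integration.integrable_sum int3)
  have "\<bar>\<integral>w. T w \<partial>P\<bar> \<le> (\<integral>w. \<bar>T w\<bar> \<partial>P)" by (rule integral_abs_bound)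
  also have "\<dots> \<le> (\<integral>w. A * (?M w) + 3 * h w \<partial>P)"
  proof (rule integral_mono_AE[OF _ _ T_le])
    show "integrable P (\<lambda>w. \<bar>T w\<bar>)"
      unfolding T_def using int_exp int_lin int_sq int_diag by (intro integrable_abs) auto
    show "integrable P (\<lambda>w. A * (?M w) + 3 * h w)"
      using int_cub h by (intro Bochner_Integration.integrable_add) auto
  qed
  also have "\<dots> = A * (\<Sum>k\<in>K. a k * (\<integral>w. \<bar>v w k\<bar> ^ 3 \<partial>P)) + 3 * (\<integral>w. h w \<partial>P)"
    using int_cub h int3 by (simp add: Bochner_Integration.integral_sum)
  also have "A * (\<Sum>k\<in>K. a k * (\<integral>w. \<bar>v w k\<bar> ^ 3 \<partial>P)) \<le> A * (\<Sum>k\<in>K. a k * M)"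
    by (intro mult_left_mono sum_mono M a) (auto simp: A_def)
  also have "A * (\<Sum>k\<in>K. a k * M) = A * S * M" by (simp add: S_def sum_distrib_right)
  also have "A * S * M \<le> 8 / 3 * exp 4 * M"
  proof -
    \<comment> \<open>\<open>u\<close> is the decay rate in \<open>A\<close>. As
      \<open>S * exp (- (u * S))\<close> is at most \<open>1 / u = 2 * exp 2\<close>, the constant
      is \<open>4 / 3 * exp 2 * 2 * exp 2\<close>.\<close>
    define u :: real where "u = exp (- 2) / 2"
    have u: "0 < u" by (simp add: u_def)
    have "(u * S) * exp (- (u * S)) \<le> 1" by (rule mult_exp_minus_le_1)
    then have "S * exp (- (u * S)) \<le> 1 / u" using u by (simp add: field_simps)
    then have "4 / 3 * exp 2 * (S * exp (- (u * S))) \<le> 4 / 3 * exp 2 * (1 / u)"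
      by (intro mult_left_mono) auto
    moreover have "A * S = 4 / 3 * exp 2 * (S * exp (- (u * S)))"
      by (simp add: A_def u_def mult_ac)
    ultimately have "A * S \<le> 4 / 3 * exp 2 * (1 / u)" by linarith
    also have "\<dots> = 8 / 3 * exp 4"
    proof -
      have "exp 2 * exp 2 = exp (4 :: real)" by (simp add: exp_add[symmetric])
      then show ?thesis by (simp add: u_def exp_minus field_simps)
    qed
    finally show ?thesis using M0 by (rule mult_right_mono)
  qed
  finally show ?thesis unfolding E_T by simp
qed

text \<open>The weights add up to \<open>S\<^sup>2\<close> and \<open>S\<close>, both absorbed by
  \<open>exp (- S)\<close>; an entrywise covariance error thus costs the same in every
  dimension.\<close>

lemma abs_quadratic_exp_diff_le:
  fixes a :: "'k \<Rightarrow> real"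
  assumes K: "finite K" and a: "\<And>k. k \<in> K \<Longrightarrow> 0 \<le> a k"
    and d: "\<And>k l. k \<in> K \<Longrightarrow> l \<in> K \<Longrightarrow> \<bar>c k l - c' k l\<bar> \<le> d" and d0: "0 \<le> d"
  defines "S \<equiv> \<Sum>k\<in>K. a k"
  shows "\<bar>exp (- S) / 2 * ((\<Sum>k\<in>K. \<Sum>l\<in>K. a k * a l * c k l) - (\<Sum>k\<in>K. a k * c k k)) -
     exp (- S) / 2 * ((\<Sum>k\<in>K. \<Sum>l\<in>K. a k * a l * c' k l) - (\<Sum>k\<in>K. a k * c' k k))\<bar> \<le> d"
proof -
  let ?F = "\<lambda>c. \<Sum>k\<in>K. \<Sum>l\<in>K. a k * a l * c k l" and ?D = "\<lambda>c. \<Sum>k\<in>K. a k * c k k"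
  have S0: "0 \<le> S" unfolding S_def by (intro sum_nonneg a)
  have "\<bar>?F c - ?F c'\<bar> \<le> (\<Sum>k\<in>K. \<Sum>l\<in>K. a k * a l * d)"
    unfolding sum_subtractf[symmetric] right_diff_distrib[symmetric]
    by (intro order_trans[OF sum_abs] sum_mono) (auto simp: abs_mult a intro!: mult_left_mono d mult_nonneg_nonneg)
  also have "\<dots> = S\<^sup>2 * d" unfolding S_def power2_eq_square sum_product unfolding sum_distrib_right ..
  finally have 1: "\<bar>?F c - ?F c'\<bar> \<le> S\<^sup>2 * d" .
  have "\<bar>?D c - ?D c'\<bar> \<le> (\<Sum>k\<in>K. a k * d)"
    unfolding sum_subtractf[symmetric] right_diff_distrib[symmetric]
    by (intro order_trans[OF sum_abs] sum_mono) (auto simp: abs_mult a intro!: mult_left_mono d)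
  also have "\<dots> = S * d" by (simp add: S_def sum_distrib_right)
  finally have 2: "\<bar>?D c - ?D c'\<bar> \<le> S * d" .
  have "\<bar>exp (- S) / 2 * (?F c - ?D c) -
     exp (- S) / 2 * (?F c' - ?D c')\<bar> =
     exp (- S) / 2 * \<bar>(?F c - ?F c')
       - (?D c - ?D c')\<bar>"
    unfolding right_diff_distrib[symmetric] abs_mult by (simp add: algebra_simps)
  also have "\<dots> \<le> exp (- S) / 2 * (S\<^sup>2 * d + S * d)"
    using 1 2 by (intro mult_left_mono) auto
  also have "\<dots> = (S\<^sup>2 * exp (- S) + S * exp (- S)) * (d / 2)" by (simp add: algebra_simps)
  also have "\<dots> \<le> (1 + 1) * (d / 2)"
    using d0 by (intro mult_right_mono add_mono quadratic_mult_exp_minus_le(2) S0 mult_exp_minus_le_1) auto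
  finally show ?thesis by simp
qed

text \<open>The jumps \<zeta> are almost surely inside the Taylor range. The Gaussian jumps \<eta>
  are unbounded, and a large one is charged to the sum of the \<open>m\<close>-th powers over all
  signed coordinates, which is the only term containing the dimension.\<close>

lemma soft_box_step:
  fixes \<zeta> :: "'a \<Rightarrow> 'i \<Rightarrow> real" and \<eta> :: "'b \<Rightarrow> 'i \<Rightarrow> real"
  assumes P: "prob_space P" and G: "prob_space G" and I: "finite I" and \<beta>: "0 < \<beta>" and m: "m \<ge> 2"
    and \<zeta>: "\<And>i. i \<in> I \<Longrightarrow> (\<lambda>w. \<zeta> w i) \<in> borel_measurable P"
    and \<eta>: "\<And>i. i \<in> I \<Longrightarrow> (\<lambda>w. \<eta> w i) \<in> borel_measurable G"
    and \<zeta>3: "\<And>i. i \<in> I \<Longrightarrow> integrable P (\<lambda>w. \<bar>\<zeta> w i\<bar> ^ 3)" "\<And>i. i \<in> I \<Longrightarrow> (\<integral>w. \<bar>\<zeta> w i\<bar> ^ 3 \<partial>P) \<le> M"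
    and \<eta>3: "\<And>i. i \<in> I \<Longrightarrow> integrable G (\<lambda>w. \<bar>\<eta> w i\<bar> ^ 3)" "\<And>i. i \<in> I \<Longrightarrow> (\<integral>w. \<bar>\<eta> w i\<bar> ^ 3 \<partial>G) \<le> M"
    and \<zeta>_mean: "\<And>i. i \<in> I \<Longrightarrow> (\<integral>w. \<zeta> w i \<partial>P) = 0" and \<eta>_mean: "\<And>i. i \<in> I \<Longrightarrow> (\<integral>w. \<eta> w i \<partial>G) = 0"
    and cov: "\<And>i j. i \<in> I \<Longrightarrow> j \<in> I \<Longrightarrow> \<bar>(\<integral>w. \<zeta> w i * \<zeta> w j \<partial>P) - (\<integral>w. \<eta> w i * \<eta> w j \<partial>G)\<bar> \<le> d"
    and small: "AE w in P. \<forall>i\<in>I. \<beta> * \<bar>\<zeta> w i\<bar> \<le> 2"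
    and \<eta>m: "\<And>i. i \<in> I \<Longrightarrow> integrable G (\<lambda>w. \<bar>\<eta> w i\<bar> ^ m)" "\<And>i. i \<in> I \<Longrightarrow> (\<integral>w. \<bar>\<eta> w i\<bar> ^ m \<partial>G) \<le> R"
    and M0: "0 \<le> M" and d0: "0 \<le> d"
  shows "\<bar>(\<integral>w. soft_box I \<beta> t (\<lambda>i. x i + \<zeta> w i) \<partial>P) - (\<integral>w. soft_box I \<beta> t (\<lambda>i. x i + \<eta> w i) \<partial>G)\<bar>
    \<le> 16 / 3 * exp 4 * \<beta> ^ 3 * M + \<beta>\<^sup>2 * d + 6 * real (card I) * \<beta> ^ m * R"
proof -
  \<comment> \<open>Coordinates are indexed together with a sign, so both faces of the box fit the
    one-sided sums of exponentials; \<open>a\<close> holds the weights at the base point and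
    \<open>v\<close> the signed, scaled jump.\<close>
  let ?K = "I \<times> {- 1, 1 :: real}"
  define a where "a k = exp (\<beta> * (snd k * x (fst k) - t))" for k :: "'i \<times> real"
  define v where "v z k = \<beta> * snd k * z (fst k)" for z :: "'i \<Rightarrow> real" and k :: "'i \<times> real"
  have K: "finite ?K" using I by blast
  have box: "soft_box I \<beta> t (\<lambda>i. x i + z i) = exp (- (\<Sum>k\<in>?K. a k * exp (v z k)))" for z
    unfolding soft_box_def split_beta a_def v_def
    by (simp only: exp_add[symmetric] distrib_left right_diff_distrib mult.assoc) (simp add: algebra_simps)
  have abs_v: "\<bar>v z k\<bar> = \<beta> * \<bar>z (fst k)\<bar>" if "k \<in> ?K" for z k
    using that \<beta> by (auto simp: v_def abs_mult)
  have v3: "\<bar>v z k\<bar> ^ j = \<beta> ^ j * \<bar>z (fst k)\<bar> ^ j" if "k \<in> ?K" for z k j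
    by (simp add: abs_v[OF that] power_mult_distrib)
  have vv: "v z k * v z l = (\<beta>\<^sup>2 * (snd k * snd l)) * (z (fst k) * z (fst l))" for z k l
    by (simp add: v_def power2_eq_square)
  have fstI: "fst k \<in> I" if "k \<in> ?K" for k using that by auto
  define cP where "cP k l = (\<beta>\<^sup>2 * (snd k * snd l)) * (\<integral>w. \<zeta> w (fst k) * \<zeta> w (fst l) \<partial>P)" for k l :: "'i \<times> real"
  define cG where "cG k l = (\<beta>\<^sup>2 * (snd k * snd l)) * (\<integral>w. \<eta> w (fst k) * \<eta> w (fst l) \<partial>G)" for k l :: "'i \<times> real"
  define S where "S = (\<Sum>k\<in>?K. a k)"
  let ?Q = "\<lambda>c. (\<Sum>k\<in>?K. \<Sum>l\<in>?K. a k * a l * c k l) - (\<Sum>k\<in>?K. a k * c k k)"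
    and ?T = "\<lambda>w. \<Sum>k\<in>?K. \<bar>v (\<eta> w) k\<bar> ^ m"
  have P_exp: "\<bar>(\<integral>w. exp (- (\<Sum>k\<in>?K. a k * exp (v (\<zeta> w) k))) \<partial>P) -
      (exp (- S) + exp (- S) / 2 * ?Q cP)\<bar>
    \<le> 8 / 3 * exp 4 * (\<beta> ^ 3 * M) + 3 * (\<integral>w. 0 \<partial>P)"
    unfolding S_def
  proof (rule expectation_exp_minus_sum_exp[OF P K _ _ _ _ _ _ _ _ _ m])
    show "AE w in P. (\<forall>k\<in>?K. \<bar>v (\<zeta> w) k\<bar> \<le> 2) \<or> (\<Sum>k\<in>?K. \<bar>v (\<zeta> w) k\<bar> ^ m) \<le> 0"
      using small by eventually_elim (use abs_v fstI in \<open>metis (no_types, lifting)\<close>)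
  qed (use \<beta> \<zeta> \<zeta>3 \<zeta>_mean M0 fstI in \<open>auto simp: v3 vv cP_def simp del: insert_iff intro!: mult_left_mono, auto simp: a_def v_def\<close>)
  have G_exp: "\<bar>(\<integral>w. exp (- (\<Sum>k\<in>?K. a k * exp (v (\<eta> w) k))) \<partial>G) -
      (exp (- S) + exp (- S) / 2 * ?Q cG)\<bar>
    \<le> 8 / 3 * exp 4 * (\<beta> ^ 3 * M) + 3 * (\<integral>w. ?T w \<partial>G)"
    unfolding S_def
  proof (rule expectation_exp_minus_sum_exp[OF G K _ _ _ _ _ _ _ _ _ m])
    show "integrable G ?T"
      using \<eta>m fstI by (auto simp: v3 simp del: insert_iff intro!: Bochner_Integration.integrable_sum)
  qed (use \<beta> \<eta> \<eta>3 \<eta>_mean M0 fstI in \<open>auto simp: v3 vv cG_def simp del: insert_iff intro!: mult_left_mono sum_nonneg, auto simp: a_def v_def\<close>)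
  have tail: "(\<integral>w. ?T w \<partial>G) \<le> (\<Sum>k\<in>?K. \<beta> ^ m * R)"
  proof -
    have "(\<integral>w. ?T w \<partial>G) = (\<Sum>k\<in>?K. \<integral>w. \<bar>v (\<eta> w) k\<bar> ^ m \<partial>G)"
      using \<eta>m fstI by (intro Bochner_Integration.integral_sum) (simp add: v3 del: insert_iff)
    also have "\<dots> \<le> (\<Sum>k\<in>?K. \<beta> ^ m * R)"
      using \<eta>m fstI \<beta> by (intro sum_mono) (simp add: v3 mult_left_mono del: insert_iff)
    finally show ?thesis .
  qed
  have "\<bar>cP k l - cG k l\<bar> \<le> \<beta>\<^sup>2 * d" if "k \<in> ?K" "l \<in> ?K" for k l
  proof -
    have s: "\<bar>snd k * snd l\<bar> = 1" using that by auto
    have "\<bar>cP k l - cG k l\<bar> = \<beta>\<^sup>2 * \<bar>snd k * snd l\<bar> *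
        \<bar>(\<integral>w. \<zeta> w (fst k) * \<zeta> w (fst l) \<partial>P) - (\<integral>w. \<eta> w (fst k) * \<eta> w (fst l) \<partial>G)\<bar>"
      unfolding cP_def cG_def right_diff_distrib[symmetric] by (simp add: abs_mult)
    then show ?thesis
      unfolding s using cov[OF fstI fstI] that by (auto simp del: insert_iff intro!: mult_left_mono)
  qed
  then have quad: "\<bar>exp (- S) / 2 * ?Q cP -
     exp (- S) / 2 * ?Q cG\<bar> \<le> \<beta>\<^sup>2 * d"
    unfolding S_def using d0 by (intro abs_quadratic_exp_diff_le K) (auto simp: a_def)
  have "card ?K = card I * 2" by (simp add: card_cartesian_product)
  then have R: "(\<Sum>k\<in>?K. \<beta> ^ m * R) = 2 * real (card I) * \<beta> ^ m * R" by simp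
  have tri: "\<bar>A - B\<bar> \<le> p + q + r" if "\<bar>A - (e + y)\<bar> \<le> p" "\<bar>B - (e + z)\<bar> \<le> q" "\<bar>y - z\<bar> \<le> r"
    for A B e y z p q r :: real
    using that by linarith
  have "3 * (\<integral>w. ?T w \<partial>G) \<le> 6 * real (card I) * \<beta> ^ m * R"
    using tail unfolding R by linarith
  moreover have "16 / 3 * exp 4 * \<beta> ^ 3 * M = 8 / 3 * exp 4 * (\<beta> ^ 3 * M) + 8 / 3 * exp 4 * (\<beta> ^ 3 * M)"
    by simp
  moreover have "(\<integral>w. 0 \<partial>P) = (0 :: real)" by simp
  ultimately show ?thesis
    unfolding box using tri[OF P_exp G_exp quad] by linarith
qed

subsection \<open>Truncation and the non-asymptotic bound\<close>

text \<open>Stability of the Gaussian law: it is split into \<open>card L\<close> independent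
  pieces, so that Lindeberg's method can exchange summand for summand.\<close>

lemma gaussian_law_normalized_sum:
  fixes L :: "'l set"
  assumes I: "finite I" and L: "finite L" "L \<noteq> {}" and G: "gaussian_law I \<Sigma> G"
  shows "distr (PiM L (\<lambda>_. G)) (borel_on I) (\<lambda>w. \<lambda>i\<in>I. \<Sum>l\<in>L. w l i / sqrt (real (card L))) = G"
proof (rule gaussian_law_unique[OF I _ G refl], rule gaussian_law_image)
  interpret G: prob_space G using G by (rule gaussian_lawD)
  interpret GL: product_prob_space "\<lambda>_::'l. G" L by (intro product_prob_spaceI) (rule G.prob_space_axioms)
  note [measurable_cong] = gaussian_lawD(2)[OF G]
  have n: "0 < real (card L)" using L by (simp add: card_gt_0_iff)
  show "prob_space (PiM L (\<lambda>_. G))" by (intro prob_space_PiM) (rule G.prob_space_axioms)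
  show "(\<lambda>w. \<Sum>l\<in>L. w l i / sqrt (real (card L))) \<in> borel_measurable (PiM L (\<lambda>_. G))" if i: "i \<in> I" for i
  proof -
    have [measurable]: "(\<lambda>w. w l i) \<in> borel_measurable (PiM L (\<lambda>_. G))" if "l \<in> L" for l
      using i by (intro measurable_PiM_component_rev that) measurable
    show ?thesis by (intro borel_measurable_sum borel_measurable_divide borel_measurable_const) measurable
  qed
  fix a :: "'a \<Rightarrow> real"
  define r where "r = sqrt (real (card L))"
  define a' where "a' i = a i / r" for i
  have "(\<integral>w. iexp (\<Sum>i\<in>I. a i * (\<Sum>l\<in>L. w l i / r)) \<partial>PiM L (\<lambda>_. G)) =
      (\<integral>w. (\<Prod>l\<in>L. iexp (\<Sum>i\<in>I. a' i * w l i)) \<partial>PiM L (\<lambda>_. G))"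
  proof (intro Bochner_Integration.integral_cong refl)
    fix w :: "'l \<Rightarrow> 'a \<Rightarrow> real"
    have "(\<Sum>i\<in>I. a i * (\<Sum>l\<in>L. w l i / r)) = (\<Sum>l\<in>L. \<Sum>i\<in>I. a' i * w l i)"
      unfolding sum_distrib_left by (subst sum.swap) (simp add: a'_def)
    then show "iexp (\<Sum>i\<in>I. a i * (\<Sum>l\<in>L. w l i / r)) = (\<Prod>l\<in>L. iexp (\<Sum>i\<in>I. a' i * w l i))"
      by (simp only: of_real_sum sum_distrib_left exp_sum[OF L(1)])
  qed
  also have "\<dots> = (\<Prod>l\<in>L. \<integral>y. iexp (\<Sum>i\<in>I. a' i * y i) \<partial>G)"
    by (intro GL.product_integral_prod L G.integrable_iexp) (auto simp del: of_real_sum)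
  also have "\<dots> = complex_of_real (exp (- quad_form I \<Sigma> a' / 2) ^ card L)"
    unfolding gaussian_lawD(3)[OF G] by simp
  also have "exp (- quad_form I \<Sigma> a' / 2) ^ card L =
      exp (- quad_form I \<Sigma> a / 2)"
  proof -
    have "quad_form I \<Sigma> a' = quad_form I \<Sigma> a / real (card L)"
      using n by (simp add: a'_def r_def sum_divide_distrib)
    then show ?thesis using n by (simp add: exp_of_nat_mult[symmetric])
  qed
  finally show "(\<integral>w. iexp (\<Sum>i\<in>I. a i * (\<Sum>l\<in>L. w l i / sqrt (real (card L)))) \<partial>PiM L (\<lambda>_. G)) =
      complex_of_real (exp (- quad_form I \<Sigma> a / 2))"
    unfolding r_def .
qed

definition abs_moment :: "nat \<Rightarrow> real" where
  "abs_moment m = (\<integral>x. \<bar>x\<bar> ^ m \<partial>std_normal_distribution)"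

lemma abs_moment_nonneg: "0 \<le> abs_moment m"
  unfolding abs_moment_def by (intro Bochner_Integration.integral_nonneg) auto

lemma gaussian_law_abs_moment:
  assumes I: "finite I" "j \<in> I" and G: "gaussian_law I \<Sigma> G" and pos: "0 < \<Sigma> j j"
  shows "integrable G (\<lambda>y. \<bar>y j\<bar> ^ m)"
    and "(\<integral>y. \<bar>y j\<bar> ^ m \<partial>G) = sqrt (\<Sigma> j j) ^ m * abs_moment m"
proof -
  note [measurable_cong] = gaussian_lawD(2)[OF G]
  define c where "c = 1 / sqrt (\<Sigma> j j)"
  define H where "H = distr G (borel_on I) (\<lambda>y. \<lambda>i\<in>I. c * y i)"
  have H: "gaussian_law I (\<lambda>i k. c * c * \<Sigma> i k) H"
    unfolding H_def by (rule gaussian_law_scale[OF G])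
  have [measurable]: "(\<lambda>y. y j) \<in> borel_measurable G" using I by measurable
  have m: "(\<lambda>y. \<lambda>i\<in>I. c * y i) \<in> measurable G (borel_on I)"
  proof (rule measurable_restrict)
    fix i assume "i \<in> I"
    then have "(\<lambda>y. y i) \<in> borel_measurable G"
      unfolding measurable_cong_sets[OF gaussian_lawD(2)[OF G] refl] by (rule measurable_component_singleton)
    then show "(\<lambda>y. c * y i) \<in> borel_measurable G" by (rule borel_measurable_times[OF borel_measurable_const])
  qed
  have "distr H borel (\<lambda>y. y j) = std_normal_distribution"
    by (rule gaussian_law_coordinate[OF I H]) (use pos in \<open>simp add: c_def field_simps\<close>)
  moreover have "distr H borel (\<lambda>y. y j) = distr G borel (\<lambda>y. c * y j)"
    unfolding H_def using I by (subst distr_distr[OF _ m]) (auto simp: comp_def)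
  ultimately have D: "distr G borel (\<lambda>y. c * y j) = std_normal_distribution" by simp
  have y: "\<bar>y j\<bar> ^ m = sqrt (\<Sigma> j j) ^ m * \<bar>c * y j\<bar> ^ m" for y :: "'a \<Rightarrow> real"
    using pos by (simp add: c_def power_mult_distrib[symmetric] abs_mult)
  have "integrable std_normal_distribution (\<lambda>x. \<bar>x ^ m\<bar>)"
    by (intro integrable_abs integrable_std_normal_distribution_moment)
  then have int: "integrable G (\<lambda>y. \<bar>c * y j\<bar> ^ m)"
    unfolding D[symmetric] by (subst (asm) integrable_distr_eq) (auto simp: power_abs)
  show "integrable G (\<lambda>y. \<bar>y j\<bar> ^ m)"
    unfolding y by (intro integrable_mult_right int)
  have "(\<integral>y. \<bar>c * y j\<bar> ^ m \<partial>G) = abs_moment m"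
    unfolding abs_moment_def D[symmetric] by (subst integral_distr) auto
  then show "(\<integral>y. \<bar>y j\<bar> ^ m \<partial>G) = sqrt (\<Sigma> j j) ^ m * abs_moment m"
    unfolding y by simp
qed

definition truncate :: "real \<Rightarrow> real \<Rightarrow> real" where
  "truncate \<tau> x = (if \<bar>x\<bar> \<le> \<tau> then x else 0)"

lemma truncate_measurable[measurable]: "truncate \<tau> \<in> borel_measurable borel"
  unfolding truncate_def by measurable

lemma abs_truncate_le: "\<bar>truncate \<tau> x\<bar> \<le> \<bar>x\<bar>" "0 \<le> \<tau> \<Longrightarrow> \<bar>truncate \<tau> x\<bar> \<le> \<tau>"
  by (auto simp: truncate_def)

lemma powr_tail_le:
  fixes x :: real
  assumes "0 < \<tau>" "\<tau> \<le> x" "r \<le> q"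
  shows "x powr r \<le> \<tau> powr (r - q) * x powr q"
proof -
  have "x powr (r - q) \<le> \<tau> powr (r - q)" using assms by (intro powr_mono2') auto
  then have "x powr (r - q) * x powr q \<le> \<tau> powr (r - q) * x powr q" by (intro mult_right_mono) auto
  then show ?thesis using assms by (simp add: powr_add[symmetric])
qed

text \<open>The error vanishes unless some argument exceeds \<tau>, and there a lower power is
  traded for the power \<open>q\<close> with a gain in \<tau>. For the product, everything is
  compared with the larger of the two arguments.\<close>

lemma truncation_error_le:
  fixes x y :: real
  assumes \<tau>: "0 < \<tau>" and q: "2 \<le> q"
  shows "\<bar>x - truncate \<tau> x\<bar> \<le> \<tau> powr (1 - q) * \<bar>x\<bar> powr q"
    and "\<bar>x * y - truncate \<tau> x * truncate \<tau> y\<bar> \<le> \<tau> powr (2 - q) * (\<bar>x\<bar> powr q + \<bar>y\<bar> powr q)"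
proof -
  show "\<bar>x - truncate \<tau> x\<bar> \<le> \<tau> powr (1 - q) * \<bar>x\<bar> powr q"
    using powr_tail_le[OF \<tau>, of "\<bar>x\<bar>" 1 q] \<tau> q by (auto simp: truncate_def)
  define M where "M = max \<bar>x\<bar> \<bar>y\<bar>"
  show "\<bar>x * y - truncate \<tau> x * truncate \<tau> y\<bar> \<le> \<tau> powr (2 - q) * (\<bar>x\<bar> powr q + \<bar>y\<bar> powr q)"
  proof (cases "M \<le> \<tau>")
    case True
    then have "truncate \<tau> x = x" "truncate \<tau> y = y" by (auto simp: truncate_def M_def)
    then show ?thesis by simp
  next
    case False
    have "\<bar>x * y - truncate \<tau> x * truncate \<tau> y\<bar> \<le> \<bar>x * y\<bar>" by (auto simp: truncate_def)
    also have "\<dots> \<le> M * M" unfolding abs_mult by (intro mult_mono) (auto simp: M_def)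
    also have "\<dots> = M powr 2" using False \<tau> by (simp add: powr_numeral power2_eq_square)
    also have "\<dots> \<le> \<tau> powr (2 - q) * M powr q" using False \<tau> q by (intro powr_tail_le) auto
    also have "\<dots> \<le> \<tau> powr (2 - q) * (\<bar>x\<bar> powr q + \<bar>y\<bar> powr q)"
      by (intro mult_left_mono) (auto simp: M_def max_def)
    finally show ?thesis .
  qed
qed

lemma power_le_1_add_powr:
  fixes x :: real
  assumes "real k \<le> q"
  shows "\<bar>x\<bar> ^ k \<le> 1 + \<bar>x\<bar> powr q"
proof (cases "\<bar>x\<bar> \<le> 1")
  case True
  then have "\<bar>x\<bar> ^ k \<le> 1" by (intro power_le_one) auto
  then show ?thesis using powr_ge_zero[of "\<bar>x\<bar>" q] by linarith
next
  case False
  then have "\<bar>x\<bar> ^ k = \<bar>x\<bar> powr real k" by (simp add: powr_realpow)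
  also have "\<dots> \<le> \<bar>x\<bar> powr q" using False assms by (intro powr_mono) auto
  finally show ?thesis by simp
qed

locale bounded_moments = prob_space Q for Q :: "('i \<Rightarrow> real) measure" +
  fixes I :: "'i set" and q C :: real
  assumes I: "finite I" and sets_Q[measurable_cong]: "sets Q = sets (borel_on I)"
    and q: "3 \<le> q" and C: "0 \<le> C"
    and int_q: "\<And>i. i \<in> I \<Longrightarrow> integrable Q (\<lambda>x. \<bar>x i\<bar> powr q)"
    and moment: "\<And>i. i \<in> I \<Longrightarrow> (\<integral>x. \<bar>x i\<bar> powr q \<partial>Q) \<le> C"
begin

lemma coordinate_measurable[measurable]: "i \<in> I \<Longrightarrow> (\<lambda>x. x i) \<in> borel_measurable Q"
  by measurable

text \<open>Stated for any \<open>f\<close> dominated by the identity, to serve both a coordinate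
  and its truncation.\<close>

lemma abs_power_moment:
  assumes i: "i \<in> I" and k: "k \<le> 3" and [measurable]: "f \<in> borel_measurable borel" and f: "\<And>x. \<bar>f x\<bar> \<le> \<bar>x\<bar>"
  shows "integrable Q (\<lambda>x. \<bar>f (x i)\<bar> ^ k)" "(\<integral>x. \<bar>f (x i)\<bar> ^ k \<partial>Q) \<le> 1 + C"
proof -
  note [measurable] = coordinate_measurable[OF i]
  have b: "\<bar>f x\<bar> ^ k \<le> 1 + \<bar>x\<bar> powr q" for x
    using power_mono[OF f[of x], of k] power_le_1_add_powr[of k q x] k q by simp
  have int': "integrable Q (\<lambda>x. 1 + \<bar>x i\<bar> powr q)" using int_q[OF i] by simp
  show int: "integrable Q (\<lambda>x. \<bar>f (x i)\<bar> ^ k)"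
    by (rule Bochner_Integration.integrable_bound[OF int']) (use b in auto)
  have "(\<integral>x. \<bar>f (x i)\<bar> ^ k \<partial>Q) \<le> (\<integral>x. 1 + \<bar>x i\<bar> powr q \<partial>Q)"
    by (intro integral_mono int int' b)
  also have "\<dots> \<le> 1 + C" using int_q[OF i] moment[OF i] by (simp add: prob_space)
  finally show "(\<integral>x. \<bar>f (x i)\<bar> ^ k \<partial>Q) \<le> 1 + C" .
qed

lemma integrable_coordinate:
  assumes i: "i \<in> I" and [measurable]: "f \<in> borel_measurable borel" and f: "\<And>x. \<bar>f x\<bar> \<le> \<bar>x\<bar>"
  shows "integrable Q (\<lambda>x. f (x i))" "\<bar>\<integral>x. f (x i) \<partial>Q\<bar> \<le> 1 + C"
proof -
  note [measurable] = coordinate_measurable[OF i]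
  have "integrable Q (\<lambda>x. \<bar>f (x i)\<bar>)" "(\<integral>x. \<bar>f (x i)\<bar> \<partial>Q) \<le> 1 + C"
    using abs_power_moment[OF i, of 1 f] f by auto
  then show "integrable Q (\<lambda>x. f (x i))" "\<bar>\<integral>x. f (x i) \<partial>Q\<bar> \<le> 1 + C"
    by (auto simp: integrable_abs_iff intro: order_trans[OF integral_abs_bound])
qed

lemma integrable_coordinate_product:
  assumes i: "i \<in> I" "j \<in> I" and [measurable]: "f \<in> borel_measurable borel" and f: "\<And>x. \<bar>f x\<bar> \<le> \<bar>x\<bar>"
  shows "integrable Q (\<lambda>x. f (x i) * f (x j))"
proof -
  note [measurable] = coordinate_measurable[OF i(1)] coordinate_measurable[OF i(2)]
  show ?thesis
    by (rule integrable_product_of_cubes(1)) (measurable, simp_all add: abs_power_moment f i)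
qed

text \<open>Truncation shifts the mean, while the Lindeberg step needs mean zero; hence the
  recentring.\<close>

definition centered_truncation :: "real \<Rightarrow> ('i \<Rightarrow> real) \<Rightarrow> 'i \<Rightarrow> real" where
  "centered_truncation \<tau> x i = truncate \<tau> (x i) - (\<integral>x. truncate \<tau> (x i) \<partial>Q)"

lemma truncation_mean_error:
  assumes i: "i \<in> I" and \<tau>: "0 < \<tau>"
  shows "(\<integral>x. \<bar>x i - truncate \<tau> (x i)\<bar> \<partial>Q) \<le> C * \<tau> powr (1 - q)"
    "integrable Q (\<lambda>x. \<bar>x i - truncate \<tau> (x i)\<bar>)"
    "\<bar>(\<integral>x. x i \<partial>Q) - (\<integral>x. truncate \<tau> (x i) \<partial>Q)\<bar> \<le> C * \<tau> powr (1 - q)"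
proof -
  note [measurable] = coordinate_measurable[OF i]
  have int: "integrable Q (\<lambda>x. x i)" "integrable Q (\<lambda>x. truncate \<tau> (x i))"
    using integrable_coordinate[OF i, of "\<lambda>x. x"] integrable_coordinate[OF i, of "truncate \<tau>"]
    by (auto simp: abs_truncate_le)
  show int': "integrable Q (\<lambda>x. \<bar>x i - truncate \<tau> (x i)\<bar>)"
    using int by auto
  have "(\<integral>x. \<bar>x i - truncate \<tau> (x i)\<bar> \<partial>Q) \<le> (\<integral>x. \<tau> powr (1 - q) * \<bar>x i\<bar> powr q \<partial>Q)"
    using \<tau> q by (intro integral_mono int' integrable_mult_right int_q i truncation_error_le) auto
  also have "\<dots> \<le> \<tau> powr (1 - q) * C" using moment[OF i] by (simp add: mult_left_mono)
  finally show le: "(\<integral>x. \<bar>x i - truncate \<tau> (x i)\<bar> \<partial>Q) \<le> C * \<tau> powr (1 - q)" by (simp add: mult.commute)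
  have "\<bar>(\<integral>x. x i \<partial>Q) - (\<integral>x. truncate \<tau> (x i) \<partial>Q)\<bar> = \<bar>\<integral>x. x i - truncate \<tau> (x i) \<partial>Q\<bar>"
    using int by simp
  also have "\<dots> \<le> (\<integral>x. \<bar>x i - truncate \<tau> (x i)\<bar> \<partial>Q)" by (rule integral_abs_bound)
  finally show "\<bar>(\<integral>x. x i \<partial>Q) - (\<integral>x. truncate \<tau> (x i) \<partial>Q)\<bar> \<le> C * \<tau> powr (1 - q)" using le by linarith
qed

lemma centered_truncation_facts:
  assumes \<tau>: "1 \<le> \<tau>" and i: "i \<in> I"
  shows "(\<lambda>x. centered_truncation \<tau> x i) \<in> borel_measurable Q"
    and "\<bar>centered_truncation \<tau> x i\<bar> \<le> 2 * \<tau>"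
    and "(\<integral>x. centered_truncation \<tau> x i \<partial>Q) = 0"
    and "integrable Q (\<lambda>x. \<bar>centered_truncation \<tau> x i\<bar> ^ 3)"
    and "(\<integral>x. \<bar>centered_truncation \<tau> x i\<bar> ^ 3 \<partial>Q) \<le> 8 * (1 + C) ^ 3"
proof -
  let ?z = "\<lambda>x. centered_truncation \<tau> x i"
  note [measurable] = coordinate_measurable[OF i]
  let ?m = "\<integral>x. truncate \<tau> (x i) \<partial>Q"
  have int: "integrable Q (\<lambda>x. truncate \<tau> (x i))" and m: "\<bar>?m\<bar> \<le> 1 + C"
    using integrable_coordinate[OF i, of "truncate \<tau>"] by (auto simp: abs_truncate_le)
  show [measurable]: "(\<lambda>x. (?z x)) \<in> borel_measurable Q"
    unfolding centered_truncation_def by measurable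
  have "\<bar>?m\<bar> \<le> (\<integral>x. \<bar>truncate \<tau> (x i)\<bar> \<partial>Q)" by (rule integral_abs_bound)
  also have "\<dots> \<le> \<tau>" using int \<tau> by (intro integral_le_const) (auto simp: abs_truncate_le)
  finally show "\<bar>(?z x)\<bar> \<le> 2 * \<tau>"
    unfolding centered_truncation_def using abs_truncate_le(2)[of \<tau> "x i"] \<tau> by linarith
  show "(\<integral>x. (?z x) \<partial>Q) = 0"
    unfolding centered_truncation_def using int by (simp add: prob_space)
  have cube: "\<bar>u - v\<bar> ^ 3 \<le> 4 * \<bar>u\<bar> ^ 3 + 4 * \<bar>v\<bar> ^ 3" for u v :: real
  proof -
    have "\<bar>u - v\<bar> ^ 3 \<le> (\<bar>u\<bar> + \<bar>v\<bar>) ^ 3" by (intro power_mono) auto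
    also have "\<dots> \<le> 4 * \<bar>u\<bar> ^ 3 + 4 * \<bar>v\<bar> ^ 3"
    proof -
      have "4 * a ^ 3 + 4 * b ^ 3 - (a + b) ^ 3 = 3 * (a + b) * (a - b)\<^sup>2" for a b :: real
        by (simp add: power2_eq_square power3_eq_cube algebra_simps)
      from this[of "\<bar>u\<bar>" "\<bar>v\<bar>"] show ?thesis by (smt (verit) abs_ge_zero mult_nonneg_nonneg zero_le_power2)
    qed
    finally show ?thesis .
  qed
  have int3: "integrable Q (\<lambda>x. \<bar>truncate \<tau> (x i)\<bar> ^ 3)" "(\<integral>x. \<bar>truncate \<tau> (x i)\<bar> ^ 3 \<partial>Q) \<le> 1 + C"
    using abs_power_moment[OF i, of 3 "truncate \<tau>"] by (auto simp: abs_truncate_le)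
  have bound: "\<bar>?z x\<bar> ^ 3 \<le> 4 * \<bar>truncate \<tau> (x i)\<bar> ^ 3 + 4 * (1 + C) ^ 3" for x
    unfolding centered_truncation_def
    using cube[of "truncate \<tau> (x i)" ?m] power_mono[OF m, of 3] by simp
  show int_c: "integrable Q (\<lambda>x. \<bar>?z x\<bar> ^ 3)"
    by (rule Bochner_Integration.integrable_bound[where f="\<lambda>x. 4 * \<bar>truncate \<tau> (x i)\<bar> ^ 3 + 4 * (1 + C) ^ 3"])
      (use int3 bound C in \<open>auto intro: order_trans[OF _ abs_ge_self]\<close>)
  have "(\<integral>x. \<bar>?z x\<bar> ^ 3 \<partial>Q) \<le> (\<integral>x. 4 * \<bar>truncate \<tau> (x i)\<bar> ^ 3 + 4 * (1 + C) ^ 3 \<partial>Q)"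
    using int3 by (intro integral_mono int_c bound) auto
  also have "\<dots> \<le> 4 * (1 + C) + 4 * (1 + C) ^ 3" using int3 by (simp add: prob_space)
  also have "\<dots> \<le> 8 * (1 + C) ^ 3" using C self_le_power[of "1 + C" 3] by simp
  finally show "(\<integral>x. \<bar>?z x\<bar> ^ 3 \<partial>Q) \<le> 8 * (1 + C) ^ 3" .
qed

text \<open>Truncation perturbs the mixed second moment by order \<open>\<tau> powr (2 - q)\<close>
  and the means by order \<open>\<tau> powr (1 - q)\<close>; as \<open>\<tau> \<ge> 1\<close>, the
  former dominates.\<close>

lemma centered_truncation_covariance:
  assumes \<tau>: "1 \<le> \<tau>" and i: "i \<in> I" "j \<in> I"
  shows "\<bar>(\<integral>x. centered_truncation \<tau> x i * centered_truncation \<tau> x j \<partial>Q) -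
      (\<integral>x. (x i - (\<integral>x. x i \<partial>Q)) * (x j - (\<integral>x. x j \<partial>Q)) \<partial>Q)\<bar> \<le> 4 * (1 + C)\<^sup>2 * \<tau> powr (2 - q)"
proof -
  let ?cov = "\<integral>x. (x i - (\<integral>x. x i \<partial>Q)) * (x j - (\<integral>x. x j \<partial>Q)) \<partial>Q"
    and ?cov' = "\<integral>x. centered_truncation \<tau> x i * centered_truncation \<tau> x j \<partial>Q"
  note [measurable] = coordinate_measurable[OF i(1)] coordinate_measurable[OF i(2)]
  let ?T = "truncate \<tau>"
  define mi where "mi = (\<integral>x. ?T (x i) \<partial>Q)" define mj where "mj = (\<integral>x. ?T (x j) \<partial>Q)"
  define ni where "ni = (\<integral>x. x i \<partial>Q)" define nj where "nj = (\<integral>x. x j \<partial>Q)"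
  have expand: "(\<integral>x. (f x - (\<integral>x. f x \<partial>Q)) * (g x - (\<integral>x. g x \<partial>Q)) \<partial>Q) = (\<integral>x. f x * g x \<partial>Q) - (\<integral>x. f x \<partial>Q) * (\<integral>x. g x \<partial>Q)"
    if [simp]: "integrable Q f" "integrable Q g" "integrable Q (\<lambda>x. f x * g x)" for f g :: "('i \<Rightarrow> real) \<Rightarrow> real"
    by (simp add: algebra_simps prob_space)
  have id: "(\<lambda>x :: real. x) \<in> borel_measurable borel" by simp
  note tr = truncate_measurable abs_truncate_le(1)
  have int: "integrable Q (\<lambda>x. x i)" "integrable Q (\<lambda>x. x j)" "integrable Q (\<lambda>x. ?T (x i))" "integrable Q (\<lambda>x. ?T (x j))"
    "integrable Q (\<lambda>x. x i * x j)" "integrable Q (\<lambda>x. ?T (x i) * ?T (x j))"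
    by (rule integrable_coordinate[OF i(1) id order_refl] integrable_coordinate[OF i(2) id order_refl]
        integrable_coordinate[OF i(1) tr] integrable_coordinate[OF i(2) tr]
        integrable_coordinate_product[OF i id order_refl] integrable_coordinate_product[OF i tr])+
  have le: "\<bar>mi\<bar> \<le> 1 + C" "\<bar>nj\<bar> \<le> 1 + C" "\<bar>ni - mi\<bar> \<le> C * \<tau> powr (1 - q)" "\<bar>nj - mj\<bar> \<le> C * \<tau> powr (1 - q)"
    unfolding mi_def mj_def ni_def nj_def
    using integrable_coordinate(2)[OF i(2) id order_refl] integrable_coordinate(2)[OF i(1) tr]
      truncation_mean_error(3)[OF i(1), of \<tau>] truncation_mean_error(3)[OF i(2), of \<tau>] \<tau>
    by simp_all
  let ?p = "(\<integral>x. x i * x j \<partial>Q) - (\<integral>x. ?T (x i) * ?T (x j) \<partial>Q)" and ?d = "\<lambda>x. x i * x j - ?T (x i) * ?T (x j)"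
  have tt: "\<tau> powr (1 - q) \<le> \<tau> powr (2 - q)" using \<tau> by (intro powr_mono) auto
  have "\<bar>?p\<bar> = \<bar>\<integral>x. ?d x \<partial>Q\<bar>"
    using int by simp
  also have "\<dots> \<le> (\<integral>x. \<bar>?d x\<bar> \<partial>Q)" by (rule integral_abs_bound)
  also have "\<dots> \<le> (\<integral>x. \<tau> powr (2 - q) * (\<bar>x i\<bar> powr q + \<bar>x j\<bar> powr q) \<partial>Q)"
    using \<tau> q int int_q[OF i(1)] int_q[OF i(2)] by (intro integral_mono truncation_error_le) auto
  also have "\<dots> = \<tau> powr (2 - q) * ((\<integral>x. \<bar>x i\<bar> powr q \<partial>Q) + (\<integral>x. \<bar>x j\<bar> powr q \<partial>Q))"
    using int_q[OF i(1)] int_q[OF i(2)] by simp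
  also have "\<dots> \<le> \<tau> powr (2 - q) * (2 * C)"
    using moment[OF i(1)] moment[OF i(2)] by (intro mult_left_mono) auto
  finally have prod: "\<bar>?p\<bar> \<le> \<tau> powr (2 - q) * (2 * C)" .
  have "ni * nj - mi * mj = (ni - mi) * nj + mi * (nj - mj)" by (simp add: algebra_simps)
  then have "\<bar>ni * nj - mi * mj\<bar> \<le> \<bar>ni - mi\<bar> * \<bar>nj\<bar> + \<bar>mi\<bar> * \<bar>nj - mj\<bar>"
    by (metis abs_mult abs_triangle_ineq)
  also have "\<dots> \<le> (C * \<tau> powr (1 - q)) * (1 + C) + (1 + C) * (C * \<tau> powr (1 - q))"
    using le C by (intro add_mono mult_mono) auto
  also have "\<dots> = 2 * C * (1 + C) * \<tau> powr (1 - q)" by (simp add: algebra_simps)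
  also have "\<dots> \<le> 2 * C * (1 + C) * \<tau> powr (2 - q)" using tt C by (intro mult_left_mono) auto
  finally have mean: "\<bar>ni * nj - mi * mj\<bar> \<le> 2 * C * (1 + C) * \<tau> powr (2 - q)" .
  have "\<bar>?cov' -
      ?cov\<bar> \<le> \<tau> powr (2 - q) * (2 * C) + 2 * C * (1 + C) * \<tau> powr (2 - q)"
    unfolding centered_truncation_def
    unfolding expand[OF int(3,4,6)] expand[OF int(1,2,5)]
    using prod mean unfolding mi_def mj_def ni_def nj_def by linarith
  also have "\<dots> = (4 * C + 2 * C\<^sup>2) * \<tau> powr (2 - q)" by (simp add: power2_eq_square algebra_simps)
  also have "\<dots> \<le> 4 * (1 + C)\<^sup>2 * \<tau> powr (2 - q)"
    using C by (intro mult_right_mono) (auto simp: power2_eq_square algebra_simps)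
  finally show ?thesis .
qed

end

section \<open>From smooth test functions to probabilities of boxes\<close>

lemma soft_box_cong: "(\<And>i. i \<in> I \<Longrightarrow> x i = y i) \<Longrightarrow> soft_box I \<beta> t x = soft_box I \<beta> t y"
  unfolding soft_box_def by (intro arg_cong[where f="\<lambda>u. exp (- u)"] sum.cong) auto

text \<open>The soft box is placed midway, at \<open>t\<close> plus one width: it is nearly 1 on the
  box of size \<open>t\<close> and nearly 0 outside the box enlarged by two widths. Since the
  hypothesis \<open>cmp\<close> is symmetric in the two variables, the lemma yields both
  directions.\<close>

lemma box_prob_le_of_soft_box:
  fixes V :: "'a \<Rightarrow> 'i \<Rightarrow> real" and Y :: "'b \<Rightarrow> 'i \<Rightarrow> real"
  assumes M: "prob_space M" and G: "prob_space G" and I: "finite I" and \<beta>: "0 < \<beta>" and K: "0 \<le> K"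
    and V[measurable]: "\<And>i. i \<in> I \<Longrightarrow> (\<lambda>w. V w i) \<in> borel_measurable M"
    and Y[measurable]: "\<And>i. i \<in> I \<Longrightarrow> (\<lambda>w. Y w i) \<in> borel_measurable G"
    and cmp: "\<And>t. \<bar>(\<integral>w. soft_box I \<beta> t (V w) \<partial>M) - (\<integral>w. soft_box I \<beta> t (Y w) \<partial>G)\<bar> \<le> E"
    and I1: "I \<noteq> {}"
  shows "measure M {w \<in> space M. \<forall>i\<in>I. \<bar>V w i\<bar> \<le> t} \<le>
    measure G {w \<in> space G. \<forall>i\<in>I. \<bar>Y w i\<bar> \<le> t + 2 * ((ln (2 * real (card I)) + K) / \<beta>)} + 2 * exp (- K) + E"
proof -
  interpret M: prob_space M by fact
  interpret G: prob_space G by fact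
  define \<delta> where "\<delta> = (ln (2 * real (card I)) + K) / \<beta>"
  have "1 \<le> real (card I)" using I I1 by (simp add: Suc_leI card_gt_0_iff)
  then have K\<delta>: "K / \<beta> \<le> \<delta>" using \<beta> by (simp add: \<delta>_def divide_right_mono)
  let ?A = "{w \<in> space M. \<forall>i\<in>I. \<bar>V w i\<bar> \<le> t}" and ?B = "{w \<in> space G. \<forall>i\<in>I. \<bar>Y w i\<bar> \<le> t + 2 * \<delta>}"
  have A[measurable]: "?A \<in> sets M" and B[measurable]: "?B \<in> sets G" using I by measurable
  have intM: "integrable M (\<lambda>w. soft_box I \<beta> s (V w))" for s
    by (rule M.integrable_const_bound[where B=1]) (auto simp: soft_box_bounds(3))
  have intG: "integrable G (\<lambda>w. soft_box I \<beta> s (Y w))" for s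
    by (rule G.integrable_const_bound[where B=1]) (auto simp: soft_box_bounds(3))
  have ind: "integrable M (indicat_real ?A)" "integrable G (indicat_real ?B)"
    using A B by (auto intro!: M.integrable_const_bound[where B=1] G.integrable_const_bound[where B=1]
        borel_measurable_indicator simp: indicator_def simp del: Collect_mem_eq)
  have "measure M ?A = (\<integral>w. indicator ?A w \<partial>M)" by simp
  also have "\<dots> \<le> (\<integral>w. soft_box I \<beta> (t + \<delta>) (V w) + exp (- K) \<partial>M)"
  proof (rule integral_mono)
    fix w assume "w \<in> space M"
    show "indicator ?A w \<le> soft_box I \<beta> (t + \<delta>) (V w) + exp (- K)"
      using soft_box_near_1[OF I \<beta>, of "V w" "t + \<delta>" K] soft_box_bounds(1)[of I \<beta> "t + \<delta>" "V w"]
      by (auto simp: \<delta>_def indicator_def add_nonneg_nonneg)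
  qed (rule ind Bochner_Integration.integrable_add intM M.integrable_const)+
  also have "\<dots> = (\<integral>w. soft_box I \<beta> (t + \<delta>) (V w) \<partial>M) + exp (- K)"
    using intM by (simp add: M.prob_space)
  also have "(\<integral>w. soft_box I \<beta> (t + \<delta>) (V w) \<partial>M) \<le> (\<integral>w. soft_box I \<beta> (t + \<delta>) (Y w) \<partial>G) + E"
    using cmp[of "t + \<delta>"] by linarith
  also have "(\<integral>w. soft_box I \<beta> (t + \<delta>) (Y w) \<partial>G) \<le> (\<integral>w. indicator ?B w + exp (- K) \<partial>G)"
  proof (rule integral_mono)
    fix w assume w: "w \<in> space G"
    show "soft_box I \<beta> (t + \<delta>) (Y w) \<le> indicator ?B w + exp (- K)"
    proof (cases "w \<in> ?B")
      case True
      then show ?thesis using soft_box_bounds(2)[of I \<beta> "t + \<delta>" "Y w"] by (simp add: add_increasing2)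
    next
      case False
      then obtain i where i: "i \<in> I" "t + 2 * \<delta> < \<bar>Y w i\<bar>" using w by auto
      have "soft_box I \<beta> (t + \<delta>) (Y w) \<le> exp (- K)"
        by (rule soft_box_near_0[OF I \<beta> i(1)]) (use i K\<delta> in linarith)
      then show ?thesis using False by simp
    qed
  qed (rule ind Bochner_Integration.integrable_add intG G.integrable_const)+
  also have "(\<integral>w. indicator ?B w + exp (- K) \<partial>G) = measure G ?B + exp (- K)"
    by (subst Bochner_Integration.integral_add[OF ind(2)]) (simp_all add: G.prob_space)
  finally show ?thesis by (simp add: \<delta>_def)
qed

text \<open>If the maximum norm lies between \<open>t\<close> and \<open>t + \<delta>\<close>, then
  so does the maximum of \<open>y\<close> or that of \<open>- y\<close>. Both have the same law by
  symmetry, whence the factor 2.\<close>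

lemma gaussian_abs_max_anticoncentration:
  fixes I :: "'i::linorder set"
  assumes I: "finite I" "I \<noteq> {}" and G: "gaussian_law I \<Sigma> G"
    and b: "0 < b" "\<And>i. i \<in> I \<Longrightarrow> b \<le> \<Sigma> i i" and sym: "\<And>i k. i \<in> I \<Longrightarrow> k \<in> I \<Longrightarrow> \<Sigma> i k = \<Sigma> k i"
    and \<delta>: "0 \<le> \<delta>" "\<delta> \<le> sqrt b"
  shows "measure G {y \<in> space G. \<forall>i\<in>I. \<bar>y i\<bar> \<le> t + \<delta>} \<le> measure G {y \<in> space G. \<forall>i\<in>I. \<bar>y i\<bar> \<le> t}
    + 2 * (\<delta> / sqrt b * (1 + exp 1 * (sqrt (2 * ln (real (card I))) + 2)))"
proof -
  interpret G: prob_space G using G by (rule gaussian_lawD)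
  note sG[measurable_cong] = gaussian_lawD(2)[OF G]
  let ?E = "{y \<in> space G. (\<exists>j\<in>I. t < y j) \<and> (\<forall>j\<in>I. y j \<le> t + \<delta>)}"
  define neg where "neg y = (\<lambda>i\<in>I. (- 1) * y i)" for y :: "'i \<Rightarrow> real"
  let ?E' = "neg -` ?E \<inter> space G"
  have [measurable]: "(\<lambda>y. y i) \<in> borel_measurable G" if "i \<in> I" for i using that by measurable
  have negG: "distr G (borel_on I) neg = G"
    using gaussian_law_unique[OF I(1) gaussian_law_scale[OF G, of "\<lambda>_. - 1"] G] by (simp add: neg_def[abs_def])
  have m: "neg \<in> measurable G (borel_on I)"
    unfolding neg_def[abs_def] by (rule measurable_restrict) simp
  have E: "?E \<in> sets G" using I by measurable
  have E': "?E' \<in> sets G" by (rule measurable_sets[OF m E[unfolded sG]])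
  have "measure G ?E = measure (distr G (borel_on I) neg) ?E" unfolding negG ..
  also have "\<dots> = measure G ?E'" by (rule measure_distr[OF m E[unfolded sG]])
  finally have "measure G ?E' = measure G ?E" ..
  then have le: "measure G ?E + measure G ?E' \<le> 2 * (\<delta> / sqrt b * (1 + exp 1 * (sqrt (2 * ln (real (card I))) + 2)))"
    using gaussian_max_anticoncentration[OF I G b sym \<delta>, of t] by simp
  let ?S = "\<lambda>s. {y \<in> space G. \<forall>i\<in>I. \<bar>y i\<bar> \<le> s}"
  have S: "?S s \<in> sets G" for s using I by measurable
  have "?S (t + \<delta>) \<subseteq> ?S t \<union> (?E \<union> ?E')"
  proof
    fix y assume y: "y \<in> ?S (t + \<delta>)"
    have sp: "neg y \<in> space G"
      using measurable_space[OF m, of y] y sets_eq_imp_space_eq[OF sG] by simp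
    show "y \<in> ?S t \<union> (?E \<union> ?E')"
    proof (cases "y \<in> ?S t")
      case False
      then obtain i where i: "i \<in> I" "t < y i \<or> t < - y i" using y by (force simp: not_le)
      have b: "y j \<le> t + \<delta>" "- y j \<le> t + \<delta>" if "j \<in> I" for j using y that by (auto simp: abs_le_iff)
      show ?thesis using i(2)
      proof
        assume "t < y i" then have "y \<in> ?E" using y i(1) b by auto
        then show ?thesis by blast
      next
        assume "t < - y i" then have "neg y \<in> ?E" using sp i(1) b by (auto simp: neg_def)
        then show ?thesis using y by blast
      qed
    qed blast
  qed
  then have "measure G (?S (t + \<delta>)) \<le> measure G (?S t \<union> (?E \<union> ?E'))"
    using S E E' by (intro G.finite_measure_mono) auto
  also have "\<dots> \<le> measure G (?S t) + (measure G ?E + measure G ?E')"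
    using S E E' by (intro order_trans[OF measure_Un_le] add_left_mono measure_Un_le) auto
  finally show ?thesis using le by linarith
qed

text \<open>The summands stem from anti-concentration, from the smoothing (twice \<open>exp (- K)\<close>), from the Lindeberg
  replacement and from the probability that the truncation moves some coordinate by more than \<open>\<delta>\<close>.\<close>

definition approximation_error :: "real \<Rightarrow> real \<Rightarrow> real \<Rightarrow> nat \<Rightarrow> nat \<Rightarrow> nat \<Rightarrow> real \<Rightarrow> real \<Rightarrow> real \<Rightarrow> real" where
  "approximation_error q C b m n p \<beta> K \<delta> =
     2 * ((\<delta> + 2 * ((ln (2 * real p) + K) / \<beta>)) / sqrt b * (1 + exp 1 * (sqrt (2 * ln (real p)) + 2))) + 2 * exp (- K)
      + real n * (16 / 3 * exp 4 * \<beta> ^ 3 * ((1 + C) ^ 3 * (8 + abs_moment 3) / sqrt (real n) ^ 3)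
        + \<beta>\<^sup>2 * (4 * (1 + C)\<^sup>2 * (sqrt (real n) / \<beta>) powr (2 - q) / real n)
        + 6 * real p * \<beta> ^ m * ((1 + C) ^ m * abs_moment m / sqrt (real n) ^ m))
      + 2 * real p * sqrt (real n) * (C * (sqrt (real n) / \<beta>) powr (1 - q)) / \<delta>"

locale gaussian_approximation = bounded_moments Q I q C
  for Q :: "('i::linorder \<Rightarrow> real) measure" and I q C +
  fixes \<Sigma> :: "'i \<Rightarrow> 'i \<Rightarrow> real" and G :: "('i \<Rightarrow> real) measure" and b :: real
  assumes I1: "I \<noteq> {}" and G: "gaussian_law I \<Sigma> G"
    and G_mean: "\<And>i. i \<in> I \<Longrightarrow> (\<integral>y. y i \<partial>G) = 0"
    and G_cov: "\<And>i j. i \<in> I \<Longrightarrow> j \<in> I \<Longrightarrow> (\<integral>y. y i * y j \<partial>G) = \<Sigma> i j"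
    and Q_cov: "\<And>i j. i \<in> I \<Longrightarrow> j \<in> I \<Longrightarrow>
      (\<integral>x. (x i - (\<integral>x. x i \<partial>Q)) * (x j - (\<integral>x. x j \<partial>Q)) \<partial>Q) = \<Sigma> i j"
    and b: "0 < b" "\<And>i. i \<in> I \<Longrightarrow> b \<le> \<Sigma> i i"
begin

sublocale G: prob_space G using G by (rule gaussian_lawD)

lemma \<Sigma>_diag: assumes i: "i \<in> I" shows "0 < \<Sigma> i i" "sqrt (\<Sigma> i i) \<le> 1 + C"
proof -
  show "0 < \<Sigma> i i" using b i by force
  have id: "(\<lambda>x :: real. x) \<in> borel_measurable borel" by simp
  define \<mu> where "\<mu> = (\<integral>x. x i \<partial>Q)"
  have int: "integrable Q (\<lambda>x. x i)" "integrable Q (\<lambda>x. x i * x i)"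
    using integrable_coordinate(1)[OF i id order_refl] integrable_coordinate_product[OF i i id order_refl] .
  have "\<Sigma> i i = (\<integral>x. x i * x i \<partial>Q) - \<mu> * \<mu>"
    unfolding Q_cov[OF i i, symmetric] \<mu>_def[symmetric] using int
    by (simp add: algebra_simps prob_space \<mu>_def[symmetric])
  also have "\<dots> \<le> (\<integral>x. \<bar>x i\<bar> ^ 2 \<partial>Q)" by (simp add: power2_eq_square)
  also have "\<dots> \<le> 1 + C" using abs_power_moment(2)[OF i _ id, of 2] by simp
  also have "\<dots> \<le> (1 + C)\<^sup>2" using C by (simp add: power2_eq_square algebra_simps)
  finally show "sqrt (\<Sigma> i i) \<le> 1 + C" using C by (intro real_le_lsqrt) auto
qed

lemma soft_box_comparison:
  assumes n: "1 \<le> n" and \<beta>: "0 < \<beta>" and \<tau>: "1 \<le> sqrt (real n) / \<beta>" and m: "2 \<le> m"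
  defines "\<tau> \<equiv> sqrt (real n) / \<beta>"
  shows "\<bar>(\<integral>w. soft_box I \<beta> t (\<lambda>i. \<Sum>l\<in>{1..n}. centered_truncation \<tau> (w l) i / sqrt (real n)) \<partial>PiM {1..n} (\<lambda>_. Q)) -
      (\<integral>y. soft_box I \<beta> t y \<partial>G)\<bar>
    \<le> real n * (16 / 3 * exp 4 * \<beta> ^ 3 * ((1 + C) ^ 3 * (8 + abs_moment 3) / sqrt (real n) ^ 3)
      + \<beta>\<^sup>2 * (4 * (1 + C)\<^sup>2 * \<tau> powr (2 - q) / real n)
      + 6 * real (card I) * \<beta> ^ m * ((1 + C) ^ m * abs_moment m / sqrt (real n) ^ m))"
    (is "_ \<le> real n * ?\<Delta>")
proof -
  note sG[measurable_cong] = gaussian_lawD(2)[OF G]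
  define s where "s = sqrt (real n)"
  have s: "0 < s" "s * s = real n" using n by (auto simp: s_def)
  let ?z = "\<lambda>w i. centered_truncation \<tau> w i / s" and ?M = "(1 + C) ^ 3 * (8 + abs_moment 3) / s ^ 3"
  \<comment> \<open>This fixes the truncation level: centring doubles the bound \<tau>, and the
    scaled jumps then just fit the Taylor range 2.\<close>
  have s\<beta>: "\<beta> * (2 * \<tau>) / s = 2" using \<beta> s by (simp add: \<tau>_def s_def[symmetric])
  note ct = centered_truncation_facts[OF \<tau>[folded \<tau>_def]]
  have gm: "integrable G (\<lambda>y. \<bar>y i / s\<bar> ^ k)"
    "(\<integral>y. \<bar>y i / s\<bar> ^ k \<partial>G) \<le> (1 + C) ^ k * abs_moment k / s ^ k" if i: "i \<in> I" for i k
  proof -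
    have e: "\<bar>y i / s\<bar> ^ k = \<bar>y i\<bar> ^ k / s ^ k" for y :: "'i \<Rightarrow> real"
      using s by (simp add: power_divide)
    note g = gaussian_law_abs_moment[OF I i G \<Sigma>_diag(1)[OF i], of k]
    show "integrable G (\<lambda>y. \<bar>y i / s\<bar> ^ k)" unfolding e using g by simp
    have "sqrt (\<Sigma> i i) ^ k * abs_moment k \<le> (1 + C) ^ k * abs_moment k"
      using \<Sigma>_diag[OF i] by (intro mult_right_mono power_mono abs_moment_nonneg) auto
    then show "(\<integral>y. \<bar>y i / s\<bar> ^ k \<partial>G) \<le> (1 + C) ^ k * abs_moment k / s ^ k"
      unfolding e using g s by (simp add: divide_right_mono)
  qed
  have step: "\<bar>(\<integral>w. soft_box I \<beta> t (\<lambda>i. x i + ?z w i) \<partial>Q) -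
      (\<integral>y. soft_box I \<beta> t (\<lambda>i. x i + y i / s) \<partial>G)\<bar> \<le> ?\<Delta>" for x
    unfolding s_def[symmetric]
  proof (rule soft_box_step[OF prob_space_axioms G.prob_space_axioms I \<beta> m])
    fix i assume i: "i \<in> I"
    show "(\<lambda>w. ?z w i) \<in> borel_measurable Q" using ct(1)[OF i] by measurable
    show "(\<lambda>y. y i / s) \<in> borel_measurable G" using i by measurable
    have e: "\<bar>?z w i\<bar> ^ 3 = \<bar>centered_truncation \<tau> w i\<bar> ^ 3 / s ^ 3" for w
      using s by (simp add: power_divide)
    show "integrable Q (\<lambda>w. \<bar>?z w i\<bar> ^ 3)" unfolding e using ct(4)[OF i] by simp
    have "(\<integral>w. \<bar>?z w i\<bar> ^ 3 \<partial>Q) \<le> 8 * (1 + C) ^ 3 / s ^ 3"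
      unfolding e using ct(5)[OF i] s by (simp add: divide_right_mono)
    also have "\<dots> \<le> ?M"
      using s C abs_moment_nonneg[of 3] by (intro divide_right_mono) (auto simp: algebra_simps)
    finally show "(\<integral>w. \<bar>?z w i\<bar> ^ 3 \<partial>Q) \<le> ?M" .
    show "integrable G (\<lambda>w. \<bar>w i / s\<bar> ^ 3)" by (rule gm[OF i])
    have "(\<integral>w. \<bar>w i / s\<bar> ^ 3 \<partial>G) \<le> (1 + C) ^ 3 * abs_moment 3 / s ^ 3" by (rule gm[OF i])
    also have "\<dots> \<le> ?M"
      using s C by (intro divide_right_mono mult_left_mono) auto
    finally show "(\<integral>w. \<bar>w i / s\<bar> ^ 3 \<partial>G) \<le> ?M" .
    show "(\<integral>w. ?z w i \<partial>Q) = 0" using ct(3)[OF i] by simp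
    show "(\<integral>w. w i / s \<partial>G) = 0" using G_mean[OF i] by simp
    show "integrable G (\<lambda>w. \<bar>w i / s\<bar> ^ m)" by (rule gm[OF i])
    show "(\<integral>w. \<bar>w i / s\<bar> ^ m \<partial>G) \<le> (1 + C) ^ m * abs_moment m / s ^ m" by (rule gm[OF i])
  next
    fix i j assume ij: "i \<in> I" "j \<in> I"
    have "(\<integral>w. ?z w i * (?z w j) \<partial>Q) - (\<integral>w. w i / s * (w j / s) \<partial>G) =
        ((\<integral>w. centered_truncation \<tau> w i * centered_truncation \<tau> w j \<partial>Q) - \<Sigma> i j) / real n"
      using G_cov[OF ij] by (simp add: s(2)[symmetric] diff_divide_distrib)
    then show "\<bar>(\<integral>w. ?z w i * (?z w j) \<partial>Q) - (\<integral>w. w i / s * (w j / s) \<partial>G)\<bar>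
        \<le> 4 * (1 + C)\<^sup>2 * \<tau> powr (2 - q) / real n"
      using centered_truncation_covariance[OF \<tau>[folded \<tau>_def] ij] n unfolding Q_cov[OF ij]
      by (simp add: divide_right_mono)
  next
    show "AE w in Q. \<forall>i\<in>I. \<beta> * \<bar>?z w i\<bar> \<le> 2"
    proof (intro AE_I2 ballI)
      fix w i assume i: "i \<in> I"
      have "\<beta> * \<bar>?z w i\<bar> \<le> \<beta> * (2 * \<tau>) / s"
        using ct(2)[OF i, of w] \<beta> s by (simp add: divide_right_mono mult_left_mono)
      then show "\<beta> * \<bar>?z w i\<bar> \<le> 2" using s\<beta> by simp
    qed
    show "0 \<le> ?M"
      using s C abs_moment_nonneg[of 3] by simp
    show "0 \<le> 4 * (1 + C)\<^sup>2 * \<tau> powr (2 - q) / real n" by simp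
  qed
  have "\<bar>(\<integral>w. soft_box I \<beta> t (\<lambda>i. 0 + (\<Sum>l\<in>{1..n}. ?z (w l) i)) \<partial>PiM {1..n} (\<lambda>_. Q)) -
      (\<integral>w. soft_box I \<beta> t (\<lambda>i. 0 + (\<Sum>l\<in>{1..n}. w l i / s)) \<partial>PiM {1..n} (\<lambda>_. G))\<bar> \<le> real (card {1..n}) * ?\<Delta>"
  proof (rule lindeberg_replacement[OF prob_space_axioms G.prob_space_axioms _ _ step])
    show "(\<lambda>w. ?z w i) \<in> borel_measurable Q" if "i \<in> I" for i using ct(1)[OF that] by measurable
    show "(\<lambda>y. y i / s) \<in> borel_measurable G" if "i \<in> I" for i using that by measurable
  qed simp
  \<comment> \<open>The \<open>n\<close> Gaussian pieces of size \<open>1 / sqrt n\<close> recombine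
    to the law \<open>G\<close> itself.\<close>
  moreover have "(\<integral>w. soft_box I \<beta> t (\<lambda>i. \<Sum>l\<in>{1..n}. w l i / s) \<partial>PiM {1..n} (\<lambda>_. G)) = (\<integral>y. soft_box I \<beta> t y \<partial>G)"
  proof -
    let ?S = "\<lambda>w. \<lambda>i\<in>I. \<Sum>l\<in>{1..n}. w l i / sqrt (real (card {1..n}))"
    have "distr (PiM {1..n} (\<lambda>_. G)) (borel_on I) ?S = G"
      using n by (intro gaussian_law_normalized_sum[OF I _ _ G]) auto
    moreover have "?S \<in> measurable (PiM {1..n} (\<lambda>_. G)) (borel_on I)"
    proof (rule measurable_restrict)
      fix i assume i: "i \<in> I"
      have "(\<lambda>y. y i) \<in> borel_measurable G" using i by measurable
      then have [measurable]: "(\<lambda>w. w l i) \<in> borel_measurable (PiM {1..n} (\<lambda>_. G))" if "l \<in> {1..n}" for l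
        using that by (intro measurable_PiM_component_rev)
      show "(\<lambda>w. \<Sum>l\<in>{1..n}. w l i / sqrt (real (card {1..n}))) \<in> borel_measurable (PiM {1..n} (\<lambda>_. G))"
        by (intro borel_measurable_sum borel_measurable_divide borel_measurable_const) measurable
    qed
    moreover have "(\<lambda>y. soft_box I \<beta> t y) \<in> borel_measurable (borel_on I)"
      by (rule soft_box_measurable) simp
    ultimately have "(\<integral>y. soft_box I \<beta> t y \<partial>G) = (\<integral>w. soft_box I \<beta> t (?S w) \<partial>PiM {1..n} (\<lambda>_. G))"
      by (metis integral_distr)
    also have "\<dots> = (\<integral>w. soft_box I \<beta> t (\<lambda>i. \<Sum>l\<in>{1..n}. w l i / s) \<partial>PiM {1..n} (\<lambda>_. G))"
      by (intro Bochner_Integration.integral_cong refl soft_box_cong) (simp add: s_def)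
    finally show ?thesis ..
  qed
  ultimately show ?thesis unfolding s_def[symmetric] by (simp add: add_0_left)
qed


text \<open>Markov's inequality for one variable that dominates the deviations of all coordinates at
  once. Summing over coordinates instead of maximising costs the factor
  \<open>card I\<close>.\<close>

lemma truncation_error_prob:
  assumes n: "1 \<le> n" and \<tau>: "0 < \<tau>" and \<delta>: "0 < \<delta>"
  shows "measure (PiM {1..n} (\<lambda>_. Q)) {w \<in> space (PiM {1..n} (\<lambda>_. Q)). \<exists>i\<in>I.
      \<delta> < \<bar>(\<Sum>l\<in>{1..n}. (w l i - (\<integral>x. x i \<partial>Q)) / sqrt (real n)) -
         (\<Sum>l\<in>{1..n}. centered_truncation \<tau> (w l) i / sqrt (real n))\<bar>}
    \<le> 2 * real (card I) * sqrt (real n) * (C * \<tau> powr (1 - q)) / \<delta>"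
proof -
  let ?P = "PiM {1..n} (\<lambda>_. Q)"
  interpret P: prob_space ?P by (intro prob_space_PiM prob_space_axioms)
  define s where "s = sqrt (real n)"
  have s: "0 < s" "s * s = real n" using n by (auto simp: s_def)
  let ?e = "\<lambda>x i. \<bar>x i - truncate \<tau> (x i)\<bar>"
    and ?g = "\<lambda>w l i. (w l i - truncate \<tau> (w l i)) - ((\<integral>x. x i \<partial>Q) - (\<integral>x. truncate \<tau> (x i) \<partial>Q))"
  define c where "c = C * \<tau> powr (1 - q)"
  \<comment> \<open>Each summand has mean at most \<open>2 * c / s\<close>: one \<open>c\<close>
    bounds the random truncation error, the other the shift of the mean. Adding
    \<open>n = s * s\<close> of them gives \<open>2 * s * c\<close> per coordinate.\<close>
  define Z where "Z w = (\<Sum>i\<in>I. \<Sum>l\<in>{1..n}. (?e (w l) i + c) / s)" for w :: "nat \<Rightarrow> 'i \<Rightarrow> real"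
  define D where "D w i = \<bar>(\<Sum>l\<in>{1..n}. (w l i - (\<integral>x. x i \<partial>Q)) / s) - (\<Sum>l\<in>{1..n}. centered_truncation \<tau> (w l) i / s)\<bar>"
    for w :: "nat \<Rightarrow> 'i \<Rightarrow> real" and i
  have c: "0 \<le> c" using C by (simp add: c_def)
  have Z_nn: "0 \<le> Z w" for w unfolding Z_def using s c by (intro sum_nonneg) auto
  have comp: "integrable ?P (\<lambda>w. ?e (w l) i)"
    "(\<integral>w. ?e (w l) i \<partial>?P) \<le> c" if i: "i \<in> I" and l: "l \<in> {1..n}" for i l
  proof -
    note [measurable] = coordinate_measurable[OF i]
    have D: "distr ?P Q (\<lambda>w. w l) = Q"
      using distr_PiM_component[of "{1..n}" "\<lambda>_. Q" l] prob_space_axioms l by simp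
    have m: "(\<lambda>w. w l) \<in> measurable ?P Q" using l by (rule measurable_component_singleton)
    show "integrable ?P (\<lambda>w. ?e (w l) i)"
      using truncation_mean_error(2)[OF i \<tau>] unfolding D[symmetric, THEN arg_cong, of "\<lambda>R. integrable R (\<lambda>x. ?e x i)"]
      by (rule integrable_distr[OF m])
    have "(\<integral>w. ?e (w l) i \<partial>?P) = (\<integral>x. ?e x i \<partial>distr ?P Q (\<lambda>w. w l))"
      by (rule integral_distr[OF m, symmetric]) measurable
    then show "(\<integral>w. ?e (w l) i \<partial>?P) \<le> c"
      unfolding D c_def using truncation_mean_error(1)[OF i \<tau>] by simp
  qed
  have Z_int: "integrable ?P Z" unfolding Z_def
    by (intro Bochner_Integration.integrable_sum integrable_divide Bochner_Integration.integrable_add comp P.integrable_const)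
  have term_int: "integrable ?P (\<lambda>w. (?e (w l) i + c) / s)" if "i \<in> I" "l \<in> {1..n}" for i l
    by (intro integrable_divide Bochner_Integration.integrable_add comp P.integrable_const that)
  have "(\<integral>w. Z w \<partial>?P) = (\<Sum>i\<in>I. \<Sum>l\<in>{1..n}. \<integral>w. (?e (w l) i + c) / s \<partial>?P)"
    unfolding Z_def
    by (subst Bochner_Integration.integral_sum, intro Bochner_Integration.integrable_sum term_int, assumption+)
      (intro sum.cong refl Bochner_Integration.integral_sum term_int)
  also have "\<dots> = (\<Sum>i\<in>I. \<Sum>l\<in>{1..n}. ((\<integral>w. ?e (w l) i \<partial>?P) + c) / s)"
  proof (intro sum.cong refl)
    fix i l assume il: "i \<in> I" "l \<in> {1..n}"
    show "(\<integral>w. (?e (w l) i + c) / s \<partial>?P) = ((\<integral>w. ?e (w l) i \<partial>?P) + c) / s"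
      using Bochner_Integration.integral_add[OF comp(1)[OF il] P.integrable_const[of c]]
      by (simp add: P.prob_space[simplified])
  qed
  also have "\<dots> \<le> (\<Sum>i\<in>I. \<Sum>l\<in>{1..n}. (c + c) / s)"
    using s comp by (intro sum_mono divide_right_mono add_mono) auto
  also have "\<dots> = 2 * real (card I) * s * c"
    using s by (simp add: s(2)[symmetric])
  finally have EZ: "(\<integral>w. Z w \<partial>?P) \<le> 2 * real (card I) * s * c" .
  have DZ: "D w i \<le> Z w" if i: "i \<in> I" for w i
  proof -
    have "D w i = \<bar>\<Sum>l\<in>{1..n}. (?g w l i) / s\<bar>"
      unfolding D_def sum_subtractf[symmetric] centered_truncation_def diff_divide_distrib[symmetric]
      by (simp add: algebra_simps)
    also have "\<dots> \<le> (\<Sum>l\<in>{1..n}. (?e (w l) i + c) / s)"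
    proof (intro order_trans[OF sum_abs] sum_mono)
      fix l
      have "\<bar>?g w l i\<bar> \<le> ?e (w l) i + c"
        using truncation_mean_error(3)[OF i \<tau>] unfolding c_def by linarith
      then show "\<bar>(?g w l i) / s\<bar> \<le> (?e (w l) i + c) / s"
        using s by (simp add: divide_right_mono)
    qed
    also have "\<dots> \<le> Z w"
      unfolding Z_def using s c I i
      by (intro member_le_sum[of i I "\<lambda>i. \<Sum>l\<in>{1..n}. (?e (w l) i + c) / s"] sum_nonneg) auto
    finally show ?thesis .
  qed
  have "measure ?P {w \<in> space ?P. \<exists>i\<in>I. \<delta> < D w i} \<le> measure ?P {w \<in> space ?P. \<delta> \<le> Z w}"
  proof (rule P.finite_measure_mono)
    show "{w \<in> space ?P. \<exists>i\<in>I. \<delta> < D w i} \<subseteq> {w \<in> space ?P. \<delta> \<le> Z w}"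
      using DZ by (auto intro: order_trans[OF less_imp_le])
    show "{w \<in> space ?P. \<delta> \<le> Z w} \<in> P.events" using borel_measurable_integrable[OF Z_int] by measurable
  qed
  also have "\<dots> \<le> (\<integral>w. Z w \<partial>?P) / \<delta>"
    using Z_nn \<delta> by (intro integral_Markov_inequality_measure[OF Z_int sets.top]) auto
  also have "\<dots> \<le> 2 * real (card I) * s * c / \<delta>" using EZ \<delta> by (intro divide_right_mono) auto
  finally show ?thesis unfolding D_def s_def c_def .
qed

text \<open>The threshold moves by \<open>\<delta>\<^sub>1\<close> when the sum is truncated and by
  twice the smoothing width when it is replaced by \<open>Y\<close>. One application of Gaussian
  anti-concentration undoes the total shift \<delta>.\<close>

lemma kolmogorov_distance_le:
  assumes n: "1 \<le> n" and \<beta>: "0 < \<beta>" and \<tau>1: "1 \<le> sqrt (real n) / \<beta>" and m: "2 \<le> m"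
    and K: "0 \<le> K" and \<delta>\<^sub>1: "0 < \<delta>\<^sub>1"
  defines "\<tau> \<equiv> sqrt (real n) / \<beta>"
    and "\<delta> \<equiv> \<delta>\<^sub>1 + 2 * ((ln (2 * real (card I)) + K) / \<beta>)"
  assumes \<delta>b: "\<delta> \<le> sqrt b"
  shows "\<bar>measure (PiM {1..n} (\<lambda>_. Q)) {w \<in> space (PiM {1..n} (\<lambda>_. Q)). \<forall>i\<in>I.
        \<bar>\<Sum>l\<in>{1..n}. (w l i - (\<integral>x. x i \<partial>Q)) / sqrt (real n)\<bar> \<le> t}
      - measure G {y \<in> space G. \<forall>i\<in>I. \<bar>y i\<bar> \<le> t}\<bar>
    \<le> approximation_error q C b m n (card I) \<beta> K \<delta>\<^sub>1"
proof -
  let ?anti = "2 * (\<delta> / sqrt b * (1 + exp 1 * (sqrt (2 * ln (real (card I))) + 2)))"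
  let ?E = "real n * (16 / 3 * exp 4 * \<beta> ^ 3 * ((1 + C) ^ 3 * (8 + abs_moment 3) / sqrt (real n) ^ 3)
        + \<beta>\<^sup>2 * (4 * (1 + C)\<^sup>2 * \<tau> powr (2 - q) / real n)
        + 6 * real (card I) * \<beta> ^ m * ((1 + C) ^ m * abs_moment m / sqrt (real n) ^ m))"
  let ?\<eta> = "2 * real (card I) * sqrt (real n) * (C * \<tau> powr (1 - q)) / \<delta>\<^sub>1"
  let ?P = "PiM {1..n} (\<lambda>_. Q)"
  interpret P: prob_space ?P by (intro prob_space_PiM prob_space_axioms)
  note sG[measurable_cong] = gaussian_lawD(2)[OF G]
  define \<delta>\<^sub>2 where "\<delta>\<^sub>2 = (ln (2 * real (card I)) + K) / \<beta>"
  have \<delta>: "\<delta> = \<delta>\<^sub>1 + 2 * \<delta>\<^sub>2" by (simp add: \<delta>_def \<delta>\<^sub>2_def)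
  have "1 \<le> real (card I)" using I I1 by (simp add: Suc_leI card_gt_0_iff)
  then have \<delta>0: "0 \<le> \<delta>" using K \<beta> \<delta>\<^sub>1 by (simp add: \<delta>_def)
  define W where "W w i = (\<Sum>l\<in>{1..n}. (w l i - (\<integral>x. x i \<partial>Q)) / sqrt (real n))" for w :: "nat \<Rightarrow> 'i \<Rightarrow> real" and i
  define V where "V w i = (\<Sum>l\<in>{1..n}. centered_truncation \<tau> (w l) i / sqrt (real n))" for w :: "nat \<Rightarrow> 'i \<Rightarrow> real" and i
  have [measurable]: "(\<lambda>w. W w i) \<in> borel_measurable ?P" "(\<lambda>w. V w i) \<in> borel_measurable ?P" if i: "i \<in> I" for i
  proof -
    have [measurable]: "(\<lambda>w. w l i) \<in> borel_measurable ?P" "(\<lambda>w. centered_truncation \<tau> (w l) i) \<in> borel_measurable ?P"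
      if "l \<in> {1..n}" for l
      using that coordinate_measurable[OF i] centered_truncation_facts(1)[OF \<tau>1[folded \<tau>_def] i]
      by (auto intro: measurable_PiM_component_rev)
    show "(\<lambda>w. W w i) \<in> borel_measurable ?P" "(\<lambda>w. V w i) \<in> borel_measurable ?P"
      unfolding W_def V_def
      by (intro borel_measurable_sum borel_measurable_divide borel_measurable_diff borel_measurable_const; measurable)+
  qed
  have [measurable]: "(\<lambda>y. y i) \<in> borel_measurable G" if "i \<in> I" for i using that by measurable
  let ?PW = "\<lambda>t. measure ?P {w \<in> space ?P. \<forall>i\<in>I. \<bar>W w i\<bar> \<le> t}"
  let ?PV = "\<lambda>t. measure ?P {w \<in> space ?P. \<forall>i\<in>I. \<bar>V w i\<bar> \<le> t}"
  let ?PY = "\<lambda>t. measure G {y \<in> space G. \<forall>i\<in>I. \<bar>y i\<bar> \<le> t}"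
  let ?N = "{w \<in> space ?P. \<exists>i\<in>I. \<delta>\<^sub>1 < \<bar>W w i - V w i\<bar>}"
  have ev: "{w \<in> space ?P. \<forall>i\<in>I. \<bar>W w i\<bar> \<le> t} \<in> sets ?P" "{w \<in> space ?P. \<forall>i\<in>I. \<bar>V w i\<bar> \<le> t} \<in> sets ?P"
    "?N \<in> sets ?P" for t
    using I by measurable
  have \<tau>0: "0 < \<tau>" using \<tau>1 by (simp add: \<tau>_def)
  have N: "measure ?P ?N \<le> ?\<eta>"
    using truncation_error_prob[OF n \<tau>0 \<delta>\<^sub>1] unfolding W_def V_def .
  have close: "measure ?P {w \<in> space ?P. \<forall>i\<in>I. \<bar>A w i\<bar> \<le> t} \<le>
      measure ?P {w \<in> space ?P. \<forall>i\<in>I. \<bar>B w i\<bar> \<le> t + \<delta>\<^sub>1} + ?\<eta>"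
    if ev': "{w \<in> space ?P. \<forall>i\<in>I. \<bar>B w i\<bar> \<le> t + \<delta>\<^sub>1} \<in> sets ?P"
      and AB: "\<And>w i. \<bar>B w i\<bar> \<le> \<bar>A w i\<bar> + \<bar>W w i - V w i\<bar>" for A B t
  proof -
    have "measure ?P {w \<in> space ?P. \<forall>i\<in>I. \<bar>A w i\<bar> \<le> t} \<le>
        measure ?P ({w \<in> space ?P. \<forall>i\<in>I. \<bar>B w i\<bar> \<le> t + \<delta>\<^sub>1} \<union> ?N)"
      using ev ev' AB by (intro P.finite_measure_mono) (auto simp: not_less intro: order_trans[OF AB add_mono])
    also have "\<dots> \<le> measure ?P {w \<in> space ?P. \<forall>i\<in>I. \<bar>B w i\<bar> \<le> t + \<delta>\<^sub>1} + measure ?P ?N"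
      using ev ev' by (intro measure_Un_le) auto
    finally show ?thesis using N by linarith
  qed
  have WV: "?PW t \<le> ?PV (t + \<delta>\<^sub>1) + ?\<eta>" for t
    by (rule close[OF ev(2)]) linarith
  have VW: "?PV t \<le> ?PW (t + \<delta>\<^sub>1) + ?\<eta>" for t
    by (rule close[OF ev(1)]) linarith
  have cmp: "\<bar>(\<integral>w. soft_box I \<beta> s (V w) \<partial>?P) - (\<integral>y. soft_box I \<beta> s y \<partial>G)\<bar> \<le> ?E" for s
    unfolding V_def[abs_def] \<tau>_def by (rule soft_box_comparison[OF n \<beta> \<tau>1 m])
  have VY: "?PV t \<le> ?PY (t + 2 * \<delta>\<^sub>2) + 2 * exp (- K) + ?E" for t
    unfolding \<delta>\<^sub>2_def
    by (rule box_prob_le_of_soft_box[OF P.prob_space_axioms G.prob_space_axioms I \<beta> K _ _ cmp I1]) measurable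
  have cmp': "\<bar>(\<integral>y. soft_box I \<beta> s y \<partial>G) - (\<integral>w. soft_box I \<beta> s (V w) \<partial>?P)\<bar> \<le> ?E" for s
    using cmp[of s] by (simp add: abs_minus_commute)
  have YV: "?PY t \<le> ?PV (t + 2 * \<delta>\<^sub>2) + 2 * exp (- K) + ?E" for t
    unfolding \<delta>\<^sub>2_def
    by (rule box_prob_le_of_soft_box[OF G.prob_space_axioms P.prob_space_axioms I \<beta> K _ _ cmp' I1]) measurable
  have sym: "\<Sigma> i k = \<Sigma> k i" if "i \<in> I" "k \<in> I" for i k
    using G_cov[OF that] G_cov[OF that(2,1)] by (simp add: mult.commute)
  have anti: "?PY (t + \<delta>) \<le> ?PY t + ?anti" for t
    by (rule gaussian_abs_max_anticoncentration[OF I I1 G b sym \<delta>0 \<delta>b])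
  have "?PW t \<le> ?PY t + ?anti + 2 * exp (- K) + ?E + ?\<eta>"
    using WV[of t] VY[of "t + \<delta>\<^sub>1"] anti[of t] unfolding \<delta> by (simp add: add.assoc)
  \<comment> \<open>Here anti-concentration comes first and lowers the threshold to
    \<open>t - \<delta>\<close>, so that the two later shifts end exactly at
    \<open>t\<close>.\<close>
  moreover have "?PY t \<le> ?PW t + ?anti + 2 * exp (- K) + ?E + ?\<eta>"
    using anti[of "t - \<delta>"] YV[of "t - \<delta>"] VW[of "t - \<delta>\<^sub>1"] unfolding \<delta> by simp
  ultimately show ?thesis
    unfolding W_def approximation_error_def \<delta>_def[symmetric] \<tau>_def[symmetric] by linarith
qed

end

subsection \<open>The triangular array\<close>

text \<open>A nondegenerate normal variable is reduced to the standard one, its location parameter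
  being 0 because the mean is. A degenerate one is almost surely 0, which the formula covers with
  variance 0.\<close>

lemma centered_gaussian_variable:
  assumes N: "prob_space N" and Z: "gaussian_variable N Z" and mean: "(\<integral>\<omega>. Z \<omega> \<partial>N) = 0"
  shows "integrable N (\<lambda>\<omega>. (Z \<omega>)\<^sup>2)" "integrable N Z"
    "(\<integral>\<omega>. iexp (Z \<omega>) \<partial>N) = complex_of_real (exp (- (\<integral>\<omega>. (Z \<omega>)\<^sup>2 \<partial>N) / 2))"
proof -
  interpret prob_space N by fact
  have m[measurable]: "Z \<in> borel_measurable N" using Z by (simp add: gaussian_variable_def)
  consider (normal) \<mu> \<sigma> where "\<sigma> > 0" "distributed N lborel Z (normal_density \<mu> \<sigma>)"
    | (const) c where "AE \<omega> in N. Z \<omega> = c"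
    using Z by (auto simp: gaussian_variable_def)
  then have "integrable N (\<lambda>\<omega>. (Z \<omega>)\<^sup>2) \<and> integrable N Z \<and>
    (\<integral>\<omega>. iexp (Z \<omega>) \<partial>N) = complex_of_real (exp (- (\<integral>\<omega>. (Z \<omega>)\<^sup>2 \<partial>N) / 2))"
  proof cases
    case normal
    define S where "S \<omega> = (Z \<omega> - \<mu>) / \<sigma>" for \<omega>
    have [measurable]: "S \<in> borel_measurable N" unfolding S_def by measurable
    have "distributed N lborel S std_normal_density"
      using normal normal_standard_normal_convert[of \<sigma> Z \<mu>] by (simp add: S_def[abs_def])
    then have D: "distr N borel S = std_normal_distribution"
      using distributed_distr_eq_density by (metis distr_cong sets_lborel)
    have mom: "integrable N (\<lambda>\<omega>. S \<omega> ^ k)" "(\<integral>\<omega>. S \<omega> ^ k \<partial>N) = (\<integral>x. x ^ k \<partial>std_normal_distribution)" for k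
      using integrable_std_normal_distribution_moment[of k]
      unfolding D[symmetric] by (auto simp: integrable_distr_eq integral_distr)
    have S1: "integrable N S" "(\<integral>\<omega>. S \<omega> \<partial>N) = 0"
      using mom[of 1] integral_std_normal_distribution_moment_odd[of 1] by auto
    have S2: "integrable N (\<lambda>\<omega>. (S \<omega>)\<^sup>2)" "(\<integral>\<omega>. (S \<omega>)\<^sup>2 \<partial>N) = 1"
      using mom[of 2] std_normal_distribution_even_moments(1)[of 1] by (auto simp: fact_numeral)
    have Z_eq: "Z \<omega> = \<mu> + \<sigma> * S \<omega>" for \<omega> using normal by (simp add: S_def)
    have "(\<integral>\<omega>. Z \<omega> \<partial>N) = \<mu>" unfolding Z_eq using S1 by (simp add: prob_space)
    then have Z_eq: "Z = (\<lambda>\<omega>. \<sigma> * S \<omega>)" using Z_eq mean by auto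
    have "(\<integral>\<omega>. iexp (Z \<omega>) \<partial>N) = (\<integral>x. iexp (\<sigma> * x) \<partial>std_normal_distribution)"
      unfolding D[symmetric] Z_eq by (subst integral_distr) auto
    also have "\<dots> = complex_of_real (exp (- (\<sigma>\<^sup>2) / 2))" by (rule iexp_scaled_std_normal)
    finally show ?thesis using S1 S2 by (simp add: Z_eq power_mult_distrib)
  next
    case const
    have "(\<integral>\<omega>. Z \<omega> \<partial>N) = (\<integral>\<omega>. c \<partial>N)" using const by (intro integral_cong_AE) auto
    then have "c = 0" using mean by (simp add: prob_space)
    then have AE: "AE \<omega> in N. Z \<omega> = 0" using const by simp
    have "(\<integral>\<omega>. iexp (Z \<omega>) \<partial>N) = (\<integral>\<omega>. 1 \<partial>N)" using AE by (intro integral_cong_AE) auto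
    moreover have "(\<integral>\<omega>. (Z \<omega>)\<^sup>2 \<partial>N) = (\<integral>\<omega>. 0 \<partial>N)" using AE by (intro integral_cong_AE) auto
    moreover have "integrable N (\<lambda>\<omega>. (Z \<omega>)\<^sup>2) \<longleftrightarrow> integrable N (\<lambda>\<omega>. 0 :: real)" using AE by (intro integrable_cong_AE) auto
    moreover have "integrable N Z \<longleftrightarrow> integrable N (\<lambda>\<omega>. 0 :: real)" using AE by (intro integrable_cong_AE) auto
    ultimately show ?thesis by (simp add: prob_space)
  qed
  then show "integrable N (\<lambda>\<omega>. (Z \<omega>)\<^sup>2)" "integrable N Z"
    "(\<integral>\<omega>. iexp (Z \<omega>) \<partial>N) = complex_of_real (exp (- (\<integral>\<omega>. (Z \<omega>)\<^sup>2 \<partial>N) / 2))" by auto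
qed

text \<open>The characteristic function of the vector at \<open>a\<close> is that of the real
  Gaussian variable \<open>\<Sum>j=1..p. a j * Y \<omega> j\<close> at 1, whose variance is the
  quadratic form.\<close>

lemma gaussian_vector_law:
  assumes N: "prob_space N" and Y: "gaussian_vector N p Y"
    and mean: "\<And>j. j \<in> {1..p} \<Longrightarrow> (\<integral>\<omega>. Y \<omega> j \<partial>N) = 0"
    and cov: "\<And>j k. j \<in> {1..p} \<Longrightarrow> k \<in> {1..p} \<Longrightarrow> covariance N (\<lambda>\<omega>. Y \<omega> j) (\<lambda>\<omega>. Y \<omega> k) = \<Sigma> j k"
  defines "G \<equiv> distr N (vec_space p) Y"
  shows "gaussian_law {1..p} \<Sigma> G"
    and "\<And>j. j \<in> {1..p} \<Longrightarrow> (\<integral>y. y j \<partial>G) = 0"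
    and "\<And>j k. j \<in> {1..p} \<Longrightarrow> k \<in> {1..p} \<Longrightarrow> (\<integral>y. y j * y k \<partial>G) = \<Sigma> j k"
proof -
  let ?Z = "\<lambda>a \<omega>. \<Sum>j\<in>{1..p}. a j * Y \<omega> j"
  interpret prob_space N by fact
  let ?I = "{1..p}"
  have m[measurable]: "Y \<in> measurable N (vec_space p)" using Y by (simp add: gaussian_vector_def)
  have mj: "(\<lambda>y. y j) \<in> borel_measurable (vec_space p)" if "j \<in> ?I" for j
    using that by (rule measurable_component_singleton)
  have mY[measurable]: "(\<lambda>\<omega>. Y \<omega> j) \<in> borel_measurable N" if "j \<in> ?I" for j
    by (rule measurable_compose[OF m mj[OF that]])
  have lin: "gaussian_variable N (\<lambda>\<omega>. ?Z a \<omega>)" for a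
    using Y by (simp add: gaussian_vector_def)
  have coord: "gaussian_variable N (\<lambda>\<omega>. Y \<omega> j)" if "j \<in> ?I" for j
    using lin[of "\<lambda>i. if i = j then 1 else 0"] sum_single_coordinate(1)[of ?I j 1] that by simp
  have int: "integrable N (\<lambda>\<omega>. Y \<omega> j)" "integrable N (\<lambda>\<omega>. (Y \<omega> j)\<^sup>2)" if "j \<in> ?I" for j
    using centered_gaussian_variable[OF N coord mean] that by auto
  have int2: "integrable N (\<lambda>\<omega>. Y \<omega> j * Y \<omega> k)" if jk: "j \<in> ?I" "k \<in> ?I" for j k
  proof (rule Bochner_Integration.integrable_bound[where f="\<lambda>\<omega>. (Y \<omega> j)\<^sup>2 + (Y \<omega> k)\<^sup>2"])
    show "integrable N (\<lambda>\<omega>. (Y \<omega> j)\<^sup>2 + (Y \<omega> k)\<^sup>2)"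
      using int jk by (intro Bochner_Integration.integrable_add)
    show "(\<lambda>\<omega>. Y \<omega> j * Y \<omega> k) \<in> borel_measurable N"
      by (intro borel_measurable_times mY jk)
    have "\<bar>x * y\<bar> \<le> x\<^sup>2 + y\<^sup>2" for x y :: real
      using sum_squares_bound[of "\<bar>x\<bar>" "\<bar>y\<bar>"] abs_ge_zero[of "x * y"] unfolding abs_mult power2_abs by linarith
    then show "AE \<omega> in N. norm (Y \<omega> j * Y \<omega> k) \<le> norm ((Y \<omega> j)\<^sup>2 + (Y \<omega> k)\<^sup>2)" by simp
  qed
  have E2: "(\<integral>\<omega>. Y \<omega> j * Y \<omega> k \<partial>N) = \<Sigma> j k" if "j \<in> ?I" "k \<in> ?I" for j k
    using cov[OF that] mean[OF that(1)] mean[OF that(2)] by (simp add: covariance_def)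
  show "(\<integral>y. y j \<partial>G) = 0" if "j \<in> ?I" for j
    unfolding G_def using mean[OF that] by (subst integral_distr[OF m mj[OF that]])
  show "(\<integral>y. y j * y k \<partial>G) = \<Sigma> j k" if "j \<in> ?I" "k \<in> ?I" for j k
    unfolding G_def using E2[OF that] that by (subst integral_distr[OF m borel_measurable_times[OF mj mj]])
  show "gaussian_law ?I \<Sigma> G"
    unfolding gaussian_law_def
  proof (intro conjI allI)
    show "prob_space G" unfolding G_def by (rule prob_space_distr[OF m])
    show "sets G = sets (vec_space p)" by (simp add: G_def)
    fix a :: "nat \<Rightarrow> real"
    have sq: "(?Z a \<omega>)\<^sup>2 = (\<Sum>j\<in>?I. \<Sum>k\<in>?I. a j * a k * (Y \<omega> j * Y \<omega> k))" for \<omega>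
      by (simp add: power2_eq_square sum_product mult_ac)
    have "(\<integral>\<omega>. (?Z a \<omega>) \<partial>N) = (\<Sum>j\<in>?I. a j * (\<integral>\<omega>. Y \<omega> j \<partial>N))"
      using int by (subst Bochner_Integration.integral_sum) (auto simp del: atLeastAtMost_iff)
    then have 0: "(\<integral>\<omega>. (?Z a \<omega>) \<partial>N) = 0" using mean by simp
    have "(\<integral>\<omega>. (?Z a \<omega>)\<^sup>2 \<partial>N) = (\<Sum>j\<in>?I. \<integral>\<omega>. (\<Sum>k\<in>?I. a j * a k * (Y \<omega> j * Y \<omega> k)) \<partial>N)"
      unfolding sq by (intro Bochner_Integration.integral_sum Bochner_Integration.integrable_sum integrable_mult_right int2)
    also have "\<dots> = quad_form ?I \<Sigma> a"
    proof (intro sum.cong refl)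
      fix j assume j: "j \<in> ?I"
      have "(\<integral>\<omega>. (\<Sum>k\<in>?I. a j * a k * (Y \<omega> j * Y \<omega> k)) \<partial>N) = (\<Sum>k\<in>?I. \<integral>\<omega>. a j * a k * (Y \<omega> j * Y \<omega> k) \<partial>N)"
        by (intro Bochner_Integration.integral_sum integrable_mult_right int2 j)
      also have "\<dots> = (\<Sum>k\<in>?I. a j * a k * \<Sigma> j k)" using E2[OF j] by (intro sum.cong refl) simp
      finally show "(\<integral>\<omega>. (\<Sum>k\<in>?I. a j * a k * (Y \<omega> j * Y \<omega> k)) \<partial>N) = (\<Sum>k\<in>?I. a j * a k * \<Sigma> j k)" .
    qed
    finally have 2: "(\<integral>\<omega>. (?Z a \<omega>)\<^sup>2 \<partial>N) = quad_form ?I \<Sigma> a" .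
    have "(\<integral>y. iexp (\<Sum>j\<in>?I. a j * y j) \<partial>G) = (\<integral>\<omega>. iexp (?Z a \<omega>) \<partial>N)"
      unfolding G_def using mj by (intro integral_distr[OF m]) (measurable; assumption)
    then show "(\<integral>y. iexp (\<Sum>j\<in>?I. a j * y j) \<partial>G) = complex_of_real (exp (- quad_form ?I \<Sigma> a / 2))"
      using centered_gaussian_variable(3)[OF N lin 0] unfolding 2 by simp
  qed
qed

section \<open>From a row of the array to laws on product spaces\<close>

lemma max_norm_le_iff:
  assumes "1 \<le> p" shows "max_norm p x \<le> t \<longleftrightarrow> (\<forall>j\<in>{1..p}. \<bar>x j\<bar> \<le> t)"
  using assms unfolding max_norm_def by (subst Max_le_iff) auto

lemma iid_law:
  fixes X :: "nat \<Rightarrow> 'a \<Rightarrow> nat \<Rightarrow> real"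
  assumes M: "prob_space M" and n: "1 \<le> n" and indep: "prob_space.indep_vars M (\<lambda>_. vec_space p) X {1..n}"
    and ident: "\<And>i. i \<in> {1..n} \<Longrightarrow> distr M (vec_space p) (X i) = Q"
  shows "distr M (PiM {1..n} (\<lambda>_. vec_space p)) (\<lambda>\<omega>. \<lambda>i\<in>{1..n}. X i \<omega>) = PiM {1..n} (\<lambda>_. Q)"
proof -
  interpret prob_space M by fact
  have "distr M (PiM {1..n} (\<lambda>_. vec_space p)) (\<lambda>\<omega>. \<lambda>i\<in>{1..n}. X i \<omega>) = PiM {1..n} (\<lambda>i. distr M (vec_space p) (X i))"
  proof (subst indep_vars_iff_distr_eq_PiM'[symmetric])
    show "{1..n} \<noteq> {}" using n by simp
    show "random_variable (vec_space p) (X i)" if "i \<in> {1..n}" for i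
      using indep that unfolding indep_vars_def by blast
  qed (rule indep)
  also have "\<dots> = PiM {1..n} (\<lambda>_. Q)" by (intro PiM_cong refl ident)
  finally show ?thesis .
qed

text \<open>Both probabilities depend only on laws: the row has law \<open>Q\<close> to the power
  \<open>n\<close>, with \<open>Q\<close> the law of its first member, and \<open>Y\<close> has law
  \<open>G\<close>. The bound for product spaces then applies.\<close>

lemma sample_mean_distance_le:
  fixes X :: "nat \<Rightarrow> 'a \<Rightarrow> nat \<Rightarrow> real" and Y :: "'b \<Rightarrow> nat \<Rightarrow> real"
  assumes q: "3 \<le> q" and C: "0 \<le> C" and b: "0 < b" and n: "1 \<le> n" and p: "1 \<le> p"
    and M: "prob_space M"
    and indep: "prob_space.indep_vars M (\<lambda>_. vec_space p) X {1..n}"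
    and ident: "\<And>i i'. i \<in> {1..n} \<Longrightarrow> i' \<in> {1..n} \<Longrightarrow> distr M (vec_space p) (X i) = distr M (vec_space p) (X i')"
    and mean: "\<And>i j. i \<in> {1..n} \<Longrightarrow> j \<in> {1..p} \<Longrightarrow> (\<integral>\<omega>. X i \<omega> j \<partial>M) = \<mu> j"
    and cov: "\<And>i j k. i \<in> {1..n} \<Longrightarrow> j \<in> {1..p} \<Longrightarrow> k \<in> {1..p} \<Longrightarrow>
      covariance M (\<lambda>\<omega>. X i \<omega> j) (\<lambda>\<omega>. X i \<omega> k) = \<Sigma> j k"
    and moment: "\<And>i. i \<in> {1..n} \<Longrightarrow> (MAX j\<in>{1..p}. \<integral>\<^sup>+\<omega>. ennreal (\<bar>X i \<omega> j\<bar> powr q) \<partial>M) \<le> ennreal C"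
    and var: "\<And>i j. i \<in> {1..n} \<Longrightarrow> j \<in> {1..p} \<Longrightarrow> prob_space.variance M (\<lambda>\<omega>. X i \<omega> j) \<ge> b"
    and N: "prob_space N" and gauss: "gaussian_vector N p Y"
    and gauss_mean: "\<And>j. j \<in> {1..p} \<Longrightarrow> (\<integral>\<omega>. Y \<omega> j \<partial>N) = 0"
    and gauss_cov: "\<And>j k. j \<in> {1..p} \<Longrightarrow> k \<in> {1..p} \<Longrightarrow> covariance N (\<lambda>\<omega>. Y \<omega> j) (\<lambda>\<omega>. Y \<omega> k) = \<Sigma> j k"
    and \<beta>: "0 < \<beta>" "1 \<le> sqrt (real n) / \<beta>" and m: "2 \<le> m" and K: "0 \<le> K" and \<delta>: "0 < \<delta>"
    and \<delta>b: "\<delta> + 2 * ((ln (2 * real p) + K) / \<beta>) \<le> sqrt b"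
  shows "\<bar>measure M {\<omega> \<in> space M. sqrt (real n) * max_norm p (\<lambda>j. sample_mean n X \<omega> j - \<mu> j) \<le> t}
      - measure N {\<omega> \<in> space N. max_norm p (Y \<omega>) \<le> t}\<bar> \<le> approximation_error q C b m n p \<beta> K \<delta>"
proof -
  let ?x = "\<lambda>j \<omega>. \<bar>X 1 \<omega> j\<bar> powr q"
  let ?A = "{\<omega> \<in> space M. sqrt (real n) * max_norm p (\<lambda>j. sample_mean n X \<omega> j - \<mu> j) \<le> t}"
    and ?B = "{\<omega> \<in> space N. max_norm p (Y \<omega>) \<le> t}"
    and ?C = "{y \<in> space (vec_space p). \<forall>j\<in>{1..p}. \<bar>y j\<bar> \<le> t}"
  interpret M: prob_space M by fact
  interpret N: prob_space N by fact
  let ?I = "{1..p}"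
  define Q where "Q = distr M (vec_space p) (X 1)"
  define G where "G = distr N (vec_space p) Y"
  have one: "1 \<in> {1..n}" using n by simp
  have X: "X i \<in> measurable M (vec_space p)" if "i \<in> {1..n}" for i
    using indep that unfolding M.indep_vars_def by blast
  have mY: "Y \<in> measurable N (vec_space p)" using gauss by (simp add: gaussian_vector_def)
  have mj: "(\<lambda>y. y j) \<in> borel_measurable (vec_space p)" if "j \<in> ?I" for j
    using that by (rule measurable_component_singleton)
  have X1j: "(\<lambda>\<omega>. X 1 \<omega> j) \<in> borel_measurable M" if "j \<in> ?I" for j
    by (rule measurable_compose[OF X[OF one] mj[OF that]])
  have law: "distr M (PiM {1..n} (\<lambda>_. vec_space p)) (\<lambda>\<omega>. \<lambda>i\<in>{1..n}. X i \<omega>) = PiM {1..n} (\<lambda>_. Q)"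
    unfolding Q_def by (rule iid_law[OF M n indep ident[OF _ one]])
  \<comment> \<open>The moment bound lives in the extended nonnegative reals, so it supplies
    integrability; a real-valued integral would default to 0 for a non-integrable power.\<close>
  have nn: "(\<integral>\<^sup>+\<omega>. ennreal (?x j \<omega>) \<partial>M) \<le> ennreal C" if "j \<in> ?I" for j
    using moment[OF one] that by (subst (asm) Max_le_iff) auto
  have powr_int: "integrable M (\<lambda>\<omega>. ?x j \<omega>)" "(\<integral>\<omega>. ?x j \<omega> \<partial>M) \<le> C" if j: "j \<in> ?I" for j
  proof -
    note [measurable] = X1j[OF j]
    show int: "integrable M (\<lambda>\<omega>. ?x j \<omega>)"
    proof (rule integrableI_bounded)
      show "(\<lambda>\<omega>. ?x j \<omega>) \<in> borel_measurable M" by measurable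
      have "(\<integral>\<^sup>+\<omega>. ennreal (norm (?x j \<omega>)) \<partial>M) = (\<integral>\<^sup>+\<omega>. ennreal (?x j \<omega>) \<partial>M)"
        by simp
      also have "\<dots> < \<infinity>" using nn[OF j] by (rule le_less_trans) simp
      finally show "(\<integral>\<^sup>+\<omega>. ennreal (norm (?x j \<omega>)) \<partial>M) < \<infinity>" .
    qed
    have "ennreal (\<integral>\<omega>. ?x j \<omega> \<partial>M) \<le> ennreal C"
      using nn[OF j] by (subst nn_integral_eq_integral[OF int, symmetric]) auto
    then show "(\<integral>\<omega>. ?x j \<omega> \<partial>M) \<le> C" using C by (simp add: ennreal_le_iff)
  qed
  have EX: "(\<integral>x. x j \<partial>Q) = \<mu> j" if j: "j \<in> ?I" for j
    unfolding Q_def using mean[OF one j] by (subst integral_distr[OF X[OF one] mj[OF j]])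
  have CX: "(\<integral>x. (x j - \<mu> j) * (x k - \<mu> k) \<partial>Q) = \<Sigma> j k" if jk: "j \<in> ?I" "k \<in> ?I" for j k
    unfolding Q_def using cov[OF one jk] mean[OF one jk(1)] mean[OF one jk(2)] jk
    by (subst integral_distr[OF X[OF one]])
      (auto intro!: borel_measurable_times borel_measurable_diff mj simp: covariance_def simp del: atLeastAtMost_iff)
  interpret gaussian_approximation Q ?I q C \<Sigma> G b
  proof (intro gaussian_approximation.intro bounded_moments.intro bounded_moments_axioms.intro
      gaussian_approximation_axioms.intro)
    show "prob_space Q" unfolding Q_def by (rule M.prob_space_distr[OF X[OF one]])
    show "sets Q = sets (vec_space p)" by (simp add: Q_def)
    show "integrable Q (\<lambda>x. \<bar>x j\<bar> powr q)" if j: "j \<in> ?I" for j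
      unfolding Q_def using powr_int(1)[OF j] mj[OF j] by (subst integrable_distr_eq[OF X[OF one]]) auto
    show "(\<integral>x. \<bar>x j\<bar> powr q \<partial>Q) \<le> C" if j: "j \<in> ?I" for j
      unfolding Q_def using powr_int(2)[OF j] mj[OF j] by (subst integral_distr[OF X[OF one]]) auto
    show "(\<integral>y. y j \<partial>G) = 0" if "j \<in> ?I" for j
      unfolding G_def by (rule gaussian_vector_law(2)[OF N gauss gauss_mean gauss_cov that])
    show "gaussian_law ?I \<Sigma> G"
      unfolding G_def by (rule gaussian_vector_law(1)[OF N gauss gauss_mean gauss_cov])
    show "(\<integral>y. y j * y k \<partial>G) = \<Sigma> j k" if "j \<in> ?I" "k \<in> ?I" for j k
      unfolding G_def by (rule gaussian_vector_law(3)[OF N gauss gauss_mean gauss_cov that])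
    show "(\<integral>x. (x j - (\<integral>x. x j \<partial>Q)) * (x k - (\<integral>x. x k \<partial>Q)) \<partial>Q) = \<Sigma> j k" if "j \<in> ?I" "k \<in> ?I" for j k
      using CX[OF that] EX[OF that(1)] EX[OF that(2)] by simp
    show "b \<le> \<Sigma> j j" if j: "j \<in> ?I" for j
      using var[OF one j] unfolding cov[OF one j j, symmetric] covariance_def power2_eq_square .
    show "finite ?I" by (rule finite_atLeastAtMost)
    show "?I \<noteq> {}" using p by simp
  qed (rule q C b)+
  let ?P = "PiM {1..n} (\<lambda>_. Q)"
  let ?W = "{w \<in> space ?P. \<forall>j\<in>?I. \<bar>\<Sum>l\<in>{1..n}. (w l j - (\<integral>x. x j \<partial>Q)) / sqrt (real n)\<bar> \<le> t}"
  have W: "measure M ?A = measure ?P ?W"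
  proof -
    let ?F = "\<lambda>\<omega>. \<lambda>i\<in>{1..n}. X i \<omega>"
    let ?S = "\<lambda>\<omega> j. \<Sum>l\<in>{1..n}. (?F \<omega> l j - (\<integral>x. x j \<partial>Q)) / sqrt (real n)"
      and ?m = "\<lambda>\<omega> j. sample_mean n X \<omega> j - \<mu> j"
    have F: "?F \<in> measurable M (PiM {1..n} (\<lambda>_. vec_space p))"
    proof (rule measurable_restrict)
      show "X i \<in> measurable M (vec_space p)" if "i \<in> {1..n}" for i using that by (rule X)
    qed
    have setsP: "sets ?P = sets (PiM {1..n} (\<lambda>_. vec_space p))"
      by (intro sets_PiM_cong refl sets_Q)
    note spP = sets_eq_imp_space_eq[OF setsP]
    have comp: "(\<lambda>w. w l j) \<in> borel_measurable ?P" if "l \<in> {1..n}" "j \<in> ?I" for l j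
      using that coordinate_measurable by (intro measurable_PiM_component_rev)
    have "?W \<in> sets ?P"
    proof -
      have [measurable]: "(\<lambda>w. \<Sum>l\<in>{1..n}. (w l j - (\<integral>x. x j \<partial>Q)) / sqrt (real n)) \<in> borel_measurable ?P" if "j \<in> ?I" for j
        using that by (intro borel_measurable_sum borel_measurable_divide borel_measurable_diff borel_measurable_const comp)
      show ?thesis by measurable
    qed
    then have "measure ?P ?W = measure M (?F -` ?W \<inter> space M)"
      unfolding setsP by (subst law[symmetric], intro measure_distr[OF F])
    also have "?F -` ?W \<inter> space M = ?A"
    proof (intro set_eqI)
      fix \<omega>
      have s: "0 < sqrt (real n)" using n by simp
      have eq: "?S \<omega> j = sqrt (real n) * (?m \<omega> j)"
        if j: "j \<in> ?I" for j
      proof -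
        have "?S \<omega> j = ((\<Sum>l\<in>{1..n}. X l \<omega> j) - real n * \<mu> j) / sqrt (real n)"
          unfolding EX[OF j] sum_divide_distrib[symmetric] by (simp add: sum_subtractf)
        also have "(\<Sum>l\<in>{1..n}. X l \<omega> j) = real n * sample_mean n X \<omega> j"
          using n by (simp add: sample_mean_def)
        also have "(real n * sample_mean n X \<omega> j - real n * \<mu> j) / sqrt (real n) = sqrt (real n) * (?m \<omega> j)"
          using real_div_sqrt[of "real n"] unfolding right_diff_distrib[symmetric] by (simp flip: times_divide_eq_left)
        finally show ?thesis .
      qed
      have "sqrt (real n) * max_norm p (\<lambda>j. ?m \<omega> j) \<le> t \<longleftrightarrow>
          max_norm p (\<lambda>j. ?m \<omega> j) \<le> t / sqrt (real n)"
        using s by (simp add: field_simps)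
      also have "\<dots> \<longleftrightarrow> (\<forall>j\<in>?I. \<bar>sqrt (real n) * (?m \<omega> j)\<bar> \<le> t)"
        unfolding max_norm_le_iff[OF p] abs_mult using s
        by (intro ball_cong refl) (simp add: pos_le_divide_eq mult.commute)
      also have "\<dots> \<longleftrightarrow> (\<forall>j\<in>?I. \<bar>?S \<omega> j\<bar> \<le> t)"
        by (intro ball_cong refl) (simp only: eq)
      finally show "\<omega> \<in> ?F -` ?W \<inter> space M \<longleftrightarrow>
          \<omega> \<in> ?A"
        using measurable_space[OF F, of \<omega>] unfolding spP by blast
    qed
    finally show ?thesis ..
  qed
  have Y: "measure N ?B = measure G {y \<in> space G. \<forall>j\<in>?I. \<bar>y j\<bar> \<le> t}"
  proof -
    have "?C \<in> sets (vec_space p)"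
      using mj by measurable
    then have "measure G ?C =
        measure N (Y -` ?C \<inter> space N)"
      unfolding G_def by (rule measure_distr[OF mY])
    also have "Y -` ?C \<inter> space N = ?B"
      using measurable_space[OF mY] by (auto simp: max_norm_le_iff[OF p] simp del: atLeastAtMost_iff)
    finally show ?thesis by (simp add: G_def)
  qed
  show ?thesis
    unfolding W Y
    using kolmogorov_distance_le[OF n \<beta> m K \<delta>, of t] \<delta>b by simp
qed

section \<open>Choice of the parameters and the resulting rates\<close>

definition residual_error :: "real \<Rightarrow> real \<Rightarrow> real \<Rightarrow> nat \<Rightarrow> nat \<Rightarrow> nat \<Rightarrow> real" where
  "residual_error q C K m n p = (let l = 1 + ln (real p) in
      16 / 3 * exp 4 * ((1 + C) ^ 3 * (8 + abs_moment 3)) * (K ^ 6 * (l powr (9 / 2) * real n powr (- (1 / 2))))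
      + 4 * (1 + C)\<^sup>2 * (K powr (2 * q) * (l powr (3 * q / 2) * real n powr (- (q / 2 - 1))))
      + 6 * ((1 + C) ^ m * abs_moment m) * ((K\<^sup>2) ^ m *
          (real p * real n powr (1 - q / 2) * (l powr (3 / 2 * real m) * real n powr (- ((real m - q) / 2)))))
      + 2 * C * (K * K powr (2 * (q - 1)) * (real p * l powr (3 * q / 2 - 1) * real n powr (1 - q / 2))))"

text \<open>\<beta> is chosen so that the smoothing width is at most
  \<open>2 / (K * sqrt l)\<close>, the order of \<delta>. Anti-concentration multiplies by a
  multiple of \<open>sqrt l\<close>, leaving a bound of order \<open>1 / K\<close> free of
  \<open>n\<close> and \<open>p\<close>. Everything else except \<open>2 * exp (- K)\<close> is
  collected in \<open>residual_error\<close>, as constants depending on \<open>K\<close> times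
  sequences in \<open>n\<close>.\<close>

lemma approximation_error_le:
  fixes q C b K :: real and m n p :: nat
  assumes q: "3 \<le> q" and C: "0 \<le> C" and b: "0 < b" and n: "1 \<le> n" and p: "1 \<le> p" and K: "1 \<le> K"
  defines "l \<equiv> 1 + ln (real p)"
  defines "\<beta> \<equiv> K\<^sup>2 * l powr (3 / 2)" and "\<delta> \<equiv> 1 / (K * sqrt l)"
  shows "\<delta> + 2 * ((ln (2 * real p) + K) / \<beta>) \<le> 5 / K"
    and "approximation_error q C b m n p \<beta> K \<delta> \<le> 130 / (K * sqrt b) + 2 * exp (- K)
      + residual_error q C K m n p"
proof -
  let ?\<delta> = "\<delta> + 2 * ((ln (2 * real p) + K) / \<beta>)" and ?a = "1 + exp 1 * (sqrt (2 * ln (real p)) + 2)"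
  have l: "1 \<le> l" using p by (simp add: l_def)
  have n0: "0 < real n" using n by simp
  have \<beta>: "0 < \<beta>" using K l by (simp add: \<beta>_def)
  have sl: "1 \<le> sqrt l" "sqrt l = l powr (1 / 2)" "sqrt l * sqrt l = l" using l by (auto simp: powr_half_sqrt)
  have l32: "l powr (3 / 2) = l * sqrt l"
  proof -
    have "l powr (1 + 1 / 2) = l * sqrt l" using l unfolding powr_add by (simp add: powr_half_sqrt)
    then show ?thesis by simp
  qed
  have sn: "sqrt (real n) = real n powr (1 / 2)" using n0 by (simp add: powr_half_sqrt)
  have log2p: "ln (2 * real p) \<le> l" using p ln_2_less_1 by (simp add: ln_mult l_def)
  have num: "ln (2 * real p) + K \<le> 2 * (K * l)"
  proof -
    have "l \<le> K * l" "K \<le> K * l" using K l by (auto simp: mult_le_cancel_right1 mult_le_cancel_left1)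
    then show ?thesis using log2p by linarith
  qed
  have \<delta>5: "?\<delta> \<le> 5 / (K * sqrt l)"
  proof -
    have "(ln (2 * real p) + K) / \<beta> \<le> 2 * (K * l) / \<beta>" using num \<beta> by (intro divide_right_mono) auto
    also have "\<dots> = 2 / (K * sqrt l)" using K l by (simp add: \<beta>_def l32 power2_eq_square field_simps)
    finally have "(ln (2 * real p) + K) / \<beta> \<le> 2 / (K * sqrt l)" .
    moreover have "5 / (K * sqrt l) = 1 / (K * sqrt l) + 2 * (2 / (K * sqrt l))" by simp
    ultimately show ?thesis unfolding \<delta>_def by linarith
  qed
  also have "\<dots> \<le> 5 / K" using K l sl(1) by (intro divide_left_mono mult_pos_pos) (auto simp: mult_le_cancel_left1)
  finally show "?\<delta> \<le> 5 / K" .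
  \<comment> \<open>The shift is at most \<open>5 / (K * sqrt l)\<close> and the anti-concentration
    factor at most \<open>13 * sqrt l\<close>, using \<open>exp 1 \<le> 3\<close>; 130 is
    \<open>2 * 5 * 13\<close>.\<close>
  have anti: "2 * (?\<delta> / sqrt b * ?a) \<le> 130 / (K * sqrt b)"
  proof -
    have "sqrt (2 * ln (real p)) \<le> sqrt (2\<^sup>2 * l)" using p by (intro real_sqrt_le_mono) (simp add: l_def)
    then have "sqrt (2 * ln (real p)) + 2 \<le> 4 * sqrt l" using sl by (simp add: real_sqrt_mult)
    then have "exp 1 * (sqrt (2 * ln (real p)) + 2) \<le> 3 * (4 * sqrt l)"
      using p exp_le by (intro mult_mono) auto
    then have 13: "?a \<le> 13 * sqrt l" using sl by linarith
    have "(?\<delta>) / sqrt b * (?a) \<le>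
        5 / (K * sqrt l) / sqrt b * (13 * sqrt l)"
      using \<delta>5 13 b K l p by (intro mult_mono divide_right_mono) auto
    also have "\<dots> = 65 / (K * sqrt b)" using l b K by (simp add: field_simps)
    finally show ?thesis by simp
  qed
  have \<beta>_pow: "\<beta> ^ k = (K\<^sup>2) ^ k * l powr (3 / 2 * real k)" for k
    using l by (simp add: \<beta>_def power_mult_distrib powr_power mult.commute)
  have sn_pow: "sqrt (real n) ^ k = real n powr (real k / 2)" for k
    using n0 by (simp add: sn powr_power)
  have n_div: "real n / real n powr r = real n powr (1 - r)" for r
    using n0 unfolding powr_diff by simp
  have E1: "real n * (\<beta> ^ 3 / sqrt (real n) ^ 3) = K ^ 6 * (l powr (9 / 2) * real n powr (- (1 / 2)))"
  proof -
    have "real n / sqrt (real n) ^ 3 = real n powr (1 - 3 / 2)"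
      unfolding sn_pow n_div by simp
    then have eq: "real n / sqrt (real n) ^ 3 = real n powr (- (1 / 2))" by simp
    have "real n * (\<beta> ^ 3 / sqrt (real n) ^ 3) = \<beta> ^ 3 * (real n / sqrt (real n) ^ 3)" by simp
    also have "\<dots> = (K\<^sup>2) ^ 3 * l powr (9 / 2) * real n powr (- (1 / 2))" unfolding eq \<beta>_pow by simp
    finally show ?thesis by (simp add: power_mult[symmetric])
  qed
  have \<tau>_powr: "(sqrt (real n) / \<beta>) powr r = real n powr (r / 2) * \<beta> powr (- r)" for r
  proof -
    have "(sqrt (real n) / \<beta>) powr r = sqrt (real n) powr r / \<beta> powr r"
      by (rule powr_divide)
    also have "sqrt (real n) powr r = real n powr (r / 2)" unfolding sn powr_powr by simp
    finally show ?thesis unfolding powr_minus_divide by simp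
  qed
  have \<beta>_powr: "\<beta> powr r = K powr (2 * r) * l powr (3 / 2 * r)" for r
  proof -
    have "K\<^sup>2 = K powr 2" using K by (simp add: powr_numeral)
    then have "K\<^sup>2 powr r = K powr (2 * r)" by (simp only: powr_powr)
    then show ?thesis by (simp add: \<beta>_def powr_mult powr_powr)
  qed
  have E2: "real n * (\<beta>\<^sup>2 * ((sqrt (real n) / \<beta>) powr (2 - q) / real n)) =
      K powr (2 * q) * (l powr (3 * q / 2) * real n powr (- (q / 2 - 1)))"
  proof -
    have "\<beta>\<^sup>2 * (sqrt (real n) / \<beta>) powr (2 - q) = \<beta> powr 2 * \<beta> powr (q - 2) * real n powr ((2 - q) / 2)"
      using \<beta> by (simp add: \<tau>_powr powr_numeral mult_ac)
    also have "\<dots> = \<beta> powr q * real n powr (- (q / 2 - 1))"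
      by (simp add: powr_add[symmetric] diff_divide_distrib)
    finally show ?thesis unfolding \<beta>_powr using n0 by (simp add: mult_ac)
  qed
  \<comment> \<open>The exponent \<open>1 - m / 2\<close> of \<open>n\<close> is split so that one
    part compensates \<open>p\<close> and the other, negative for \<open>m > q\<close>, beats the
    power of \<open>l\<close>.\<close>
  have E3: "real n * (real p * \<beta> ^ m / sqrt (real n) ^ m) = (K\<^sup>2) ^ m *
      (real p * real n powr (1 - q / 2) * (l powr (3 / 2 * real m) * real n powr (- ((real m - q) / 2))))"
  proof -
    have "real n / sqrt (real n) ^ m = real n powr (1 - real m / 2)"
      unfolding sn_pow n_div ..
    also have "\<dots> = real n powr (1 - q / 2) * real n powr (- ((real m - q) / 2))"
      by (simp add: powr_add[symmetric] diff_divide_distrib)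
    finally have eq: "real n / sqrt (real n) ^ m = real n powr (1 - q / 2) * real n powr (- ((real m - q) / 2))" .
    have "real n * (real p * \<beta> ^ m / sqrt (real n) ^ m) = real p * \<beta> ^ m * (real n / sqrt (real n) ^ m)" by simp
    also have "\<dots> = real p * ((K\<^sup>2) ^ m * l powr (3 / 2 * real m)) * (real n powr (1 - q / 2) * real n powr (- ((real m - q) / 2)))"
      unfolding eq \<beta>_pow ..
    finally show ?thesis by (simp only: mult_ac)
  qed
  \<comment> \<open>\<open>\<beta> powr (q - 1)\<close> contributes the exponent
    \<open>3 / 2 * (q - 1)\<close> of \<open>l\<close> and \<open>1 / \<delta>\<close> another
    \<open>1 / 2\<close>. Their sum \<open>3 * q / 2 - 1\<close> is the exponent in the growth
    condition.\<close>
  have E4: "real p * sqrt (real n) * (sqrt (real n) / \<beta>) powr (1 - q) / \<delta> =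
      K * K powr (2 * (q - 1)) * (real p * l powr (3 * q / 2 - 1) * real n powr (1 - q / 2))"
  proof -
    have "sqrt (real n) * (sqrt (real n) / \<beta>) powr (1 - q) / \<delta> =
        K * (sqrt l * \<beta> powr (q - 1)) * (sqrt (real n) * real n powr ((1 - q) / 2))"
      by (simp add: \<tau>_powr \<delta>_def)
    also have "sqrt (real n) * real n powr ((1 - q) / 2) = real n powr (1 - q / 2)"
      unfolding sn by (simp add: powr_add[symmetric] diff_divide_distrib)
    also have "sqrt l * \<beta> powr (q - 1) = K powr (2 * (q - 1)) * (l powr (1 / 2) * l powr (3 / 2 * (q - 1)))"
      by (simp add: \<beta>_powr sl(2))
    also have "l powr (1 / 2) * l powr (3 / 2 * (q - 1)) = l powr (3 * q / 2 - 1)"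
      unfolding powr_add[symmetric] by (simp add: field_simps)
    finally have eq: "sqrt (real n) * (sqrt (real n) / \<beta>) powr (1 - q) / \<delta> =
        K * (K powr (2 * (q - 1)) * l powr (3 * q / 2 - 1)) * real n powr (1 - q / 2)" .
    have "real p * sqrt (real n) * (sqrt (real n) / \<beta>) powr (1 - q) / \<delta> =
        real p * (sqrt (real n) * (sqrt (real n) / \<beta>) powr (1 - q) / \<delta>)" by simp
    then show ?thesis unfolding eq by (simp only: mult_ac)
  qed
  let ?A = "(1 + C) ^ 3 * (8 + abs_moment 3)" and ?B = "(1 + C) ^ m * abs_moment m"
  \<comment> \<open>Pure regrouping with opaque letters, which spares the algebra the real powers
    and roots.\<close>
  have gen: "N * (x * b3 * (A / s3) + b2 * (c * T / N) + y * P * bm * (B / sm)) + 2 * P * sN * (C * U) / d =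
      x * A * (N * (b3 / s3)) + c * (N * (b2 * (T / N))) + y * B * (N * (P * bm / sm)) + 2 * C * (P * sN * U / d)"
    for N x b3 A s3 b2 c T y P bm B sm sN C U d :: real
    by (simp add: divide_inverse algebra_simps)
  have split: "approximation_error q C b m n p \<beta> K \<delta> =
     2 * (?\<delta> / sqrt b * ?a) + 2 * exp (- K)
      + 16 / 3 * exp 4 * ?A * (real n * (\<beta> ^ 3 / sqrt (real n) ^ 3))
      + 4 * (1 + C)\<^sup>2 * (real n * (\<beta>\<^sup>2 * ((sqrt (real n) / \<beta>) powr (2 - q) / real n)))
      + 6 * ?B * (real n * (real p * \<beta> ^ m / sqrt (real n) ^ m))
      + 2 * C * (real p * sqrt (real n) * (sqrt (real n) / \<beta>) powr (1 - q) / \<delta>)"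
    unfolding approximation_error_def
    using gen[of "real n" "16 / 3 * exp 4" "\<beta> ^ 3" ?A "sqrt (real n) ^ 3" "\<beta>\<^sup>2" "4 * (1 + C)\<^sup>2"
        "(sqrt (real n) / \<beta>) powr (2 - q)" 6 "real p" "\<beta> ^ m" ?B "sqrt (real n) ^ m" "sqrt (real n)" C
        "(sqrt (real n) / \<beta>) powr (1 - q)" \<delta>]
    by linarith
  show "approximation_error q C b m n p \<beta> K \<delta> \<le> 130 / (K * sqrt b) + 2 * exp (- K) + residual_error q C K m n p"
    unfolding split E1 E2 E3 E4 residual_error_def Let_def l_def[symmetric] using anti by linarith
qed

section \<open>Consequences of the growth condition\<close>

lemma log_powr_over_powr_tendsto_0:
  fixes k a c :: real
  assumes "0 < k" "0 < a" "0 < c"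
  shows "(\<lambda>n. (1 + k * ln (real n)) powr a * real n powr (- c)) \<longlonglongrightarrow> 0"
  using assms by real_asymp

locale growth_condition =
  fixes q :: real and p :: "nat \<Rightarrow> nat"
  assumes q: "2 < q" and p_pos: "\<And>n. n \<ge> 1 \<Longrightarrow> p n \<ge> 1"
    and growth: "(\<lambda>n. real (p n) * ln (real (p n)) powr (3 * q / 2 - 1)) \<in> o(\<lambda>n. real n powr (q / 2 - 1))"
begin

text \<open>The added 1 keeps the scale away from 0 in dimension one, where the logarithm vanishes
  and \<beta> would degenerate.\<close>

definition log_dim :: "nat \<Rightarrow> real" where "log_dim n = 1 + ln (real (p n))"

lemma log_dim_ge_1: "n \<ge> 1 \<Longrightarrow> 1 \<le> log_dim n"
  using p_pos[of n] by (simp add: log_dim_def)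

text \<open>For \<open>p n \<ge> 3\<close> the logarithm is at least 1, so \<open>log_dim n\<close>
  is at most twice it. For \<open>p n \<le> 2\<close>, where the assumed sequence may be 0, the
  first two factors are bounded and \<open>n powr (1 - q / 2)\<close> tends to 0 by itself.\<close>

lemma growth_shifted: "(\<lambda>n. real (p n) * log_dim n powr (3 * q / 2 - 1) * real n powr (1 - q / 2)) \<longlonglongrightarrow> 0"
proof -
  let ?e = "3 * q / 2 - 1"
  have e: "0 < ?e" using q by simp
  let ?a = "\<lambda>n. real (p n) * log_dim n powr ?e * real n powr (1 - q / 2)"
    and ?b = "\<lambda>n. 2 powr ?e * (real (p n) * ln (real (p n)) powr ?e / real n powr (q / 2 - 1)) + 2 * 2 powr ?e * real n powr (1 - q / 2)"
  have g: "(\<lambda>n. real (p n) * ln (real (p n)) powr ?e / real n powr (q / 2 - 1)) \<longlonglongrightarrow> 0"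
    using growth by (rule smalloD_tendsto)
  have n0: "(\<lambda>n. real n powr (1 - q / 2)) \<longlonglongrightarrow> 0"
    using q by real_asymp
  have lim: "(\<lambda>n. ?b n) \<longlonglongrightarrow> 2 powr ?e * 0 + 2 * 2 powr ?e * 0"
    by (intro tendsto_intros g n0)
  have le: "?a n \<le>
      ?b n"
    if n: "n \<ge> 1" for n
  proof -
    have "real (p n) * log_dim n powr ?e \<le> 2 powr ?e * (real (p n) * ln (real (p n)) powr ?e) + 2 * 2 powr ?e"
    proof (cases "p n \<le> 2")
      case True
      have "log_dim n \<le> 2"
      proof -
        have "ln (real (p n)) \<le> ln 2" using True p_pos[OF n] by (subst ln_le_cancel_iff) auto
        then show ?thesis using ln_2_less_1 by (simp add: log_dim_def)
      qed
      then have "real (p n) * log_dim n powr ?e \<le> 2 * 2 powr ?e"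
        using True log_dim_ge_1[OF n] e by (intro mult_mono powr_mono2) auto
      moreover have "0 \<le> 2 powr ?e * (real (p n) * ln (real (p n)) powr ?e)" by simp
      ultimately show ?thesis by linarith
    next
      case False
      then have "exp 1 \<le> real (p n)" using exp_le by linarith
      then have "1 \<le> ln (real (p n))" using False by (subst ln_ge_iff) auto
      then have "log_dim n powr ?e \<le> (2 * ln (real (p n))) powr ?e"
        using log_dim_ge_1[OF n] e by (intro powr_mono2) (auto simp: log_dim_def)
      also have "\<dots> = 2 powr ?e * ln (real (p n)) powr ?e"
        using \<open>1 \<le> ln (real (p n))\<close> by (simp add: powr_mult)
      finally have "real (p n) * log_dim n powr ?e \<le> real (p n) * (2 powr ?e * ln (real (p n)) powr ?e)"
        by (intro mult_left_mono) auto
      then show ?thesis by (simp add: mult_ac add_increasing2)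
    qed
    then have "?a n \<le>
        (2 powr ?e * (real (p n) * ln (real (p n)) powr ?e) + 2 * 2 powr ?e) * real n powr (1 - q / 2)"
      by (intro mult_right_mono) auto
    also have "\<dots> = ?b n"
    proof -
      have "real n powr (1 - q / 2) = 1 / real n powr (q / 2 - 1)"
        using powr_minus_divide[of "real n" "q / 2 - 1"] by simp
      then have "x / real n powr (q / 2 - 1) = x * real n powr (1 - q / 2)" for x by simp
      then show ?thesis by (simp only: distrib_right mult.assoc)
    qed
    finally show ?thesis .
  qed
  show ?thesis
  proof (rule tendsto_sandwich[OF _ _ tendsto_const])
    show "\<forall>\<^sub>F n in sequentially. ?a n \<le>
      ?b n"
      using le by (auto simp: eventually_sequentially)
  qed (use lim in auto)
qed

lemma dim_le_powr: "\<forall>\<^sub>F n in sequentially. real (p n) * real n powr (1 - q / 2) \<le> 1"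
proof -
  have "\<forall>\<^sub>F n in sequentially. real (p n) * log_dim n powr (3 * q / 2 - 1) * real n powr (1 - q / 2) < 1"
    using growth_shifted by (rule order_tendstoD) simp
  then show ?thesis
    using eventually_ge_at_top[of 1]
  proof eventually_elim
    case (elim n)
    have "1 \<le> log_dim n powr (3 * q / 2 - 1)" using log_dim_ge_1[OF elim(2)] q by (intro ge_one_powr_ge_zero) auto
    then have "real (p n) * 1 \<le> real (p n) * log_dim n powr (3 * q / 2 - 1)" by (intro mult_left_mono) auto
    then have "real (p n) * real n powr (1 - q / 2) \<le> real (p n) * log_dim n powr (3 * q / 2 - 1) * real n powr (1 - q / 2)"
      by (intro mult_right_mono) auto
    then show ?case using elim by linarith
  qed
qed

text \<open>Eventually \<open>p n \<le> n powr (q / 2 - 1)\<close>, so \<open>log_dim n\<close>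
  grows at most like \<open>ln n\<close> and loses against any power of \<open>n\<close>.\<close>

lemma log_dim_powr_tendsto_0:
  assumes "0 < a" "0 < c"
  shows "(\<lambda>n. log_dim n powr a * real n powr (- c)) \<longlonglongrightarrow> 0"
proof (rule tendsto_sandwich[OF _ _ tendsto_const])
  show "(\<lambda>n. (1 + (q / 2 - 1) * ln (real n)) powr a * real n powr (- c)) \<longlonglongrightarrow> 0"
    using q assms by (intro log_powr_over_powr_tendsto_0) auto
  show "\<forall>\<^sub>F n in sequentially. log_dim n powr a * real n powr (- c) \<le>
      (1 + (q / 2 - 1) * ln (real n)) powr a * real n powr (- c)"
    using dim_le_powr eventually_ge_at_top[of 1]
  proof eventually_elim
    case (elim n)
    have "real (p n) * real n powr (1 - q / 2) * real n powr (q / 2 - 1) \<le> 1 * real n powr (q / 2 - 1)"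
      using elim by (intro mult_right_mono) auto
    then have "real (p n) \<le> real n powr (q / 2 - 1)" using elim by (simp add: mult.assoc powr_add[symmetric])
    then have "ln (real (p n)) \<le> ln (real n powr (q / 2 - 1))"
      using p_pos[OF elim(2)] elim by (subst ln_le_cancel_iff) auto
    then have "log_dim n \<le> 1 + (q / 2 - 1) * ln (real n)" using elim by (simp add: log_dim_def ln_powr)
    then show ?case using log_dim_ge_1[OF elim(2)] assms by (intro mult_right_mono powr_mono2) auto
  qed
qed auto

text \<open>\<open>K\<close> stays fixed while \<open>n\<close> grows, so the powers of
  \<open>K\<close> in the residual terms are mere constants.\<close>

lemma approximation_error_eventually_less:
  assumes q3: "3 \<le> q" and C: "0 \<le> C" and b: "0 < b" and K: "1 \<le> K" and m: "q < real m" and \<epsilon>: "0 < \<epsilon>"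
  shows "\<forall>\<^sub>F n in sequentially. 1 \<le> sqrt (real n) / (K\<^sup>2 * log_dim n powr (3 / 2)) \<and>
    approximation_error q C b m n (p n) (K\<^sup>2 * log_dim n powr (3 / 2)) K (1 / (K * sqrt (log_dim n)))
      < 130 / (K * sqrt b) + 2 * exp (- K) + \<epsilon>"
proof -
  let ?r = "\<lambda>n. log_dim n powr (3 / 2 * real m) * real n powr (- ((real m - q) / 2))"
  have third: "(\<lambda>n. real (p n) * real n powr (1 - q / 2) * ?r n) \<longlonglongrightarrow> 0"
  proof (rule tendsto_sandwich[OF _ _ tendsto_const])
    show "(\<lambda>n. ?r n) \<longlonglongrightarrow> 0"
      using m q by (intro log_dim_powr_tendsto_0) auto
    show "\<forall>\<^sub>F n in sequentially. real (p n) * real n powr (1 - q / 2) * ?r n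
        \<le> ?r n"
      using dim_le_powr by eventually_elim (auto intro: mult_left_le_one_le)
  qed auto
  have "(\<lambda>n. residual_error q C K m n (p n)) \<longlonglongrightarrow> 16 / 3 * exp 4 * ((1 + C) ^ 3 * (8 + abs_moment 3)) * (K ^ 6 * 0)
      + 4 * (1 + C)\<^sup>2 * (K powr (2 * q) * 0) + 6 * ((1 + C) ^ m * abs_moment m) * ((K\<^sup>2) ^ m * 0)
      + 2 * C * (K * K powr (2 * (q - 1)) * 0)"
    unfolding residual_error_def Let_def log_dim_def[symmetric]
    using q by (intro tendsto_intros third growth_shifted log_dim_powr_tendsto_0) auto
  then have "\<forall>\<^sub>F n in sequentially. residual_error q C K m n (p n) < \<epsilon>" using \<epsilon> by (intro order_tendstoD) auto
  moreover have "(\<lambda>n. K\<^sup>2 * (log_dim n powr (3 / 2) * real n powr (- (1 / 2)))) \<longlonglongrightarrow> K\<^sup>2 * 0"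
    by (intro tendsto_intros log_dim_powr_tendsto_0) auto
  then have "\<forall>\<^sub>F n in sequentially. K\<^sup>2 * (log_dim n powr (3 / 2) * real n powr (- (1 / 2))) < 1"
    by (intro order_tendstoD) auto
  ultimately show ?thesis
    using eventually_ge_at_top[of 1]
  proof eventually_elim
    case (elim n)
    have l: "1 \<le> log_dim n" by (rule log_dim_ge_1[OF elim(3)])
    have "K\<^sup>2 * log_dim n powr (3 / 2) / sqrt (real n) < 1"
    proof -
      have "real n powr (- (1 / 2)) = 1 / sqrt (real n)"
        by (simp only: powr_minus_divide powr_half_sqrt of_nat_0_le_iff)
      then show ?thesis using elim(2) by simp
    qed
    then have "1 \<le> sqrt (real n) / (K\<^sup>2 * log_dim n powr (3 / 2))"
      using elim(3) K l by (simp add: field_simps)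
    then show ?case
      using approximation_error_le(2)[OF q3 C b elim(3) p_pos[OF elim(3)] K, of m] elim(1)
      unfolding log_dim_def by linarith
  qed
qed

end

theorem proposition2p2:
  fixes q C b :: real
    and p :: "nat \<Rightarrow> nat"
    and M :: "nat \<Rightarrow> 'a measure" and X :: "nat \<Rightarrow> nat \<Rightarrow> 'a \<Rightarrow> nat \<Rightarrow> real"
    and N :: "nat \<Rightarrow> 'b measure" and Y :: "nat \<Rightarrow> 'b \<Rightarrow> nat \<Rightarrow> real"
    and \<mu> :: "nat \<Rightarrow> nat \<Rightarrow> real" and \<Sigma> :: "nat \<Rightarrow> nat \<Rightarrow> nat \<Rightarrow> real"
  assumes "q > 3" "C > 0" "b > 0"
    and p_pos: "\<And>n. n \<ge> 1 \<Longrightarrow> p n \<ge> 1"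
    and prob_M: "\<And>n. n \<ge> 1 \<Longrightarrow> prob_space (M n)"
    and indep: "\<And>n. n \<ge> 1 \<Longrightarrow>
      prob_space.indep_vars (M n) (\<lambda>_. vec_space (p n)) (X n) {1..n}"
    and ident: "\<And>n i i'. n \<ge> 1 \<Longrightarrow> i \<in> {1..n} \<Longrightarrow> i' \<in> {1..n} \<Longrightarrow>
      distr (M n) (vec_space (p n)) (X n i) = distr (M n) (vec_space (p n)) (X n i')"
    and mean: "\<And>n i j. n \<ge> 1 \<Longrightarrow> i \<in> {1..n} \<Longrightarrow> j \<in> {1..p n} \<Longrightarrow>
      prob_space.expectation (M n) (\<lambda>\<omega>. X n i \<omega> j) = \<mu> n j"
    and cov: "\<And>n i j k. n \<ge> 1 \<Longrightarrow> i \<in> {1..n} \<Longrightarrow> j \<in> {1..p n} \<Longrightarrow> k \<in> {1..p n} \<Longrightarrow>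
      covariance (M n) (\<lambda>\<omega>. X n i \<omega> j) (\<lambda>\<omega>. X n i \<omega> k) = \<Sigma> n j k"
    and moment: "\<And>n i. n \<ge> 1 \<Longrightarrow> i \<in> {1..n} \<Longrightarrow>
      (MAX j\<in>{1..p n}. \<integral>\<^sup>+\<omega>. ennreal (\<bar>X n i \<omega> j\<bar> powr q) \<partial>M n) \<le> ennreal C"
    and var: "\<And>n i j. n \<ge> 1 \<Longrightarrow> i \<in> {1..n} \<Longrightarrow> j \<in> {1..p n} \<Longrightarrow>
      prob_space.variance (M n) (\<lambda>\<omega>. X n i \<omega> j) \<ge> b"
    and prob_N: "\<And>n. n \<ge> 1 \<Longrightarrow> prob_space (N n)"
    and gauss: "\<And>n. n \<ge> 1 \<Longrightarrow> gaussian_vector (N n) (p n) (Y n)"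
    and gauss_mean: "\<And>n j. n \<ge> 1 \<Longrightarrow> j \<in> {1..p n} \<Longrightarrow>
      prob_space.expectation (N n) (\<lambda>\<omega>. Y n \<omega> j) = 0"
    and gauss_cov: "\<And>n j k. n \<ge> 1 \<Longrightarrow> j \<in> {1..p n} \<Longrightarrow> k \<in> {1..p n} \<Longrightarrow>
      covariance (N n) (\<lambda>\<omega>. Y n \<omega> j) (\<lambda>\<omega>. Y n \<omega> k) = \<Sigma> n j k"
    and growth: "(\<lambda>n. real (p n) * ln (real (p n)) powr (3 * q / 2 - 1))
      \<in> o(\<lambda>n. real n powr (q / 2 - 1))"
  shows "(\<lambda>n. SUP t::real.
      \<bar>measure (M n) {\<omega> \<in> space (M n).
          sqrt (real n) * max_norm (p n) (\<lambda>j. sample_mean n (X n) \<omega> j - \<mu> n j) \<le> t}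
        - measure (N n) {\<omega> \<in> space (N n). max_norm (p n) (Y n \<omega>) \<le> t}\<bar>)
    \<longlonglongrightarrow> 0"
proof -
  interpret growth_condition q p
    by unfold_locales (use \<open>q > 3\<close> p_pos growth in auto)
  \<comment> \<open>Any integer above \<open>q\<close> would serve as the order of the Gaussian
    moment.\<close>
  define m where "m = nat \<lceil>q\<rceil> + 1"
  have m: "q < real m" "2 \<le> m" using \<open>q > 3\<close> unfolding m_def by linarith+
  let ?D = "\<lambda>n t. \<bar>measure (M n) {\<omega> \<in> space (M n).
          sqrt (real n) * max_norm (p n) (\<lambda>j. sample_mean n (X n) \<omega> j - \<mu> n j) \<le> t}
        - measure (N n) {\<omega> \<in> space (N n). max_norm (p n) (Y n \<omega>) \<le> t}\<bar>"
  show ?thesis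
  proof (rule tendstoI)
    fix \<epsilon> :: real assume \<epsilon>: "0 < \<epsilon>"
    \<comment> \<open>\<open>K\<close> is chosen before \<open>n\<close>: large enough that the
      errors independent of \<open>n\<close> fall below \<open>\<epsilon> / 2\<close> and that the
      shift \<open>5 / K\<close> is admissible for anti-concentration.\<close>
    have "((\<lambda>K::real. 130 / (K * sqrt b) + 2 * exp (- K)) \<longlongrightarrow> 0) at_top"
      using \<open>b > 0\<close> by real_asymp
    then have "\<forall>\<^sub>F K::real in at_top. 130 / (K * sqrt b) + 2 * exp (- K) < \<epsilon> / 2"
      using \<epsilon> by (intro order_tendstoD) auto
    moreover have "((\<lambda>K::real. 5 / K) \<longlongrightarrow> 0) at_top" by real_asymp
    then have "\<forall>\<^sub>F K::real in at_top. 5 / K < sqrt b"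
      using \<open>b > 0\<close> by (intro order_tendstoD) auto
    ultimately have "\<forall>\<^sub>F K::real in at_top. 130 / (K * sqrt b) + 2 * exp (- K) < \<epsilon> / 2 \<and> 5 / K < sqrt b \<and> 1 \<le> K"
      using eventually_ge_at_top[of "1 :: real"] by eventually_elim auto
    then obtain K where K: "130 / (K * sqrt b) + 2 * exp (- K) < \<epsilon> / 2" "5 / K < sqrt b" "1 \<le> K"
      by (auto dest: eventually_happens)
    have "\<forall>\<^sub>F n in sequentially. 1 \<le> sqrt (real n) / (K\<^sup>2 * log_dim n powr (3 / 2)) \<and>
      approximation_error q C b m n (p n) (K\<^sup>2 * log_dim n powr (3 / 2)) K (1 / (K * sqrt (log_dim n)))
        < 130 / (K * sqrt b) + 2 * exp (- K) + \<epsilon> / 4"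
      using \<open>q > 3\<close> \<open>C > 0\<close> \<open>b > 0\<close> K m \<epsilon> by (intro approximation_error_eventually_less) auto
    then show "\<forall>\<^sub>F n in sequentially. dist (SUP t. ?D n t) 0 < \<epsilon>"
      using eventually_ge_at_top[of 1]
    proof eventually_elim
      case (elim n)
      note n = elim(2)
      have l: "1 \<le> log_dim n" by (rule log_dim_ge_1[OF n])
      let ?\<beta> = "K\<^sup>2 * log_dim n powr (3 / 2)" and ?\<delta> = "1 / (K * sqrt (log_dim n))"
      have \<delta>b: "?\<delta> + 2 * ((ln (2 * real (p n)) + K) / ?\<beta>) \<le> sqrt b"
        using approximation_error_le(1)[of q C b n "p n" K] \<open>q > 3\<close> \<open>C > 0\<close> \<open>b > 0\<close> n p_pos[OF n] K
        unfolding log_dim_def by linarith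
      \<comment> \<open>Half of \<epsilon> goes to the choice of \<open>K\<close> and a quarter to
        the residual terms; the slack remains because the supremum turns a strict bound into a weak
        one.\<close>
      have D: "?D n t \<le> 3 / 4 * \<epsilon>" for t
      proof -
        have "?D n t \<le> approximation_error q C b m n (p n) ?\<beta> K ?\<delta>"
        proof (rule sample_mean_distance_le[where \<Sigma>="\<Sigma> n"])
          show "3 \<le> q" "0 \<le> C" "0 < b" using \<open>q > 3\<close> \<open>C > 0\<close> \<open>b > 0\<close> by auto
          show "0 < ?\<beta>" "0 \<le> K" "0 < ?\<delta>" using K l by auto
          show "1 \<le> sqrt (real n) / ?\<beta>" using elim by simp
        qed (fact n m(2) \<delta>b | rule p_pos prob_M indep ident mean cov moment var prob_N gauss gauss_mean gauss_cov; (assumption | rule n)+)+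
        then show ?thesis using elim K by linarith
      qed
      have "(SUP t. ?D n t) \<le> 3 / 4 * \<epsilon>" by (intro cSUP_least D) simp
      \<comment> \<open>A real supremum lies above its members only if the range is bounded, which
        the uniform bound \<open>D\<close> provides.\<close>
      moreover have "0 \<le> (SUP t. ?D n t)"
      proof (rule order_trans[OF _ cSUP_upper[of 0]])
        show "bdd_above (range (?D n))" by (rule bdd_aboveI2[where M="3 / 4 * \<epsilon>"]) (rule D)
      qed auto
      ultimately show ?case using \<epsilon> by (simp add: dist_real_def)
    qed
  qed
qed

end
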